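(* Let $n\ge 4$ and $t\ge1$ be integers, let $J\subset\{1,\dots,n\}$ contain $n$ or $n-1$, let $r_k>0$ $(k\in J)$, let $\mathcal{X}(D_n,J)=\bigcup_{k\in J} r_k v_k^{D_n}$, and consider weight functions on it taking a constant value $w_k>0$ on $r_kv_k^{D_n}$ for each $k\in J$. Then $\mathcal{X}(D_n,J)$ is not a tight Euclidean $t$-design except for the following sets (up to multiplying all radii by a common positive constant and all weights by a common positive constant), which are tight Euclidean $t$-designs with the indicated weights: On one sphere: (a) $t=7$, $n=8$, $J=\{2,7\}$, $r_2=r_7=1$, $w_2=w_7=1$; (b) $t=7$, $n=8$, $J=\{2,8\}$, $r_2=r_8=1$, $w_2=w_8=1$. On two spheres: (c) $t=5$, $n=6$, $J=\{1,5\}$, $r_1=1$, $r_5\neq1$, $w_1=1$, $w_5=\frac{9}{8r_5^4}$; (d) $t=5$, $n=6$, $J=\{1,6\}$, $r_1=1$, $r_6\neq1$, $w_1=1$, $w_6=\frac{9}{8r_6^4}$; (e) $t=7$, $n=4$, $J=\{1,2,3,4\}$, $r_1=r_3=r_4=1$, $r_2\ne1$, $w_1=w_3=w_4=1$, $w_2=\frac1{r_2^6}$.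
   Context: The group $D_n$: with $e_1,\dots,e_n$ the standard basis of $\mathbb{R}^n$, $D_n\subset O(\mathbb{R}^n)$ is the finite group generated by the reflections in the hyperplanes orthogonal to the fundamental roots $\alpha_i=e_i-e_{i+1}$ $(1\le i\le n-1)$ and $\alpha_n=e_{n-1}+e_n$. The corner vectors are the unit vectors $v_k=\frac1{\sqrt k}(e_1+\dots+e_k)$ for $1\le k\le n-2$, $v_{n-1}=\frac{1}{\sqrt n}(1,\dots,1,-1)$ and $v_n=\frac1{\sqrt n}(1,\dots,1)$. $v_k^{D_n}$ denotes the $D_n$-orbit of $v_k$. Euclidean design: let $X\subset\mathbb{R}^n$ be a finite set, let $\rho_1,\dots,\rho_p$ be the distinct norms of the vectors of $X$, let $S_i$ be the sphere of radius $\rho_i$ centered at the origin, $S=\bigcup_{i=1}^p S_i$, and $X_i=X\cap S_i$. Then $X$ is a Euclidean $t$-design (supported by $S$) if there is a weight function $w:X\to(0,\infty)$ such that $$\sum_{i=1}^p \Big(\sum_{x\in X_i} w(x)\Big)\frac{1}{|S_i|}\int_{S_i} f\,d\sigma_i=\sum_{x\in X} w(x)f(x)$$ for every polynomial $f$ of degree at most $t$, where $\sigma_i$ is the surface measure on $S_i$ and $|S_i|=\sigma_i(S_i)$ (if $S_i=\{0\}$, the average is read as $f(0)$). Tightness: let $\mathcal{P}_l(S)$ be the space of restrictions to $S$ of real polynomials of degree at most $l$, and $\mathcal{P}_l^*(S)$ the space of restrictions to $S$ of elements of $\bigoplus_{i=0}^{\lfloor l/2\rfloor}\mathrm{Hom}_{l-2i}(\mathbb{R}^n)$,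 where $\mathrm{Hom}_m(\mathbb{R}^n)$ is the space of real homogeneous polynomials of degree $m$. A Euclidean $2e$-design $X$ supported by $S$ satisfies $|X|\ge\dim\mathcal{P}_e(S)$. A Euclidean $(2e-1)$-design $X$ supported by $S$ satisfies $|X|\ge 2\dim\mathcal{P}^*_{e-1}(S)-1$ if $e$ is odd and $0\in X$, and $|X|\ge 2\dim\mathcal{P}^*_{e-1}(S)$ otherwise. A Euclidean $t$-design is tight if equality holds in the corresponding bound.
   Formalization: The list of exceptions is completed by two sets omitted in the statement: t=3, n=4, J={3} and t=3, n=4, J={4} (any radius and weight); each orbit is an 8-point cross-polytope and is a tight Euclidean 3-design, so the claim with only (a)–(e) is false. *)

theory Defs
  imports
    "HOL-Analysis.Analysis"
    "HOL-Algebra.Generated_Groups"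
    "HOL-Algebra.Bij"
    "HOL-Library.Function_Algebras"
begin

section \<open>Spaces of polynomial functions\<close>

text \<open>Polynomials are identified with the functions they induce; the space of real-valued
  functions carries the pointwise operations.\<close>

interpretation fun_space: vector_space "\<lambda>(c::real) (f::'a \<Rightarrow> real) x. c * f x"
  by unfold_locales (auto simp: fun_eq_iff algebra_simps)

definition monomial :: "('a::euclidean_space \<Rightarrow> nat) \<Rightarrow> 'a \<Rightarrow> real" where
  "monomial \<alpha> x = (\<Prod>b\<in>Basis. (x \<bullet> b) ^ \<alpha> b)"

definition poly_space :: "nat \<Rightarrow> ('a::euclidean_space \<Rightarrow> real) set" where
  "poly_space l = fun_space.span {monomial \<alpha> | \<alpha>. sum \<alpha> Basis \<le> l}"

definition Hom :: "nat \<Rightarrow> ('a::euclidean_space \<Rightarrow> real) set" where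
  "Hom m = fun_space.span {monomial \<alpha> | \<alpha>. sum \<alpha> Basis = m}"

definition parity_poly_space :: "nat \<Rightarrow> ('a::euclidean_space \<Rightarrow> real) set" where
  "parity_poly_space l = fun_space.span (\<Union>i\<in>{0..l div 2}. Hom (l - 2 * i))"

text \<open>A function on \<open>S\<close> is represented by its extension by zero, so that restriction to \<open>S\<close>
  is a linear map and the functions on \<open>S\<close> form a linear subspace.\<close>

definition restrict_zero :: "'a set \<Rightarrow> ('a \<Rightarrow> real) \<Rightarrow> 'a \<Rightarrow> real" where
  "restrict_zero S f = (\<lambda>x. if x \<in> S then f x else 0)"

definition dim_poly_on :: "nat \<Rightarrow> 'a::euclidean_space set \<Rightarrow> nat" where
  "dim_poly_on l S = fun_space.dim (restrict_zero S ` poly_space l)"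

definition dim_parity_poly_on :: "nat \<Rightarrow> 'a::euclidean_space set \<Rightarrow> nat" where
  "dim_parity_poly_on l S = fun_space.dim (restrict_zero S ` parity_poly_space l)"


section \<open>Surface measure on spheres\<close>

text \<open>The surface measure on the sphere of radius \<open>\<rho> > 0\<close> about the origin, as a Borel measure
  on the whole space concentrated on the sphere. It is given by polar coordinates: a Borel set
  \<open>A\<close> of the sphere has measure \<open>DIM('a) / \<rho>\<close> times the Lebesgue measure of the
  cone \<open>{s *\<^sub>R x | s x. 0 < s \<and> s \<le> 1 \<and> x \<in> A}\<close>, which is the preimage of \<open>A\<close> under the radial
  projection of the punctured ball onto the sphere.\<close>

definition surface_measure :: "real \<Rightarrow> 'a::euclidean_space measure" where
  "surface_measure \<rho> =
     scale_measure (ennreal (real DIM('a) / \<rho>))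
       (distr (restrict_space lborel (cball 0 \<rho> - {0})) borel (\<lambda>x. (\<rho> / norm x) *\<^sub>R x))"

definition sphere_mean :: "real \<Rightarrow> ('a::euclidean_space \<Rightarrow> real) \<Rightarrow> real" where
  "sphere_mean \<rho> f =
     (if \<rho> = 0 then f 0
      else 1 / measure (surface_measure \<rho>) (sphere (0::'a) \<rho>)
             * (LINT x:sphere 0 \<rho>|surface_measure \<rho>. f x))"


section \<open>Euclidean designs and tightness\<close>

definition euclidean_design :: "nat \<Rightarrow> 'a::euclidean_space set \<Rightarrow> ('a \<Rightarrow> real) \<Rightarrow> bool" where
  "euclidean_design t X w \<longleftrightarrow>
     finite X \<and> (\<forall>x\<in>X. w x > 0) \<and>
     (\<forall>f\<in>poly_space t.
        (\<Sum>\<rho>\<in>norm ` X. (\<Sum>x\<in>X \<inter> sphere 0 \<rho>. w x) * sphere_mean \<rho> f) = (\<Sum>x\<in>X. w x * f x))"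

definition supporting_spheres :: "'a::euclidean_space set \<Rightarrow> 'a set" where
  "supporting_spheres X = (\<Union>\<rho>\<in>norm ` X. sphere 0 \<rho>)"

text \<open>The weight function is an explicit argument, since the classification also specifies the
  weights. For odd \<open>t = 2 * e - 1\<close> we have \<open>e = (t + 1) div 2\<close>. The bound with \<open>- 1\<close> is stated
  additively because subtraction on natural numbers truncates.\<close>

definition tight_euclidean_design :: "nat \<Rightarrow> 'a::euclidean_space set \<Rightarrow> ('a \<Rightarrow> real) \<Rightarrow> bool" where
  "tight_euclidean_design t X w \<longleftrightarrow>
     euclidean_design t X w \<and>
     (if even t then card X = dim_poly_on (t div 2) (supporting_spheres X)
      else let e = (t + 1) div 2 in
        if odd e \<and> 0 \<in> X
        then card X + 1 = 2 * dim_parity_poly_on (e - 1) (supporting_spheres X)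
        else card X = 2 * dim_parity_poly_on (e - 1) (supporting_spheres X))"


section \<open>The reflection group of type D and its corner vectors\<close>

text \<open>Here \<open>e 1, \<dots>, e n\<close> is an enumeration of the standard basis.\<close>

definition hyperplane_reflection :: "'a::euclidean_space \<Rightarrow> 'a \<Rightarrow> 'a" where
  "hyperplane_reflection \<alpha> x = x - (2 * (x \<bullet> \<alpha>) / (\<alpha> \<bullet> \<alpha>)) *\<^sub>R \<alpha>"

definition fundamental_roots :: "(nat \<Rightarrow> 'a::euclidean_space) \<Rightarrow> nat \<Rightarrow> 'a set" where
  "fundamental_roots e n = {e i - e (i + 1) | i. 1 \<le> i \<and> i \<le> n - 1} \<union> {e (n - 1) + e n}"

definition D_group :: "(nat \<Rightarrow> 'a::euclidean_space) \<Rightarrow> nat \<Rightarrow> ('a \<Rightarrow> 'a) set" where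
  "D_group e n = generate (BijGroup UNIV) (hyperplane_reflection ` fundamental_roots e n)"

definition corner_vector :: "(nat \<Rightarrow> 'a::euclidean_space) \<Rightarrow> nat \<Rightarrow> nat \<Rightarrow> 'a" where
  "corner_vector e n k =
     (if k = n then (1 / sqrt (real n)) *\<^sub>R (\<Sum>i=1..n. e i)
      else if k = n - 1 then (1 / sqrt (real n)) *\<^sub>R ((\<Sum>i=1..n - 1. e i) - e n)
      else (1 / sqrt (real k)) *\<^sub>R (\<Sum>i=1..k. e i))"

definition corner_orbit :: "(nat \<Rightarrow> 'a::euclidean_space) \<Rightarrow> nat \<Rightarrow> nat \<Rightarrow> 'a set" where
  "corner_orbit e n k = (\<lambda>g. g (corner_vector e n k)) ` D_group e n"

definition scaled_corner_orbit ::
    "(nat \<Rightarrow> 'a::euclidean_space) \<Rightarrow> nat \<Rightarrow> (nat \<Rightarrow> real) \<Rightarrow> nat \<Rightarrow> 'a set" where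
  "scaled_corner_orbit e n r k = (\<lambda>v. r k *\<^sub>R v) ` corner_orbit e n k"

definition corner_orbit_union ::
    "(nat \<Rightarrow> 'a::euclidean_space) \<Rightarrow> nat \<Rightarrow> nat set \<Rightarrow> (nat \<Rightarrow> real) \<Rightarrow> 'a set" where
  "corner_orbit_union e n J r = (\<Union>k\<in>J. scaled_corner_orbit e n r k)"

end

theory Submission
  imports Defs
begin

text \<open>
  Testing an orbit-invariant design on polynomials with vanishing spherical means yields linear
  relations between the products of weights and powers of radii. The polynomial
  \<open>x\<^sup>2 * y\<^sup>2 * (x\<^sup>2 - y\<^sup>2)\<^sup>2\<close> in two coordinates vanishes on every corner orbit but has positive mean,
  so \<open>t \<le> 7\<close>. Polynomials of degree four and six, and the product of all coordinates,
  force further orbits to occur besides a half-spin orbit of size \<open>2 ^ (n - 1)\<close>; comparing cardinalities with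
  the dimension bounds then leaves finitely many index sets \<open>J\<close>, for which the linear relations
  determine radii and weights.
\<close>

section \<open>Means over spheres\<close>

text \<open>For \<open>t\<close> at most 7 the design property becomes a few scalar equations. A
  monomial with an odd exponent has zero defect by sign changes unless all exponents are odd, and
  then only the half-spin orbits contribute. An even monomial has a defect that is a combination of
  \<open>m4\<close>, \<open>m6\<close> and \<open>m6'\<close>. These sums come from
  \<open>x^4 - 3 x^2 y^2\<close>, \<open>x^6 - 5 x^4 y^2\<close> and
  \<open>x^4 y^2 - 3 x^2 y^2 z^2\<close>, whose spherical means vanish; on an orbit of support size
  \<open>S\<close> they leave the factors \<open>n + 2 - 3 * S\<close>, \<open>n + 4 - 5 * S\<close>
  and \<open>(S - 1) * (n + 4 - 3 * S)\<close>. The first two are negative at \<open>S = n\<close>,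
  so a half-spin orbit needs companions of small support. The upper bounds on dimensions only count
  monomials and hold for any number of spheres; exact dimensions are computed for one and two
  spheres, which is all that the surviving index sets require. The survivors also include a single
  half-spin orbit for \<open>t = 3\<close>, \<open>n = 4\<close>, a cross-polytope. It is not among
  (a) to (e) and accounts for the last two cases of the final equivalence.\<close>

text \<open>Uniqueness of Haar measure: for \<open>\<nu> = distr lborel borel T\<close> and the unit ball \<open>B\<close>, Fubini and
  translation invariance give \<open>lborel B * \<nu> A = lborel A * \<nu> (- B)\<close>, and \<open>\<nu> B = lborel B\<close>.\<close>

lemma distr_lborel_orthogonal_transformation:
  fixes T :: "'a::euclidean_space \<Rightarrow> 'a"
  assumes T: "orthogonal_transformation T"
  shows "distr lborel borel T = lborel"
proof -
  define N where "N = distr lborel borel T"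
  have linT: "linear T" using T by (rule orthogonal_transformation_linear)
  have mT[measurable]: "T \<in> borel \<rightarrow>\<^sub>M borel"
    using linT by (intro borel_measurable_continuous_onI linear_continuous_on linear_conv_bounded_linear[THEN iffD1])
  have setsN[simp, measurable_cong]: "sets N = sets borel" by (simp add: N_def)
  have spN[simp]: "space N = UNIV" by (simp add: N_def)
  have trans: "(\<integral>\<^sup>+ y. g (x + y) \<partial>N) = (\<integral>\<^sup>+ y. g y \<partial>N)"
    if [measurable]: "g \<in> borel_measurable borel" for g :: "'a \<Rightarrow> ennreal" and x
  proof -
    \<comment> \<open>Surjectivity turns the translation by \<open>x\<close> after \<open>T\<close>
      into one by \<open>z\<close> before \<open>T\<close>, where \<open>lborel\<close> is known to
      be invariant.\<close>
    obtain z where z: "x = T z" using orthogonal_transformation_surj[OF T] by (metis surjD)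
    have "(\<integral>\<^sup>+ y. g (x + y) \<partial>N) = (\<integral>\<^sup>+ y. g (T (z + y)) \<partial>lborel)"
      by (simp add: N_def nn_integral_distr z linear_add[OF linT])
    also have "\<dots> = (\<integral>\<^sup>+ y. g (T y) \<partial>distr lborel borel ((+) z))"
      by (simp add: nn_integral_distr)
    also have "\<dots> = (\<integral>\<^sup>+ y. g y \<partial>N)"
      by (simp add: lborel_distr_plus N_def nn_integral_distr)
    finally show ?thesis .
  qed
  have transl: "(\<integral>\<^sup>+ y. g (y - x) \<partial>lborel) = (\<integral>\<^sup>+ y. g y \<partial>lborel)"
    if [measurable]: "g \<in> borel_measurable borel" for g :: "'a \<Rightarrow> ennreal" and x
  proof -
    have "(\<integral>\<^sup>+ y. g (y - x) \<partial>lborel) = (\<integral>\<^sup>+ y. g y \<partial>distr lborel borel ((+) (- x)))"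
      by (simp add: nn_integral_distr)
    then show ?thesis by (simp add: lborel_distr_plus)
  qed
  have pre: "T -` ball 0 r = ball 0 r" for r
    using T by (auto simp: orthogonal_transformation)
  have ballN: "emeasure N (ball 0 r) = emeasure lborel (ball (0::'a) r)" for r
    by (simp add: N_def emeasure_distr pre)
  interpret N: sigma_finite_measure N
  proof (standard, intro exI[of _ "range (\<lambda>n::nat. ball 0 (real n))"] conjI ballI)
    show "\<Union> (range (\<lambda>n::nat. ball 0 (real n))) = space N"
      by (auto intro: reals_Archimedean2)
    show "a \<in> range (\<lambda>n::nat. ball 0 (real n)) \<Longrightarrow> emeasure N a \<noteq> \<infinity>" for a
      using ballN emeasure_lborel_ball_finite[of "0::'a"] by (auto simp: less_top[symmetric])
  qed auto
  interpret P: pair_sigma_finite lborel N ..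
  have key: "emeasure lborel (ball 0 1::'a set) * emeasure N A
      = emeasure lborel A * emeasure N (ball 0 1)" if A[measurable]: "A \<in> sets borel" for A
  proof -
    let ?B = "ball 0 1 :: 'a set"
    have B[measurable]: "?B \<in> sets borel" by simp
    have pairsets: "borel_measurable (lborel \<Otimes>\<^sub>M N) = borel_measurable (borel \<Otimes>\<^sub>M borel)"
      by (intro measurable_cong_sets sets_pair_measure_cong) simp_all
    have ind: "(\<integral>\<^sup>+ x. indicator C x * c \<partial>lborel) = emeasure lborel C * c"
      if "C \<in> sets borel" for C :: "'a set" and c
      using that by (subst nn_integral_multc) auto
    have "emeasure lborel ?B * emeasure N A = (\<integral>\<^sup>+ x. (\<integral>\<^sup>+ y. indicator ?B x * indicator A y \<partial>N) \<partial>lborel)"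
      by (simp add: nn_integral_cmult ind)
    also have "\<dots> = (\<integral>\<^sup>+ x. (\<integral>\<^sup>+ y. indicator ?B x * indicator A (x + y) \<partial>N) \<partial>lborel)"
      by (simp add: nn_integral_cmult trans[of "indicator A"])
    also have "\<dots> = (\<integral>\<^sup>+ y. (\<integral>\<^sup>+ x. indicator ?B x * indicator A (x + y) \<partial>lborel) \<partial>N)"
      by (rule P.Fubini'[symmetric]) (unfold pairsets, measurable)
    \<comment> \<open>With \<open>x\<close> innermost, translation invariance of
      \<open>lborel\<close> moves the shift from \<open>A\<close> to the ball.\<close>
    also have "\<dots> = (\<integral>\<^sup>+ y. (\<integral>\<^sup>+ x. indicator ?B (x - y) * indicator A x \<partial>lborel) \<partial>N)"
    proof (rule nn_integral_cong)
      fix y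
      have "(\<integral>\<^sup>+ x. indicator ?B (x - y) * indicator A (x - y + y) \<partial>lborel)
          = (\<integral>\<^sup>+ x. indicator ?B x * indicator A (x + y) \<partial>lborel)"
        by (rule transl[of "\<lambda>x. indicator ?B x * indicator A (x + y)"]) measurable
      then show "(\<integral>\<^sup>+ x. indicator ?B x * indicator A (x + y) \<partial>lborel)
          = (\<integral>\<^sup>+ x. indicator ?B (x - y) * indicator A x \<partial>lborel)"
        by simp
    qed
    also have "\<dots> = (\<integral>\<^sup>+ x. (\<integral>\<^sup>+ y. indicator ?B (x - y) * indicator A x \<partial>N) \<partial>lborel)"
      by (rule P.Fubini') (unfold pairsets, measurable)
    \<comment> \<open>The ball is symmetric, so its argument may be negated; the inner integrand is
      then a translate in \<open>y\<close>, and the two factors separate.\<close>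
    also have "\<dots> = (\<integral>\<^sup>+ x. (\<integral>\<^sup>+ y. indicator ?B (- x + y) * indicator A x \<partial>N) \<partial>lborel)"
      by (intro nn_integral_cong) (auto simp: indicator_def dist_norm norm_minus_commute)
    also have "\<dots> = (\<integral>\<^sup>+ x. (\<integral>\<^sup>+ y. indicator ?B y * indicator A x \<partial>N) \<partial>lborel)"
    proof (rule nn_integral_cong)
      fix x
      show "(\<integral>\<^sup>+ y. indicator ?B (- x + y) * indicator A x \<partial>N) = (\<integral>\<^sup>+ y. indicator ?B y * indicator A x \<partial>N)"
        by (rule trans[of "\<lambda>y. indicator ?B y * indicator A x" "- x"]) measurable
    qed
    also have "\<dots> = emeasure lborel A * emeasure N ?B"
      by (simp add: nn_integral_multc ind mult.commute[of "emeasure N ?B"])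
    finally show ?thesis .
  qed
  have "emeasure N A = emeasure lborel A" if "A \<in> sets borel" for A
  proof -
    have "emeasure lborel (ball 0 1::'a set) \<noteq> \<infinity>"
      using emeasure_lborel_ball_finite[of "0::'a" 1] by auto
    moreover have "emeasure lborel (ball 0 1::'a set) \<noteq> 0"
      using content_ball_pos[of 1 "0::'a"] by (auto simp: measure_def)
    ultimately have "emeasure lborel (ball 0 1::'a set) \<noteq> \<infinity>" "emeasure lborel (ball 0 1::'a set) \<noteq> 0" .
    then show ?thesis using key[OF that]
      by (metis ballN ennreal_mult_cancel_left infinity_ennreal_def mult.commute)
  qed
  then have "N = lborel" by (intro measure_eqI) auto
  then show ?thesis by (simp add: N_def)
qed

section \<open>Surface measure of a sphere and its orthogonal invariance\<close>

lemma sets_surface_measure [simp, measurable_cong]: "sets (surface_measure \<rho>) = sets borel"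
  and space_surface_measure [simp]: "space (surface_measure \<rho>) = UNIV"
  by (simp_all add: surface_measure_def space_scale_measure)

lemma emeasure_surface_measure:
  fixes A :: "'a::euclidean_space set"
  assumes [measurable]: "A \<in> sets borel"
  shows "emeasure (surface_measure \<rho>) A = ennreal (real DIM('a) / \<rho>) *
    emeasure lborel {x \<in> cball 0 \<rho> - {0}. (\<rho> / norm x) *\<^sub>R x \<in> A}"
proof -
  have "(\<lambda>x::'a. (\<rho> / norm x) *\<^sub>R x) -` A \<inter> space (restrict_space lborel (cball 0 \<rho> - {0}))
      = {x \<in> cball 0 \<rho> - {0}. (\<rho> / norm x) *\<^sub>R x \<in> A}"
    by (auto simp: space_restrict_space)
  moreover have "emeasure (restrict_space lborel (cball 0 \<rho> - {0})) {x \<in> cball 0 \<rho> - {0}. (\<rho> / norm x) *\<^sub>R x \<in> A}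
      = emeasure lborel {x \<in> cball 0 \<rho> - {0}. (\<rho> / norm x) *\<^sub>R x \<in> A}"
    by (rule emeasure_restrict_space) auto
  moreover have "(\<lambda>x::'a. (\<rho> / norm x) *\<^sub>R x) \<in> restrict_space lborel (cball 0 \<rho> - {0}) \<rightarrow>\<^sub>M borel"
    by (intro measurable_restrict_space1) measurable
  ultimately show ?thesis
    by (simp add: surface_measure_def emeasure_distr)
qed

lemma emeasure_surface_measure_sphere:
  assumes "\<rho> > 0"
  shows "emeasure (surface_measure \<rho>) (sphere (0::'a::euclidean_space) \<rho>) =
    ennreal (real DIM('a) / \<rho>) * emeasure lborel (cball (0::'a) \<rho>)"
proof -
  have "emeasure lborel {x::'a \<in> cball 0 \<rho> - {0}. (\<rho> / norm x) *\<^sub>R x \<in> sphere 0 \<rho>}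
      = emeasure lborel (cball (0::'a) \<rho> - {0})"
    using assms by (intro arg_cong2[where f=emeasure]) auto
  also have "\<dots> = emeasure lborel (cball (0::'a) \<rho>)"
    using assms by (subst emeasure_Diff) auto
  finally show ?thesis by (simp add: emeasure_surface_measure)
qed

lemma measure_surface_measure_sphere_pos:
  assumes "\<rho> > 0"
  shows "measure (surface_measure \<rho>) (sphere (0::'a::euclidean_space) \<rho>) > 0"
  using assms content_cball_pos[OF assms, of "0::'a"]
  by (simp add: measure_def emeasure_surface_measure_sphere enn2real_mult)

lemma finite_measure_surface_measure:
  assumes "\<rho> > 0"
  shows "finite_measure (surface_measure \<rho> :: 'a::euclidean_space measure)"
proof
  have "emeasure (surface_measure \<rho>) (UNIV::'a set) =
    ennreal (real DIM('a) / \<rho>) * emeasure lborel (cball (0::'a) \<rho> - {0})"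
    by (subst emeasure_surface_measure) (auto intro!: arg_cong2[where f="(*)"] arg_cong2[where f=emeasure])
  moreover have "emeasure lborel (cball (0::'a) \<rho> - {0}) \<le> emeasure lborel (cball (0::'a) \<rho>)"
    by (rule emeasure_mono) auto
  ultimately show "emeasure (surface_measure \<rho>) (space (surface_measure \<rho>) :: 'a set) \<noteq> \<infinity>"
    using emeasure_lborel_cball_finite[of "0::'a" \<rho>] by (auto simp: ennreal_mult_eq_top_iff)
qed

text \<open>An orthogonal map commutes with the radial projection and preserves centred balls, so
  the cone over a preimage is the preimage of the cone; invariance of Lebesgue measure does the
  rest.\<close>

lemma distr_surface_measure_orthogonal_transformation:
  fixes T :: "'a::euclidean_space \<Rightarrow> 'a"
  assumes T: "orthogonal_transformation T"
  shows "distr (surface_measure \<rho>) borel T = surface_measure \<rho>"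
proof (rule measure_eqI)
  fix A assume "A \<in> sets (distr (surface_measure \<rho>) borel T)"
  then have A[measurable]: "A \<in> sets borel" by simp
  have linT: "linear T" using T by (rule orthogonal_transformation_linear)
  have mT[measurable]: "T \<in> borel \<rightarrow>\<^sub>M borel"
    using linT by (intro borel_measurable_continuous_onI linear_continuous_on linear_conv_bounded_linear[THEN iffD1])
  have mT': "T \<in> borel_measurable (surface_measure \<rho>)"
    by (simp add: measurable_cong_sets[OF sets_surface_measure refl])
  have TA: "T -` A \<in> sets borel"
    using measurable_sets[OF mT A] by simp
  have nT: "norm (T x) = norm x" for x
    using T by (simp add: orthogonal_transformation)
  have T0: "T x = 0 \<longleftrightarrow> x = 0" for x
    using nT[of x] by (metis norm_eq_zero)
  have B: "{x \<in> cball 0 \<rho> - {0}. (\<rho> / norm x) *\<^sub>R x \<in> A} \<in> sets borel"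
    by measurable
  have "emeasure (distr (surface_measure \<rho>) borel T) A = emeasure (surface_measure \<rho>) (T -` A)"
    by (simp add: emeasure_distr mT')
  also have "\<dots> = ennreal (real DIM('a) / \<rho>) *
      emeasure lborel (T -` {x \<in> cball 0 \<rho> - {0}. (\<rho> / norm x) *\<^sub>R x \<in> A})"
    unfolding emeasure_surface_measure[OF TA]
    by (intro arg_cong2[where f="(*)"] arg_cong2[where f=emeasure])
       (auto simp: nT T0 linear_scale[OF linT])
  also have "\<dots> = ennreal (real DIM('a) / \<rho>) *
      emeasure (distr lborel borel T) {x \<in> cball 0 \<rho> - {0}. (\<rho> / norm x) *\<^sub>R x \<in> A}"
    using B by (simp add: emeasure_distr)
  also have "\<dots> = emeasure (surface_measure \<rho>) A"
    by (simp add: distr_lborel_orthogonal_transformation[OF T] emeasure_surface_measure)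
  finally show "emeasure (distr (surface_measure \<rho>) borel T) A = emeasure (surface_measure \<rho>) A" .
qed simp

lemma set_integrable_surface_measure:
  fixes f :: "'a::euclidean_space \<Rightarrow> real"
  assumes "\<rho> > 0" and f: "continuous_on UNIV f"
  shows "set_integrable (surface_measure \<rho>) (sphere 0 \<rho>) f"
proof -
  interpret finite_measure "surface_measure \<rho> :: 'a measure"
    using assms(1) by (rule finite_measure_surface_measure)
  have "compact (f ` sphere 0 \<rho>)"
    using f by (intro compact_continuous_image continuous_on_subset[OF f]) auto
  then obtain B where "\<forall>y\<in>f ` sphere 0 \<rho>. norm y \<le> B"
    using compact_imp_bounded bounded_iff by blast
  then have B: "\<bar>f x\<bar> \<le> B" if "norm x = \<rho>" for x
    using that by auto
  have [measurable]: "f \<in> borel_measurable borel"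
    using f by (rule borel_measurable_continuous_onI)
  have [measurable]: "sphere (0::'a) \<rho> \<in> sets borel"
    by (intro borel_closed) simp
  have "(\<lambda>x. indicator (sphere 0 \<rho>) x *\<^sub>R f x) \<in> borel_measurable (surface_measure \<rho>)"
    unfolding measurable_cong_sets[OF sets_surface_measure refl] by measurable
  then show ?thesis
    unfolding set_integrable_def
    by (intro integrable_const_bound[of _ "max B 0"] AE_I2) (auto simp: indicator_def B le_max_iff_disj)
qed

section \<open>Linearity, positivity and invariance of the spherical mean\<close>

context
  fixes \<rho> :: real
  assumes \<rho>: "\<rho> \<ge> 0"
begin

lemma sphere_mean_cong:
  assumes "\<And>x. norm x = \<rho> \<Longrightarrow> f x = g x"
  shows "sphere_mean \<rho> f = sphere_mean \<rho> g"
  using assms by (auto simp: sphere_mean_def intro!: set_lebesgue_integral_cong)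

lemma sphere_mean_add:
  assumes "continuous_on UNIV f" "continuous_on UNIV g"
  shows "sphere_mean \<rho> (\<lambda>x. f x + g x) = sphere_mean \<rho> f + sphere_mean \<rho> g"
  using assms \<rho> by (auto simp: sphere_mean_def set_integrable_surface_measure set_integral_add algebra_simps)

lemma sphere_mean_cmult: "sphere_mean \<rho> (\<lambda>x. c * f x) = c * sphere_mean \<rho> f"
  by (auto simp: sphere_mean_def)

lemma sphere_mean_diff:
  assumes "continuous_on UNIV f" "continuous_on UNIV g"
  shows "sphere_mean \<rho> (\<lambda>x. f x - g x) = sphere_mean \<rho> f - sphere_mean \<rho> g"
  using assms \<rho> by (auto simp: sphere_mean_def set_integrable_surface_measure set_integral_diff algebra_simps)

lemma sphere_mean_sum:
  assumes "\<And>i. i \<in> I \<Longrightarrow> continuous_on UNIV (f i)"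
  shows "sphere_mean \<rho> (\<lambda>x. \<Sum>i\<in>I. f i x) = (\<Sum>i\<in>I. sphere_mean \<rho> (f i))"
  using assms
proof (induction I rule: infinite_finite_induct)
  case (insert i I)
  then show ?case by (simp add: sphere_mean_add continuous_on_sum)
\<comment> \<open>Sums over empty or infinite index sets are zero, and the mean of the zero function
  is the case \<open>c = 0\<close> of \<open>sphere_mean_cmult\<close>.\<close>
qed (use sphere_mean_cmult[of 0] in simp_all)

lemma sphere_mean_const: "sphere_mean \<rho> (\<lambda>x::'a::euclidean_space. c) = c"
proof (cases "\<rho> = 0")
  case False
  then have "measure (surface_measure \<rho>) (sphere (0::'a) \<rho>) > 0"
    using \<rho> by (intro measure_surface_measure_sphere_pos) auto
  moreover have "emeasure (surface_measure \<rho>) (sphere (0::'a) \<rho>) < \<infinity>"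
    using finite_measure.emeasure_finite[OF finite_measure_surface_measure, of \<rho> "sphere (0::'a) \<rho>"] False \<rho>
    by (auto simp: less_top)
  ultimately show ?thesis
    using False by (simp add: sphere_mean_def set_lebesgue_integral_def)
qed (simp add: sphere_mean_def)

lemma sphere_mean_nonneg:
  assumes "\<And>x. f x \<ge> 0"
  shows "sphere_mean \<rho> f \<ge> 0"
  using assms by (auto simp: sphere_mean_def set_lebesgue_integral_def intro!: divide_nonneg_nonneg integral_nonneg_AE)

lemma sphere_mean_orthogonal_transformation:
  fixes T :: "'a::euclidean_space \<Rightarrow> 'a"
  assumes T: "orthogonal_transformation T" and f: "continuous_on UNIV f"
  shows "sphere_mean \<rho> (\<lambda>x. f (T x)) = sphere_mean \<rho> f"
proof -
  have linT: "linear T" using T by (rule orthogonal_transformation_linear)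
  have mT: "T \<in> borel_measurable (surface_measure \<rho>)"
    unfolding measurable_cong_sets[OF sets_surface_measure refl]
    using linT by (intro borel_measurable_continuous_onI linear_continuous_on linear_conv_bounded_linear[THEN iffD1])
  have [measurable]: "f \<in> borel_measurable borel"
    using f by (rule borel_measurable_continuous_onI)
  have [measurable]: "sphere (0::'a) \<rho> \<in> sets borel"
    by (intro borel_closed) simp
  have ind: "indicator (sphere 0 \<rho>) (T x) = (indicator (sphere 0 \<rho>) x :: real)" for x
    using T by (auto simp: indicator_def orthogonal_transformation)
  have "(LINT x:sphere 0 \<rho>|surface_measure \<rho>. f x) = (LINT x:sphere 0 \<rho>|distr (surface_measure \<rho>) borel T. f x)"
    by (simp add: distr_surface_measure_orthogonal_transformation[OF T])
  also have "\<dots> = (LINT x:sphere 0 \<rho>|surface_measure \<rho>. f (T x))"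
    unfolding set_lebesgue_integral_def by (subst integral_distr[OF mT]) (simp_all add: ind)
  finally show ?thesis
    using linT by (auto simp: sphere_mean_def linear_0)
qed

end

section \<open>Moments of the sphere up to degree eight\<close>

text \<open>Acts on the plane of \<open>b\<close> and \<open>c\<close> by the matrix with rows
  \<open>(C, S)\<close> and \<open>(S, -C)\<close>, and as the identity on its complement. The pair
  \<open>(0, 1)\<close> swaps two coordinates, \<open>(1, 0)\<close> changes the sign of one, and
  \<open>(3/5, 4/5)\<close> mixes them with rational entries.\<close>

definition planar_reflection :: "real \<Rightarrow> real \<Rightarrow> 'a::euclidean_space \<Rightarrow> 'a \<Rightarrow> 'a \<Rightarrow> 'a" where
  "planar_reflection C S b c x =
     x + ((C - 1) * (x \<bullet> b) + S * (x \<bullet> c)) *\<^sub>R b + (S * (x \<bullet> b) - (C + 1) * (x \<bullet> c)) *\<^sub>R c"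

context
  fixes b c :: "'a::euclidean_space"
  assumes bc: "b \<in> Basis" "c \<in> Basis" "b \<noteq> c"
begin

lemma inner_planar_reflection:
  "planar_reflection C S b c x \<bullet> b = C * (x \<bullet> b) + S * (x \<bullet> c)"
  "planar_reflection C S b c x \<bullet> c = S * (x \<bullet> b) - C * (x \<bullet> c)"
  "d \<in> Basis \<Longrightarrow> d \<noteq> b \<Longrightarrow> d \<noteq> c \<Longrightarrow> planar_reflection C S b c x \<bullet> d = x \<bullet> d"
  using bc by (auto simp: planar_reflection_def inner_simps inner_Basis algebra_simps)

lemma orthogonal_transformation_planar_reflection:
  assumes "C\<^sup>2 + S\<^sup>2 = 1"
  shows "orthogonal_transformation (planar_reflection C S b c)"
  unfolding orthogonal_transformation_def
proof (intro conjI allI)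
  show "linear (planar_reflection C S b c)"
    by (rule linearI) (auto simp: planar_reflection_def inner_simps algebra_simps)
  fix v w
  have B: "b \<bullet> b = 1" "c \<bullet> c = 1" "b \<bullet> c = 0" "c \<bullet> b = 0" "b \<bullet> w = w \<bullet> b" "c \<bullet> w = w \<bullet> c"
    using bc by (auto simp: inner_Basis inner_commute)
  have "planar_reflection C S b c v \<bullet> planar_reflection C S b c w = v \<bullet> w +
      (C\<^sup>2 + S\<^sup>2 - 1) * ((v \<bullet> b) * (w \<bullet> b) + (v \<bullet> c) * (w \<bullet> c))"
    unfolding planar_reflection_def inner_add_left inner_add_right inner_scaleR_left inner_scaleR_right B
    by (simp add: algebra_simps power2_eq_square)
  then show "planar_reflection C S b c v \<bullet> planar_reflection C S b c w = v \<bullet> w"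
    using assms by simp
qed

end

lemma norm_square_eq_sum_Basis: "(norm (x::'a::euclidean_space))\<^sup>2 = (\<Sum>d\<in>Basis. (x \<bullet> d)\<^sup>2)"
  unfolding power2_norm_eq_inner by (subst euclidean_inner) (simp add: power2_eq_square)

lemma continuous_on_monomial: "continuous_on UNIV (monomial \<alpha>)"
  unfolding monomial_def[abs_def] by (intro continuous_intros)

context
  fixes \<rho> :: real
  assumes \<rho>: "\<rho> \<ge> 0"
begin

lemma sphere_mean_planar_reflection:
  fixes b c :: "'a::euclidean_space"
  assumes "b \<in> Basis" "c \<in> Basis" "b \<noteq> c" "C\<^sup>2 + S\<^sup>2 = 1" "continuous_on UNIV f"
  shows "sphere_mean \<rho> (\<lambda>x. f (planar_reflection C S b c x)) = sphere_mean \<rho> f"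
  using assms by (intro sphere_mean_orthogonal_transformation \<rho> orthogonal_transformation_planar_reflection)

text \<open>The last hypothesis compares points related by exchanging two coordinates, so it can be
  checked on formulas in the coordinates. The case \<open>b = c\<close> is allowed and spares case
  distinctions later.\<close>

lemma sphere_mean_swap:
  fixes b c :: "'a::euclidean_space"
  assumes "b \<in> Basis" "c \<in> Basis" "continuous_on UNIV f"
    and "\<And>x y. x \<bullet> b = y \<bullet> c \<Longrightarrow> x \<bullet> c = y \<bullet> b \<Longrightarrow>
      (\<And>d. d \<in> Basis \<Longrightarrow> d \<noteq> b \<Longrightarrow> d \<noteq> c \<Longrightarrow> x \<bullet> d = y \<bullet> d) \<Longrightarrow> f x = g y"
  shows "sphere_mean \<rho> f = sphere_mean \<rho> g"
proof (cases "b = c")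
  case True
  then have "f x = g x" for x by (intro assms(4)) simp_all
  then have "f = g" by (rule ext)
  then show ?thesis by simp
next
  case False
  have "sphere_mean \<rho> f = sphere_mean \<rho> (\<lambda>x. f (planar_reflection 0 1 b c x))"
    using sphere_mean_planar_reflection[of b c 0 1 f] assms(1-3) False by simp
  also have "\<dots> = sphere_mean \<rho> g"
  proof -
    have "f (planar_reflection 0 1 b c x) = g x" for x
      by (rule assms(4)) (use assms(1,2) False in \<open>auto simp: inner_planar_reflection\<close>)
    then show ?thesis by simp
  qed
  finally show ?thesis .
qed

text \<open>Changing the sign of coordinate \<open>b\<close> negates the monomial. A second
  coordinate is needed because the sign change is realised as a reflection of a plane.\<close>

lemma sphere_mean_monomial_odd:
  fixes b :: "'a::euclidean_space"
  assumes b: "b \<in> Basis" "odd (\<alpha> b)" and dim: "DIM('a) \<ge> 2"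
  shows "sphere_mean \<rho> (monomial \<alpha> :: 'a \<Rightarrow> real) = 0"
proof -
  obtain c where c: "c \<in> Basis" "c \<noteq> b"
    using dim b by (metis One_nat_def card_le_Suc0_iff_eq finite_Basis not_less_eq_eq numeral_2_eq_2)
  have "monomial \<alpha> (planar_reflection 1 0 c b x) = - monomial \<alpha> x" for x
  proof -
    have "monomial \<alpha> (planar_reflection 1 0 c b x) =
        (- (x \<bullet> b)) ^ \<alpha> b * (\<Prod>d\<in>Basis - {b}. (planar_reflection 1 0 c b x \<bullet> d) ^ \<alpha> d)"
      using b c by (simp add: monomial_def prod.remove[of _ b] inner_planar_reflection)
    also have "(\<Prod>d\<in>Basis - {b}. (planar_reflection 1 0 c b x \<bullet> d) ^ \<alpha> d) = (\<Prod>d\<in>Basis - {b}. (x \<bullet> d) ^ \<alpha> d)"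
    proof (rule prod.cong)
      fix d assume "d \<in> Basis - {b}"
      then show "(planar_reflection 1 0 c b x \<bullet> d) ^ \<alpha> d = (x \<bullet> d) ^ \<alpha> d"
        using b c by (cases "d = c") (auto simp: inner_planar_reflection)
    qed simp
    finally show ?thesis
      using b by (simp add: monomial_def prod.remove[of _ b])
  qed
  then have "sphere_mean \<rho> (monomial \<alpha> :: 'a \<Rightarrow> real) = sphere_mean \<rho> (\<lambda>x::'a. -1 * monomial \<alpha> x)"
    using sphere_mean_planar_reflection[of c b 1 0 "monomial \<alpha>"] b c by (simp add: continuous_on_monomial)
  then show ?thesis unfolding sphere_mean_cmult[OF \<rho>] by simp
qed

text \<open>The reflections with \<open>C = 3/5\<close> and \<open>S = \<plusminus> 4/5\<close> are used in pairs, so that the terms of odd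
  degree in a coordinate cancel.\<close>

lemma sphere_mean_planar_symmetrization:
  fixes b c :: "'a::euclidean_space"
  assumes "b \<in> Basis" "c \<in> Basis" "b \<noteq> c" and f: "continuous_on UNIV f"
    and g: "\<And>x. f (planar_reflection (3/5) (4/5) b c x) + f (planar_reflection (3/5) (-4/5) b c x) = g x"
  shows "sphere_mean \<rho> g = 2 * sphere_mean \<rho> f"
proof -
  have cont: "continuous_on UNIV (\<lambda>x. f (planar_reflection C S b c x))" for C S
    unfolding planar_reflection_def
    by (intro continuous_on_compose2[OF f] continuous_intros) auto
  have "2 * sphere_mean \<rho> f = sphere_mean \<rho> (\<lambda>x. f (planar_reflection (3/5) (4/5) b c x))
      + sphere_mean \<rho> (\<lambda>x. f (planar_reflection (3/5) (-4/5) b c x))"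
    using assms by (simp add: sphere_mean_planar_reflection power2_eq_square)
  also have "\<dots> = sphere_mean \<rho> g"
    unfolding sphere_mean_add[OF \<rho> cont cont, symmetric] g ..
  finally show ?thesis by simp
qed

section \<open>Explicit moments of degree two, four and six\<close>

lemma sphere_mean_mult_norm:
  "sphere_mean \<rho> (\<lambda>x. f x * (norm x)\<^sup>2) = \<rho>\<^sup>2 * sphere_mean \<rho> f"
  unfolding sphere_mean_cmult[OF \<rho>, symmetric]
  by (rule sphere_mean_cong[OF \<rho>]) simp

text \<open>The recursion behind all moments: once symmetry expresses the means on the left through
  one unknown, this equation determines it from the moment two degrees lower.\<close>

lemma sum_sphere_mean_mult_coordinate_square:
  fixes f :: "'a::euclidean_space \<Rightarrow> real"
  assumes "continuous_on UNIV f"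
  shows "(\<Sum>d\<in>Basis. sphere_mean \<rho> (\<lambda>x. f x * (x \<bullet> d)\<^sup>2)) = \<rho>\<^sup>2 * sphere_mean \<rho> f"
proof -
  have "(\<Sum>d\<in>Basis. sphere_mean \<rho> (\<lambda>x. f x * (x \<bullet> d)\<^sup>2)) =
      sphere_mean \<rho> (\<lambda>x. \<Sum>d\<in>Basis. f x * (x \<bullet> d)\<^sup>2)"
    by (subst sphere_mean_sum[OF \<rho>]) (auto intro!: continuous_intros assms)
  also have "(\<lambda>x. \<Sum>d\<in>Basis. f x * (x \<bullet> d)\<^sup>2) = (\<lambda>x. f x * (norm x)\<^sup>2)"
    by (simp add: sum_distrib_left[symmetric] norm_square_eq_sum_Basis)
  finally show ?thesis by (simp add: sphere_mean_mult_norm)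
qed

lemma sphere_mean_degree_2:
  fixes b :: "'a::euclidean_space"
  assumes "b \<in> Basis"
  shows "sphere_mean \<rho> (\<lambda>x. (x \<bullet> b)\<^sup>2) = \<rho>\<^sup>2 / DIM('a)"
proof -
  have "sphere_mean \<rho> (\<lambda>x. (x \<bullet> d)\<^sup>2) = sphere_mean \<rho> (\<lambda>x. (x \<bullet> b)\<^sup>2)" if "d \<in> Basis" for d :: 'a
    by (rule sphere_mean_swap[OF that assms]) (auto intro!: continuous_intros)
  then have "\<rho>\<^sup>2 = DIM('a) * sphere_mean \<rho> (\<lambda>x. (x \<bullet> b)\<^sup>2)"
    using sum_sphere_mean_mult_coordinate_square[of "\<lambda>x::'a. 1"]
    by (simp add: sphere_mean_const[OF \<rho>])
  then show ?thesis by (simp add: field_simps)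
qed

text \<open>Permutations and sign changes cannot relate these two means, so a reflection mixing the
  coordinates is used. The factor \<open>g\<close>, depending on the other coordinates only, makes
  the ratio available again in degree six.\<close>

lemma sphere_mean_degree_4_ratio:
  fixes b c :: "'a::euclidean_space"
  assumes bc: "b \<in> Basis" "c \<in> Basis" "b \<noteq> c" and g: "continuous_on UNIV g"
    and inv: "\<And>x y. (\<And>d. d \<in> Basis - {b, c} \<Longrightarrow> x \<bullet> d = y \<bullet> d) \<Longrightarrow> g x = g y"
  shows "sphere_mean \<rho> (\<lambda>x. (x \<bullet> b) ^ 4 * g x) = 3 * sphere_mean \<rho> (\<lambda>x. (x \<bullet> b)\<^sup>2 * (x \<bullet> c)\<^sup>2 * g x)"
proof -
  let ?x4 = "\<lambda>x. (x \<bullet> b) ^ 4 * g x" and ?y4 = "\<lambda>x. (x \<bullet> c) ^ 4 * g x"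
    and ?x2y2 = "\<lambda>x. (x \<bullet> b)\<^sup>2 * (x \<bullet> c)\<^sup>2 * g x"
  have gT: "g (planar_reflection C S b c x) = g x" for C S x
    using bc by (intro inv) (auto simp: inner_planar_reflection)
  \<comment> \<open>Twice the even terms of the binomial expansion. For the means this gives
    \<open>576 * x4 = 1728 * x2y2\<close>, hence the factor 3.\<close>
  have even4: "(3/5 * x + 4/5 * y) ^ 4 * z + (3/5 * x + -4/5 * y) ^ 4 * z =
      162/625 * (x ^ 4 * z) + 512/625 * (y ^ 4 * z) + 1728/625 * (x\<^sup>2 * y\<^sup>2 * z)" for x y z :: real
    by algebra
  have cont: "continuous_on UNIV ?x4" "continuous_on UNIV ?y4" "continuous_on UNIV ?x2y2"
    by (intro continuous_intros g)+
  have "2 * sphere_mean \<rho> ?x4 =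
      sphere_mean \<rho> (\<lambda>x. 162/625 * ?x4 x + 512/625 * ?y4 x + 1728/625 * ?x2y2 x)"
    by (rule sphere_mean_planar_symmetrization[OF bc cont(1), symmetric])
       (unfold inner_planar_reflection(1,2)[OF bc] gT, rule even4)
  also have "\<dots> = 162/625 * sphere_mean \<rho> ?x4 + 512/625 * sphere_mean \<rho> ?y4 + 1728/625 * sphere_mean \<rho> ?x2y2"
    using cont by (simp only: sphere_mean_add sphere_mean_cmult \<rho> continuous_on_add continuous_on_mult_left)
  also have "sphere_mean \<rho> ?y4 = sphere_mean \<rho> ?x4"
  proof (rule sphere_mean_swap[OF bc(1,2) cont(2)])
    fix x y :: 'a
    assume xy: "x \<bullet> b = y \<bullet> c" "x \<bullet> c = y \<bullet> b" "\<And>d. d \<in> Basis \<Longrightarrow> d \<noteq> b \<Longrightarrow> d \<noteq> c \<Longrightarrow> x \<bullet> d = y \<bullet> d"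
    have "g x = g y" by (intro inv xy(3)) auto
    then show "?y4 x = ?x4 y" by (simp add: xy(2))
  qed
  finally show ?thesis by simp
qed

lemma sphere_mean_degree_4:
  fixes b c :: "'a::euclidean_space"
  assumes bc: "b \<in> Basis" "c \<in> Basis" "b \<noteq> c"
  shows "sphere_mean \<rho> (\<lambda>x. (x \<bullet> b) ^ 4) = 3 * \<rho> ^ 4 / (real DIM('a) * (real DIM('a) + 2))"
    and "sphere_mean \<rho> (\<lambda>x. (x \<bullet> b)\<^sup>2 * (x \<bullet> c)\<^sup>2) = \<rho> ^ 4 / (real DIM('a) * (real DIM('a) + 2))"
proof -
  let ?m = "sphere_mean \<rho> (\<lambda>x. (x \<bullet> b) ^ 4)"
  have *: "sphere_mean \<rho> (\<lambda>x. (x \<bullet> b)\<^sup>2 * (x \<bullet> d)\<^sup>2) = (if d = b then ?m else ?m / 3)" if "d \<in> Basis" for d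
    using sphere_mean_degree_4_ratio[of b d "\<lambda>_. 1"] that bc
    by (simp add: power4_eq_xxxx power2_eq_square mult.assoc)
  have "\<rho>\<^sup>2 * (\<rho>\<^sup>2 / DIM('a)) = (\<Sum>d\<in>Basis. if d = b then ?m else ?m / 3)"
    using sum_sphere_mean_mult_coordinate_square[of "\<lambda>x. (x \<bullet> b)\<^sup>2"] bc
    by (simp add: sphere_mean_degree_2 * continuous_intros)
  also have "\<dots> = ?m + (DIM('a) - 1) * ?m / 3"
    using bc by (simp add: sum.remove[of _ b] of_nat_diff DIM_positive Suc_leI)
  finally have "?m * (real DIM('a) * (real DIM('a) + 2)) = 3 * \<rho> ^ 4"
    by (simp add: field_simps power4_eq_xxxx power2_eq_square of_nat_diff DIM_positive Suc_leI)
  then show m: "?m = 3 * \<rho> ^ 4 / (real DIM('a) * (real DIM('a) + 2))"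
    by (intro eq_divide_imp) (simp_all only: mult_eq_0_iff, simp_all add: add_nonneg_eq_0_iff)
  show "sphere_mean \<rho> (\<lambda>x. (x \<bullet> b)\<^sup>2 * (x \<bullet> c)\<^sup>2) = \<rho> ^ 4 / (real DIM('a) * (real DIM('a) + 2))"
  proof -
    obtain N :: real where N: "N = real DIM('a) * (real DIM('a) + 2)" by simp
    have "sphere_mean \<rho> (\<lambda>x. (x \<bullet> b)\<^sup>2 * (x \<bullet> c)\<^sup>2) = ?m / 3" using bc *[of c] by simp
    then show ?thesis unfolding m N[symmetric] by simp
  qed
qed

text \<open>The mean of \<open>x^4 y^2\<close> is the unknown. The mean of
  \<open>x^2 y^2 z^2\<close> is a third of it, the norm recursion applied to \<open>x^2 y^2\<close>
  determines it, and the mixing reflection shows that the mean of \<open>x^6\<close> is five times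
  as large.\<close>

lemma sphere_mean_degree_6:
  fixes b c d :: "'a::euclidean_space"
  assumes "b \<in> Basis" "c \<in> Basis" "d \<in> Basis" "b \<noteq> c" "b \<noteq> d" "c \<noteq> d"
  shows "sphere_mean \<rho> (\<lambda>x. (x \<bullet> b) ^ 6) = 15 * \<rho> ^ 6 / (real DIM('a) * (real DIM('a) + 2) * (real DIM('a) + 4))"
    and "sphere_mean \<rho> (\<lambda>x. (x \<bullet> b) ^ 4 * (x \<bullet> c)\<^sup>2) = 3 * \<rho> ^ 6 / (real DIM('a) * (real DIM('a) + 2) * (real DIM('a) + 4))"
    and "sphere_mean \<rho> (\<lambda>x. (x \<bullet> b)\<^sup>2 * (x \<bullet> c)\<^sup>2 * (x \<bullet> d)\<^sup>2) = \<rho> ^ 6 / (real DIM('a) * (real DIM('a) + 2) * (real DIM('a) + 4))"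
proof -
  let ?m = "sphere_mean \<rho> (\<lambda>x. (x \<bullet> b) ^ 4 * (x \<bullet> c)\<^sup>2)"
  let ?x6 = "\<lambda>x. (x \<bullet> b) ^ 6" and ?y6 = "\<lambda>x. (x \<bullet> c) ^ 6"
    and ?x4y2 = "\<lambda>x. (x \<bullet> b) ^ 4 * (x \<bullet> c)\<^sup>2" and ?x2y4 = "\<lambda>x. (x \<bullet> b)\<^sup>2 * (x \<bullet> c) ^ 4"
  have even6: "(3/5 * x + 4/5 * y) ^ 6 + (3/5 * x + -4/5 * y) ^ 6 = 1458/15625 * x ^ 6 + 8192/15625 * y ^ 6 +
      38880/15625 * (x ^ 4 * y\<^sup>2) + 69120/15625 * (x\<^sup>2 * y ^ 4)" for x y :: real
    by algebra
  have cont: "continuous_on UNIV ?x6" "continuous_on UNIV ?y6" "continuous_on UNIV ?x4y2" "continuous_on UNIV ?x2y4"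
    by (intro continuous_intros)+
  have swap: "sphere_mean \<rho> ?x2y4 = ?m"
    using assms by (intro sphere_mean_swap[of b c] cont) auto
  have *: "sphere_mean \<rho> (\<lambda>x. (x \<bullet> b)\<^sup>2 * (x \<bullet> c)\<^sup>2 * (x \<bullet> d)\<^sup>2) = (if d = b \<or> d = c then ?m else ?m / 3)"
    if d: "d \<in> Basis" for d
  proof -
    consider "d = b" | "d = c" | "d \<noteq> b" "d \<noteq> c" by blast
    then show ?thesis
    proof cases
      case 1
      then show ?thesis
        by (simp add: power4_eq_xxxx power2_eq_square mult_ac)
    next
      case 2
      then show ?thesis using swap
        by (simp add: power4_eq_xxxx power2_eq_square mult_ac)
    next
      case 3
      then show ?thesis
      proof -
        have "?m = 3 * sphere_mean \<rho> (\<lambda>x. (x \<bullet> b)\<^sup>2 * (x \<bullet> d)\<^sup>2 * (x \<bullet> c)\<^sup>2)"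
          using 3 assms d by (intro sphere_mean_degree_4_ratio continuous_intros) auto
        also have "(\<lambda>x. (x \<bullet> b)\<^sup>2 * (x \<bullet> d)\<^sup>2 * (x \<bullet> c)\<^sup>2) = (\<lambda>x. (x \<bullet> b)\<^sup>2 * (x \<bullet> c)\<^sup>2 * (x \<bullet> d)\<^sup>2)"
          by (simp add: mult_ac)
        finally show ?thesis using 3 by simp
      qed
    qed
  qed
  have n: "DIM('a) \<ge> 2"
    using card_mono[of Basis "{b, c}"] assms by simp
  have "\<rho>\<^sup>2 * (\<rho> ^ 4 / (real DIM('a) * (real DIM('a) + 2))) = (\<Sum>d\<in>Basis. if d = b \<or> d = c then ?m else ?m / 3)"
    using sum_sphere_mean_mult_coordinate_square[of "\<lambda>x. (x \<bullet> b)\<^sup>2 * (x \<bullet> c)\<^sup>2"] assms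
    by (simp add: sphere_mean_degree_4 * continuous_intros)
  also have "\<dots> = (\<Sum>d\<in>Basis - {b, c}. ?m / 3) + (\<Sum>d\<in>{b, c}. ?m)"
    using assms by (subst sum.subset_diff[of "{b, c}"]) (auto intro!: arg_cong2[where f="(+)"] sum.cong)
  also have "\<dots> = 2 * ?m + (DIM('a) - 2) * ?m / 3"
    using assms n by (simp add: card_Diff_subset of_nat_diff)
  finally have "\<rho>\<^sup>2 * (\<rho> ^ 4 / (real DIM('a) * (real DIM('a) + 2))) = 2 * ?m + (real DIM('a) - 2) * ?m / 3"
    using n by (simp add: of_nat_diff)
  note eq = this
  have solve: "m * (k * (k + 2) * (k + 4)) = 3 * r ^ 6"
    if "r\<^sup>2 * (r ^ 4 / (k * (k + 2))) = 2 * m + (k - 2) * m / 3" "k > 0" for r m k :: real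
  proof -
    have "r\<^sup>2 * r ^ 4 = (2 * m + (k - 2) * m / 3) * (k * (k + 2))"
      unfolding that(1)[symmetric] using that(2) by simp
    then show ?thesis by algebra
  qed
  have "?m * (real DIM('a) * (real DIM('a) + 2) * (real DIM('a) + 4)) = 3 * \<rho> ^ 6"
    by (rule solve[OF eq]) simp
  then show m: "?m = 3 * \<rho> ^ 6 / (real DIM('a) * (real DIM('a) + 2) * (real DIM('a) + 4))"
    by (intro eq_divide_imp) (simp_all only: mult_eq_0_iff, simp_all add: add_nonneg_eq_0_iff)
  show "sphere_mean \<rho> (\<lambda>x. (x \<bullet> b)\<^sup>2 * (x \<bullet> c)\<^sup>2 * (x \<bullet> d)\<^sup>2) = \<rho> ^ 6 / (real DIM('a) * (real DIM('a) + 2) * (real DIM('a) + 4))"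
  proof -
    obtain N :: real where N: "N = real DIM('a) * (real DIM('a) + 2) * (real DIM('a) + 4)" by simp
    have "sphere_mean \<rho> (\<lambda>x. (x \<bullet> b)\<^sup>2 * (x \<bullet> c)\<^sup>2 * (x \<bullet> d)\<^sup>2) = ?m / 3" using assms *[of d] by simp
    then show ?thesis unfolding m N[symmetric] by simp
  qed
  have "2 * sphere_mean \<rho> ?x6 = sphere_mean \<rho> (\<lambda>x. 1458/15625 * ?x6 x + 8192/15625 * ?y6 x +
      38880/15625 * ?x4y2 x + 69120/15625 * ?x2y4 x)"
    by (rule sphere_mean_planar_symmetrization[OF assms(1,2,4) cont(1), symmetric])
       (unfold inner_planar_reflection(1,2)[OF assms(1,2,4)], rule even6)
  also have "\<dots> = 1458/15625 * sphere_mean \<rho> ?x6 + 8192/15625 * sphere_mean \<rho> ?y6 +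
      38880/15625 * ?m + 69120/15625 * sphere_mean \<rho> ?x2y4"
    using cont by (simp only: sphere_mean_add sphere_mean_cmult \<rho> continuous_on_add continuous_on_mult_left)
  also have "sphere_mean \<rho> ?y6 = sphere_mean \<rho> ?x6"
    using assms by (intro sphere_mean_swap[of b c] cont) auto
  \<comment> \<open>With the two mixed means identified, the equation reads
    \<open>21600 * x6 = 108000 * ?m\<close> after clearing denominators.\<close>
  finally have "sphere_mean \<rho> ?x6 = 5 * ?m" unfolding swap by simp
  then show "sphere_mean \<rho> ?x6 = 15 * \<rho> ^ 6 / (real DIM('a) * (real DIM('a) + 2) * (real DIM('a) + 4))"
    unfolding m by simp
qed

text \<open>With \<open>z = x \<bullet> b + \<i> (x \<bullet> c)\<close> the integrand is \<open>(Im (z ^ 4))\<^sup>2 / 16\<close>; by symmetry it has the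
  same mean as \<open>(Re (z ^ 4))\<^sup>2 / 16\<close>, and the two add up to \<open>\<bar>z\<bar> ^ 8 / 16\<close>.\<close>

lemma sphere_mean_degree_8_pos:
  fixes b c :: "'a::euclidean_space"
  assumes bc: "b \<in> Basis" "c \<in> Basis" "b \<noteq> c" and "\<rho> \<noteq> 0"
  shows "sphere_mean \<rho> (\<lambda>x. (x \<bullet> b)\<^sup>2 * (x \<bullet> c)\<^sup>2 * ((x \<bullet> b)\<^sup>2 - (x \<bullet> c)\<^sup>2)\<^sup>2) > 0"
proof -
  let ?q = "\<lambda>x. (x \<bullet> b)\<^sup>2 * (x \<bullet> c)\<^sup>2 * ((x \<bullet> b)\<^sup>2 - (x \<bullet> c)\<^sup>2)\<^sup>2"
  let ?v = "\<lambda>x. ((x \<bullet> b) ^ 4 - 6 * (x \<bullet> b)\<^sup>2 * (x \<bullet> c)\<^sup>2 + (x \<bullet> c) ^ 4)\<^sup>2"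
  have cont: "continuous_on UNIV ?q" "continuous_on UNIV ?v"
    "continuous_on UNIV (\<lambda>x. (x \<bullet> b) ^ 4)" "continuous_on UNIV (\<lambda>x. (x \<bullet> b) ^ 8)"
    "continuous_on UNIV (\<lambda>x. 16 * ?q x + ?v x)"
    by (intro continuous_intros)+
  \<comment> \<open>The constants come from \<open>(3 + 4i)^4 = -527 - 336i\<close>, with
    \<open>84 = 336 / 4\<close>; the reflection multiplies the conjugate of \<open>z^4\<close> by
    this number over 625. The cross terms cancel in the pair.\<close>
  have q_sum: "(3/5 * x + 4/5 * y)\<^sup>2 * (4/5 * x - 3/5 * y)\<^sup>2 * ((3/5 * x + 4/5 * y)\<^sup>2 - (4/5 * x - 3/5 * y)\<^sup>2)\<^sup>2 +
      (3/5 * x + -4/5 * y)\<^sup>2 * (-4/5 * x - 3/5 * y)\<^sup>2 * ((3/5 * x + -4/5 * y)\<^sup>2 - (-4/5 * x - 3/5 * y)\<^sup>2)\<^sup>2 =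
      2 * (527/625)\<^sup>2 * (x\<^sup>2 * y\<^sup>2 * (x\<^sup>2 - y\<^sup>2)\<^sup>2) + 2 * (84/625)\<^sup>2 * (x ^ 4 - 6 * x\<^sup>2 * y\<^sup>2 + y ^ 4)\<^sup>2" for x y :: real
    by algebra
  have q: "2 * sphere_mean \<rho> ?q = sphere_mean \<rho> (\<lambda>x. 2 * (527/625)\<^sup>2 * ?q x + 2 * (84/625)\<^sup>2 * ?v x)"
    by (rule sphere_mean_planar_symmetrization[OF bc cont(1), symmetric])
       (unfold inner_planar_reflection(1,2)[OF bc], rule q_sum)
  also have "\<dots> = 2 * (527/625)\<^sup>2 * sphere_mean \<rho> ?q + 2 * (84/625)\<^sup>2 * sphere_mean \<rho> ?v"
    using cont by (simp only: sphere_mean_add sphere_mean_cmult \<rho> continuous_on_add continuous_on_mult_left)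
  \<comment> \<open>The factor 16 arises from
    \<open>625^2 - 527^2 = 336^2 = 16 * 84^2\<close>.\<close>
  finally have v: "sphere_mean \<rho> ?v = 16 * sphere_mean \<rho> ?q"
    by (simp add: power2_eq_square)
  define m where "m = sphere_mean \<rho> (\<lambda>x. (x \<bullet> b) ^ 4)"
  have "m > 0"
    unfolding m_def sphere_mean_degree_4[OF bc] using \<open>\<rho> \<noteq> 0\<close> \<rho>
    by (intro divide_pos_pos mult_pos_pos add_pos_pos) auto
  \<comment> \<open>Nonnegativity of the variance of the fourth power bounds the eighth moment below
    by \<open>m^2\<close>, so no eighth moment has to be computed.\<close>
  have "0 \<le> sphere_mean \<rho> (\<lambda>x. ((x \<bullet> b) ^ 4 - m)\<^sup>2)"
    by (intro sphere_mean_nonneg \<rho>) simp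
  also have "(\<lambda>x. ((x \<bullet> b) ^ 4 - m)\<^sup>2) = (\<lambda>x. ((x \<bullet> b) ^ 8 + m\<^sup>2) - (2 * m) * (x \<bullet> b) ^ 4)"
  proof
    have "(y ^ 4 - m)\<^sup>2 = (y ^ 8 + m\<^sup>2) - (2 * m) * y ^ 4" for y :: real by algebra
    then show "((x \<bullet> b) ^ 4 - m)\<^sup>2 = ((x \<bullet> b) ^ 8 + m\<^sup>2) - (2 * m) * (x \<bullet> b) ^ 4" for x .
  qed
  also have "sphere_mean \<rho> \<dots> = sphere_mean \<rho> (\<lambda>x. (x \<bullet> b) ^ 8) + m\<^sup>2 - (2 * m) * m"
    using cont unfolding m_def
    by (simp only: sphere_mean_add sphere_mean_diff sphere_mean_cmult sphere_mean_const \<rho>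
        continuous_on_add continuous_on_mult_left continuous_on_const)
  finally have "sphere_mean \<rho> (\<lambda>x. (x \<bullet> b) ^ 8) > 0"
    using mult_pos_pos[OF \<open>m > 0\<close> \<open>m > 0\<close>] by (simp add: power2_eq_square)
  also have "0 \<le> sphere_mean \<rho> (\<lambda>x. (16 * ?q x + ?v x) - (x \<bullet> b) ^ 8)"
  proof (intro sphere_mean_nonneg \<rho>)
    fix x
    have "(16 * (X\<^sup>2 * Y\<^sup>2 * (X\<^sup>2 - Y\<^sup>2)\<^sup>2) + (X ^ 4 - 6 * X\<^sup>2 * Y\<^sup>2 + Y ^ 4)\<^sup>2) - X ^ 8 =
        Y\<^sup>2 * (4 * X ^ 6 + 6 * X ^ 4 * Y\<^sup>2 + 4 * X\<^sup>2 * Y ^ 4 + Y ^ 6)" for X Y :: real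
      by algebra
    then have "(16 * ?q x + ?v x) - (x \<bullet> b) ^ 8 = (x \<bullet> c)\<^sup>2 *
        (4 * (x \<bullet> b) ^ 6 + 6 * (x \<bullet> b) ^ 4 * (x \<bullet> c)\<^sup>2 + 4 * (x \<bullet> b)\<^sup>2 * (x \<bullet> c) ^ 4 + (x \<bullet> c) ^ 6)"
      .
    also have "\<dots> \<ge> 0"
      by (intro mult_nonneg_nonneg add_nonneg_nonneg) auto
    finally show "(16 * ?q x + ?v x) - (x \<bullet> b) ^ 8 \<ge> 0" .
  qed
  then have "sphere_mean \<rho> (\<lambda>x. (x \<bullet> b) ^ 8) \<le> 16 * sphere_mean \<rho> ?q + sphere_mean \<rho> ?v"
    unfolding sphere_mean_diff[OF \<rho> cont(5,4)]
    using cont(1,2) by (simp add: sphere_mean_add sphere_mean_cmult \<rho> continuous_on_mult_left)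
  finally show ?thesis unfolding v by simp
qed

end

section \<open>Polynomial functions and the defect of a weighted point set\<close>

lemma monomial_in_poly_space: "sum \<alpha> Basis \<le> l \<Longrightarrow> monomial \<alpha> \<in> poly_space l"
  unfolding poly_space_def by (intro fun_space.span_base) auto

lemma monomial_in_Hom: "sum \<alpha> Basis = m \<Longrightarrow> monomial \<alpha> \<in> Hom m"
  unfolding Hom_def by (intro fun_space.span_base) auto

lemma poly_space_mono: "l \<le> m \<Longrightarrow> poly_space l \<subseteq> poly_space m"
  unfolding poly_space_def by (intro fun_space.span_mono) auto

lemma poly_space_add:
  assumes "f \<in> poly_space l" "g \<in> poly_space l"
  shows "(\<lambda>x. f x + g x) \<in> poly_space l"
  using fun_space.span_add[OF assms[unfolded poly_space_def]]
  by (simp add: poly_space_def plus_fun_def)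

lemma poly_space_cmult: "f \<in> poly_space l \<Longrightarrow> (\<lambda>x. c * f x) \<in> poly_space l"
  unfolding poly_space_def by (rule fun_space.span_scale)

lemma poly_space_diff:
  assumes "f \<in> poly_space l" "g \<in> poly_space l"
  shows "(\<lambda>x. f x - g x) \<in> poly_space l"
  using poly_space_add[OF assms(1) poly_space_cmult[OF assms(2), of "-1"]] by simp

text \<open>The zero function needs no case of its own: it is zero times the constant
  monomial.\<close>

lemma poly_space_induct [consumes 1, case_names monomial add cmult]:
  assumes "f \<in> poly_space l"
    and "\<And>\<alpha>. sum \<alpha> Basis \<le> l \<Longrightarrow> P (monomial \<alpha>)"
    and "\<And>f g. f \<in> poly_space l \<Longrightarrow> g \<in> poly_space l \<Longrightarrow> P f \<Longrightarrow> P g \<Longrightarrow> P (\<lambda>x. f x + g x)"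
    and "\<And>c f. f \<in> poly_space l \<Longrightarrow> P f \<Longrightarrow> P (\<lambda>x. c * f x)"
  shows "P f"
proof -
  have "(\<lambda>x. 0 * monomial (\<lambda>_. 0) x) \<in> poly_space l \<and> P (\<lambda>x. 0 * monomial (\<lambda>_. 0) x)"
    by (intro conjI poly_space_cmult assms(2,4) monomial_in_poly_space) auto
  then have "fun_space.subspace {f. f \<in> poly_space l \<and> P f}"
    unfolding fun_space.subspace_def using assms(3,4)
    by (auto simp: zero_fun_def plus_fun_def intro: poly_space_add poly_space_cmult)
  from fun_space.span_induct[OF assms(1)[unfolded poly_space_def] this] show ?thesis
    using assms(2) by (auto intro: monomial_in_poly_space)
qed

lemma monomial_mult: "monomial \<alpha> x * monomial \<beta> x = monomial (\<lambda>b. \<alpha> b + \<beta> b) x"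
  by (simp add: monomial_def power_add prod.distrib)

lemma poly_space_mult:
  assumes "f \<in> poly_space l" "g \<in> poly_space m"
  shows "(\<lambda>x. f x * g x) \<in> poly_space (l + m)"
  using assms(1)
proof (induction rule: poly_space_induct)
  case (monomial \<alpha>)
  from assms(2) show ?case
  proof (induction rule: poly_space_induct)
    case (monomial \<beta>)
    then show ?case
      using \<open>sum \<alpha> Basis \<le> l\<close> by (simp add: monomial_mult sum.distrib monomial_in_poly_space)
  qed (auto simp: algebra_simps dest: poly_space_add poly_space_cmult)
qed (auto simp: algebra_simps dest: poly_space_add poly_space_cmult)

lemma poly_space_const: "(\<lambda>x. c) \<in> poly_space l"
  using poly_space_cmult[OF monomial_in_poly_space[of "\<lambda>_. 0" l], of c]
  by (simp add: monomial_def)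

lemma poly_space_power:
  assumes "f \<in> poly_space l"
  shows "(\<lambda>x. f x ^ k) \<in> poly_space (k * l)"
  by (induction k) (use assms in \<open>auto intro: poly_space_const dest: poly_space_mult\<close>)

lemma poly_space_inner_Basis:
  assumes "b \<in> Basis"
  shows "(\<lambda>x. x \<bullet> b) \<in> poly_space 1"
proof -
  have "monomial (\<lambda>d. if d = b then 1 else 0) = (\<lambda>x. x \<bullet> b)"
    using assms by (auto simp: monomial_def if_distrib[of "\<lambda>i. (_ ^ i)"] cong: if_cong)
  then show ?thesis
    using monomial_in_poly_space[of "\<lambda>d. if d = b then 1 else 0" 1] assms by simp
qed

lemma poly_space_coordinate_power: "b \<in> Basis \<Longrightarrow> (\<lambda>x. (x \<bullet> b) ^ k) \<in> poly_space k"
  using poly_space_power[OF poly_space_inner_Basis] by simp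

lemma poly_space_sum:
  "(\<And>i. i \<in> I \<Longrightarrow> f i \<in> poly_space l) \<Longrightarrow> (\<lambda>x. \<Sum>i\<in>I. f i x) \<in> poly_space l"
  by (induction I rule: infinite_finite_induct) (auto intro: poly_space_const poly_space_add)

lemma poly_space_norm_square: "(\<lambda>x::'a::euclidean_space. (norm x)\<^sup>2) \<in> poly_space 2"
  unfolding norm_square_eq_sum_Basis by (intro poly_space_sum poly_space_coordinate_power)

lemma continuous_on_poly_space: "f \<in> poly_space l \<Longrightarrow> continuous_on UNIV f"
  by (induction rule: poly_space_induct) (auto intro: continuous_on_monomial continuous_intros)

text \<open>Difference of the two sides of the design equation. Each point is compared with the mean
  over its own sphere, so that no grouping by norm is needed and the sum splits over orbits.\<close>

definition defect :: "'a::euclidean_space set \<Rightarrow> ('a \<Rightarrow> real) \<Rightarrow> ('a \<Rightarrow> real) \<Rightarrow> real" where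
  "defect X w f = (\<Sum>x\<in>X. w x * (sphere_mean (norm x) f - f x))"

lemma euclidean_design_iff_defect:
  fixes X :: "'a::euclidean_space set"
  shows "euclidean_design t X w \<longleftrightarrow>
     finite X \<and> (\<forall>x\<in>X. w x > 0) \<and> (\<forall>f\<in>poly_space t. defect X w f = 0)"
proof -
  have "(\<Sum>\<rho>\<in>norm ` X. (\<Sum>x\<in>X \<inter> sphere 0 \<rho>. w x) * sphere_mean \<rho> f) =
      (\<Sum>x\<in>X. w x * sphere_mean (norm x) f)" if "finite X" for f :: "'a \<Rightarrow> real"
  proof -
    have "(\<Sum>x\<in>X. w x * sphere_mean (norm x) f) =
        (\<Sum>\<rho>\<in>norm ` X. \<Sum>x\<in>{x\<in>X. norm x = \<rho>}. w x * sphere_mean (norm x) f)"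
      using that by (rule sum.image_gen)
    also have "\<dots> = (\<Sum>\<rho>\<in>norm ` X. (\<Sum>x\<in>X \<inter> sphere 0 \<rho>. w x) * sphere_mean \<rho> f)"
      by (intro sum.cong refl) (auto simp: sum_distrib_right intro!: sum.cong)
    finally show ?thesis ..
  qed
  then show ?thesis
    unfolding euclidean_design_def defect_def
    by (intro conj_cong refl ball_cong) (simp add: right_diff_distrib sum_subtractf)
qed

text \<open>The defect is linear on polynomials, continuity supplying the integrability that
  additivity of the means requires; hence a spanning set suffices.\<close>

lemma euclidean_design_iff_monomials:
  "euclidean_design t X w \<longleftrightarrow> finite X \<and> (\<forall>x\<in>X. w x > 0) \<and>
     (\<forall>\<alpha>. sum \<alpha> Basis \<le> t \<longrightarrow> defect X w (monomial \<alpha>) = 0)"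
proof -
  have "defect X w f = 0" if "f \<in> poly_space t" "\<forall>\<alpha>. sum \<alpha> Basis \<le> t \<longrightarrow> defect X w (monomial \<alpha>) = 0" for f
    using that(1)
  proof (induction rule: poly_space_induct)
    case (add f g)
    have "sphere_mean (norm x) (\<lambda>x. f x + g x) = sphere_mean (norm x) f + sphere_mean (norm x) g" for x :: 'a
      using add by (intro sphere_mean_add continuous_on_poly_space) auto
    then have "defect X w (\<lambda>x. f x + g x) = defect X w f + defect X w g"
      by (simp add: defect_def sum.distrib[symmetric] algebra_simps)
    with add show ?case by simp
  next
    case (cmult c f)
    have "defect X w (\<lambda>x. c * f x) = c * defect X w f"
      by (simp add: defect_def sphere_mean_cmult sum_distrib_left algebra_simps)
    with cmult show ?case by simp
  qed (use that(2) in auto)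
  then show ?thesis
    unfolding euclidean_design_iff_defect using monomial_in_poly_space by blast
qed

section \<open>Vectors with coordinates in \<open>{-1, 0, 1}\<close>\<close>

definition signed_vector :: "'a::euclidean_space set \<Rightarrow> 'a set \<Rightarrow> 'a" where
  "signed_vector A M = (\<Sum>b\<in>A. (if b \<in> M then -1 else 1) *\<^sub>R b)"

text \<open>The index of a corner vector differs from the number of its nonzero coordinates at
  \<open>n - 1\<close> only, where the half-spin vector has full support.\<close>

definition support_size :: "nat \<Rightarrow> nat \<Rightarrow> nat" where
  "support_size n k = (if k \<ge> n - 1 then n else k)"

text \<open>A pair \<open>(A, M)\<close> encodes the support and the set of negative coordinates; the index \<open>k\<close> is
  that of a corner vector, so that \<open>DIM('a) - 1\<close> and \<open>DIM('a)\<close> are the two half-spin types.\<close>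

definition sign_patterns :: "nat \<Rightarrow> ('a::euclidean_space set \<times> 'a set) set" where
  "sign_patterns k = {(A, M). A \<subseteq> Basis \<and> card A = support_size DIM('a) k \<and> M \<subseteq> A \<and>
     (k = DIM('a) \<longrightarrow> even (card M)) \<and> (k = DIM('a) - 1 \<longrightarrow> odd (card M))}"

text \<open>Coordinate description of the scaled corner orbit, identified with the group orbit in
  \<open>scaled_corner_orbit_eq_signed_orbit\<close>. The divisor makes \<open>s\<close> the
  norm.\<close>

definition signed_orbit :: "nat \<Rightarrow> real \<Rightarrow> 'a::euclidean_space set" where
  "signed_orbit k s =
     (\<lambda>(A, M). (s / sqrt (support_size DIM('a) k)) *\<^sub>R signed_vector A M) ` sign_patterns k"

text \<open>For the half-spin types the parity condition halves the \<open>2 ^ n\<close> sign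
  patterns; otherwise the support and all signs are free.\<close>

definition orbit_size :: "nat \<Rightarrow> nat \<Rightarrow> nat" where
  "orbit_size n k = (if k \<ge> n - 1 then 2 ^ (n - 1) else 2 ^ k * (n choose k))"

lemma inner_signed_vector:
  fixes b :: "'a::euclidean_space"
  assumes "A \<subseteq> Basis" "b \<in> Basis"
  shows "signed_vector A M \<bullet> b = (if b \<in> A then if b \<in> M then -1 else 1 else 0)"
proof -
  have fin: "finite A" using assms(1) finite_Basis by (rule finite_subset)
  have "signed_vector A M \<bullet> b = (\<Sum>d\<in>A. (if d \<in> M then -1 else 1) * (d \<bullet> b))"
    by (simp add: signed_vector_def inner_sum_left)
  also have "\<dots> = (\<Sum>d\<in>A. if d = b then if d \<in> M then -1 else 1 else 0)"
    using assms by (intro sum.cong) (auto simp: inner_Basis)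
  finally show ?thesis using fin by simp
qed

lemma sign_patternsD:
  assumes "(A, M) \<in> sign_patterns k"
  shows "A \<subseteq> Basis" "M \<subseteq> A" "card A = support_size DIM('a::euclidean_space) k" "finite (A::'a set)" "finite M"
  using assms finite_subset[OF _ finite_Basis] by (auto simp: sign_patterns_def intro: finite_subset)

lemma finite_sign_patterns: "finite (sign_patterns k :: ('a::euclidean_space set \<times> 'a set) set)"
  by (rule finite_subset[of _ "Pow Basis \<times> Pow Basis"]) (auto simp: sign_patterns_def)

lemma finite_signed_orbit: "finite (signed_orbit k s)"
  by (simp add: signed_orbit_def finite_sign_patterns)

lemma support_size_pos: "1 \<le> k \<Longrightarrow> k \<le> n \<Longrightarrow> 0 < support_size n k"
  by (auto simp: support_size_def)

lemma support_size_le: "k \<le> n \<Longrightarrow> support_size n k \<le> n"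
  by (auto simp: support_size_def)

lemma inj_on_signed_vector:
  assumes "c \<noteq> 0"
  shows "inj_on (\<lambda>(A, M). c *\<^sub>R (signed_vector A M :: 'a::euclidean_space)) (sign_patterns k)"
proof (rule inj_onI, clarify)
  fix A M A' M' :: "'a set"
  assume P: "(A, M) \<in> sign_patterns k" "(A', M') \<in> sign_patterns k"
    and eq: "c *\<^sub>R signed_vector A M = c *\<^sub>R signed_vector A' M'"
  have *: "(if b \<in> A then if b \<in> M then -1 else 1 else 0::real) = (if b \<in> A' then if b \<in> M' then -1 else 1 else 0)"
    if "b \<in> Basis" for b
    using eq assms inner_signed_vector[OF sign_patternsD(1)[OF P(1)] that, of M]
      inner_signed_vector[OF sign_patternsD(1)[OF P(2)] that, of M'] by simp
  have "b \<in> A \<longleftrightarrow> b \<in> A'" "b \<in> M \<longleftrightarrow> b \<in> M'" if "b \<in> Basis" for b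
    using *[OF that] sign_patternsD(2)[OF P(1)] sign_patternsD(2)[OF P(2)] by (auto split: if_splits)
  then show "A = A' \<and> M = M'"
    using sign_patternsD(1,2)[OF P(1)] sign_patternsD(1,2)[OF P(2)] by blast
qed

lemma card_fixed_support:
  fixes A :: "'a::euclidean_space set"
  assumes "A \<subseteq> Basis" "card A = support_size DIM('a) k" "1 \<le> k" "k \<le> DIM('a)"
  shows "card {M. (A, M) \<in> sign_patterns k} = (if k \<ge> DIM('a) - 1 then 2 ^ (DIM('a) - 1) else 2 ^ k)"
proof (cases "k \<ge> DIM('a) - 1")
  case True
  then have "A = Basis"
    using assms by (intro card_subset_eq) (auto simp: support_size_def)
  have eq: "card {M::'a set. M \<subseteq> Basis \<and> even (card M)} = card {M::'a set. M \<subseteq> Basis \<and> odd (card M)}"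
  proof -
    have "{} \<subset> (Basis :: 'a set)" using nonempty_Basis by blast
    from card_subsupersets_even_odd[OF finite_Basis this] show ?thesis by simp
  qed
  have "card {M::'a set. M \<subseteq> Basis \<and> even (card M)} + card {M::'a set. M \<subseteq> Basis \<and> odd (card M)} = card (Pow (Basis::'a set))"
    by (subst card_Un_disjoint[symmetric]) (auto intro!: arg_cong[where f=card])
  also have "\<dots> = 2 * 2 ^ (DIM('a) - 1)"
    by (simp add: card_Pow power_eq_if)
  finally have cards: "card {M::'a set. M \<subseteq> Basis \<and> even (card M)} = 2 ^ (DIM('a) - 1)"
    "card {M::'a set. M \<subseteq> Basis \<and> odd (card M)} = 2 ^ (DIM('a) - 1)"
    using eq by simp_all
  have ne: "DIM('a) \<noteq> DIM('a) - Suc 0"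
    using DIM_positive[where 'a='a] by linarith
  have "{M. (A, M) \<in> sign_patterns k} =
      (if k = DIM('a) then {M. M \<subseteq> Basis \<and> even (card M)} else {M. M \<subseteq> Basis \<and> odd (card M)})"
    unfolding sign_patterns_def \<open>A = Basis\<close> using True \<open>k \<le> DIM('a)\<close>
    by (cases "k = DIM('a)") (auto simp: support_size_def ne)
  then show ?thesis
    using True by (simp add: cards)
next
  case False
  then have "{M. (A, M) \<in> sign_patterns k} = Pow A"
    using assms by (auto simp: sign_patterns_def)
  then show ?thesis
    using False assms finite_subset[OF assms(1) finite_Basis] by (simp add: card_Pow support_size_def)
qed

text \<open>The quotient form, rather than \<open>card S - card B choose (k - card B)\<close>, also
  covers \<open>k < card B\<close>, where both sides vanish, and turns into a rational function of
  \<open>k\<close> for small \<open>B\<close>.\<close>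

lemma card_supersets:
  assumes "finite S" "B \<subseteq> S" "k \<le> card S"
  shows "real (card {A. B \<subseteq> A \<and> A \<subseteq> S \<and> card A = k}) = (card S choose k) * (k choose card B) / (card S choose card B)"
proof (cases "card B \<le> k")
  case True
  have fB: "finite B" using assms finite_subset by blast
  have "bij_betw (\<lambda>C. B \<union> C) {C. C \<subseteq> S - B \<and> card C = k - card B} {A. B \<subseteq> A \<and> A \<subseteq> S \<and> card A = k}"
  proof (rule bij_betwI[where g="\<lambda>A. A - B"], goal_cases)
    case 1
    have "card (B \<union> C) = k" if "C \<subseteq> S - B" "card C = k - card B" for C
      using that True assms fB finite_subset[of C "S - B"] by (subst card_Un_disjoint) auto
    then show ?case using assms by auto
  next
    case 2
    show ?case using assms fB by (auto simp: card_Diff_subset)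
  qed auto
  then have "card {A. B \<subseteq> A \<and> A \<subseteq> S \<and> card A = k} = card (S - B) choose (k - card B)"
    using assms by (simp add: bij_betw_same_card[symmetric] n_subsets)
  also have "card (S - B) = card S - card B"
    using assms fB by (simp add: card_Diff_subset)
  finally have "card {A. B \<subseteq> A \<and> A \<subseteq> S \<and> card A = k} = (card S - card B) choose (k - card B)" .
  moreover have "(card S choose k) * (k choose card B) = (card S choose card B) * ((card S - card B) choose (k - card B))"
    using True assms by (intro choose_mult)
  moreover have "(card S choose card B) > 0"
    using assms by (intro zero_less_binomial card_mono)
  ultimately show ?thesis
    unfolding of_nat_mult[symmetric] by (simp only:) simp
next
  case False
  have "card B \<le> k" if "B \<subseteq> A" "A \<subseteq> S" "card A = k" for A
    using that assms by (metis card_mono finite_subset)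
  then have empty: "{A. B \<subseteq> A \<and> A \<subseteq> S \<and> card A = k} = {}"
    using False by auto
  show ?thesis using False unfolding empty by (simp add: binomial_eq_0)
qed

text \<open>A monomial with even exponents has one value wherever its variables \<open>B\<close> lie
  in the support and is zero elsewhere, so orbit sums reduce to counting supports.
  \<open>B = {}\<close> counts the orbit itself, and \<open>B = Basis\<close> serves the product of
  all coordinates.\<close>

lemma sum_signed_orbit:
  fixes f :: "'a::euclidean_space \<Rightarrow> real"
  assumes k: "1 \<le> k" "k \<le> DIM('a)" and "s \<noteq> 0" and B: "B \<subseteq> Basis"
    and f: "\<And>A M. (A, M) \<in> sign_patterns k \<Longrightarrow>
      f ((s / sqrt (support_size DIM('a) k)) *\<^sub>R signed_vector A M) = (if B \<subseteq> A then v else 0)"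
  shows "(\<Sum>x\<in>signed_orbit k s. f x) =
    v * orbit_size DIM('a) k * (support_size DIM('a) k choose card B) / (DIM('a) choose card B)"
proof -
  let ?S = "support_size DIM('a) k"
  let ?m = "(if k \<ge> DIM('a) - 1 then 2 ^ (DIM('a) - 1) else 2 ^ k) :: nat"
  have c: "s / sqrt ?S \<noteq> 0"
    using assms support_size_pos[OF k] by simp
  have "(\<Sum>x\<in>signed_orbit k s. f x) = (\<Sum>(A, M)\<in>sign_patterns k. if B \<subseteq> A then v else 0)"
    unfolding signed_orbit_def
    by (subst sum.reindex[OF inj_on_signed_vector[OF c]]) (auto intro!: sum.cong simp: f)
  also have "(sign_patterns k :: ('a set \<times> 'a set) set) = Sigma {A. A \<subseteq> Basis \<and> card A = ?S} (\<lambda>A. {M. (A, M) \<in> sign_patterns k})"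
    by (auto simp: sign_patterns_def)
  also have "(\<Sum>(A, M)\<in>\<dots>. if B \<subseteq> A then v else 0) =
      (\<Sum>A\<in>{A. A \<subseteq> Basis \<and> card A = ?S}. \<Sum>M\<in>{M. (A, M) \<in> sign_patterns k}. if B \<subseteq> A then v else 0)"
    by (subst sum.Sigma)
       (auto intro!: finite_subset[of _ "Pow Basis :: 'a set set"] simp: sign_patterns_def)
  also have "\<dots> = (\<Sum>A\<in>{A. A \<subseteq> Basis \<and> card A = ?S}. if B \<subseteq> A then ?m * v else 0)"
    using k by (intro sum.cong refl) (auto simp: card_fixed_support)
  also have "\<dots> = (\<Sum>A\<in>{A. B \<subseteq> A \<and> A \<subseteq> Basis \<and> card A = ?S}. ?m * v)"
  proof -
    have "{A. B \<subseteq> A \<and> A \<subseteq> Basis \<and> card A = ?S} = {A \<in> {A. A \<subseteq> Basis \<and> card A = ?S}. B \<subseteq> A}"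
      by blast
    moreover have "finite {A :: 'a set. A \<subseteq> Basis \<and> card A = ?S}"
      by (rule finite_subset[of _ "Pow Basis"]) auto
    ultimately show ?thesis by (simp only: sum.inter_filter)
  qed
  also have "\<dots> = ?m * v * ((DIM('a) choose ?S) * (?S choose card B) / (DIM('a) choose card B))"
    using card_supersets[OF finite_Basis B support_size_le[OF k(2)]] by simp
  also have "\<dots> = v * orbit_size DIM('a) k * (?S choose card B) / (DIM('a) choose card B)"
    by (simp add: orbit_size_def support_size_def)
  finally show ?thesis .
qed

lemma card_signed_orbit:
  assumes "1 \<le> k" "k \<le> DIM('a)" "s \<noteq> 0"
  shows "card (signed_orbit k s :: 'a::euclidean_space set) = orbit_size DIM('a) k"
proof -
  have "real (card (signed_orbit k s :: 'a set)) = real (orbit_size DIM('a) k)"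
    using sum_signed_orbit[OF assms, of "{}" "\<lambda>_::'a. 1" 1] by simp
  then show ?thesis by simp
qed

lemma norm_signed_orbit:
  fixes x :: "'a::euclidean_space"
  assumes k: "1 \<le> k" "k \<le> DIM('a)" and "s \<ge> 0" and x: "x \<in> signed_orbit k s"
  shows "norm x = s"
proof -
  obtain A M where P: "(A, M) \<in> sign_patterns k"
    and xA: "x = (s / sqrt (support_size DIM('a) k)) *\<^sub>R signed_vector A M"
    using x by (auto simp: signed_orbit_def)
  have "(norm (signed_vector A M))\<^sup>2 = (\<Sum>b\<in>Basis. if b \<in> A then 1 else 0)"
    unfolding norm_square_eq_sum_Basis
    using sign_patternsD[OF P] by (intro sum.cong) (auto simp: inner_signed_vector)
  also have "\<dots> = support_size DIM('a) k"
    using sign_patternsD[OF P] by (simp add: sum.If_cases Int_absorb1)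
  finally have "norm (signed_vector A M) = sqrt (support_size DIM('a) k)"
    by (metis norm_ge_zero real_sqrt_unique)
  then show ?thesis
    using xA \<open>s \<ge> 0\<close> support_size_pos[OF k] by simp
qed

lemma prod_signed_vector:
  fixes M :: "'a::euclidean_space set"
  assumes "M \<subseteq> Basis"
  shows "(\<Prod>b\<in>Basis. signed_vector Basis M \<bullet> b) = (-1) ^ card M"
proof -
  have "(\<Prod>b\<in>Basis. signed_vector Basis M \<bullet> b) = (\<Prod>b\<in>Basis. if b \<in> M then -1 else 1)"
    by (intro prod.cong) (auto simp: inner_signed_vector)
  also have "\<dots> = (-1) ^ card M"
    using assms by (simp add: prod.If_cases Int_absorb1)
  finally show ?thesis .
qed

text \<open>Positive scaling keeps support and signs, so different radii cannot make orbits meet;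
  the two half-spin types are separated by the parity of the number of minus signs.\<close>

lemma signed_orbit_disjoint:
  assumes k: "1 \<le> k" "k \<le> DIM('a)" and l: "1 \<le> l" "l \<le> DIM('a)" and "k \<noteq> l" "s > 0" "s' > 0"
  shows "signed_orbit k s \<inter> signed_orbit l s' = ({} :: 'a::euclidean_space set)"
proof (rule ccontr)
  assume "signed_orbit k s \<inter> signed_orbit l s' \<noteq> ({} :: 'a set)"
  then obtain A M A' M' :: "'a set" where P: "(A, M) \<in> sign_patterns k" "(A', M') \<in> sign_patterns l"
    and eq: "(s / sqrt (support_size DIM('a) k)) *\<^sub>R signed_vector A M =
      (s' / sqrt (support_size DIM('a) l)) *\<^sub>R signed_vector A' M'"
    unfolding signed_orbit_def by fastforce
  define c where "c = s / sqrt (support_size DIM('a) k)"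
  define c' where "c' = s' / sqrt (support_size DIM('a) l)"
  have c: "c > 0" "c' > 0"
    using assms support_size_pos by (auto simp: c_def c'_def)
  have *: "c * (if b \<in> A then if b \<in> M then -1 else 1 else 0) = c' * (if b \<in> A' then if b \<in> M' then -1 else 1 else 0)"
    if "b \<in> Basis" for b
    using arg_cong[OF eq, of "\<lambda>x. x \<bullet> b"] sign_patternsD(1)[OF P(1)] sign_patternsD(1)[OF P(2)] that
    by (simp add: inner_signed_vector c_def c'_def)
  have "b \<in> A \<longleftrightarrow> b \<in> A'" "b \<in> M \<longleftrightarrow> b \<in> M'" if "b \<in> Basis" for b
    using *[OF that] c sign_patternsD(2)[OF P(1)] sign_patternsD(2)[OF P(2)] by (auto split: if_splits)
  then have "A = A'" "M = M'"
    using sign_patternsD(1,2)[OF P(1)] sign_patternsD(1,2)[OF P(2)] by blast+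
  then show False
    using P k l \<open>k \<noteq> l\<close> by (auto simp: sign_patterns_def support_size_def split: if_splits)
qed

section \<open>The orbits of the corner vectors\<close>

definition toggle :: "'a \<Rightarrow> 'a set \<Rightarrow> 'a set" where
  "toggle b M = (if b \<in> M then M - {b} else insert b M)"

lemma toggle_toggle [simp]: "toggle b (toggle b M) = M"
  by (auto simp: toggle_def)

lemma mem_toggle: "d \<in> toggle b M \<longleftrightarrow> (if d = b then d \<notin> M else d \<in> M)"
  by (auto simp: toggle_def)

lemma even_card_toggle: "finite M \<Longrightarrow> even (card (toggle b M)) \<longleftrightarrow> odd (card M)"
  by (cases "b \<in> M"; cases "card M") (auto simp: toggle_def)

lemma inner_signed_vector_toggle:
  fixes b d :: "'a::euclidean_space"
  assumes "A \<subseteq> Basis" "d \<in> Basis"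
  shows "signed_vector A (if b \<in> A then toggle b M else M) \<bullet> d =
    (if d = b then -1 else 1) * (signed_vector A M \<bullet> d)"
  using assms by (auto simp: inner_signed_vector mem_toggle)

lemma hyperplane_reflection_diff_Basis:
  fixes b c :: "'a::euclidean_space"
  assumes "b \<in> Basis" "c \<in> Basis" "b \<noteq> c"
  shows "hyperplane_reflection (b - c) x = x - (x \<bullet> b - x \<bullet> c) *\<^sub>R (b - c)"
proof -
  have "(b - c) \<bullet> (b - c) = 2"
    using assms by (simp add: inner_diff_left inner_diff_right inner_Basis)
  then show ?thesis by (simp add: hyperplane_reflection_def inner_diff_right)
qed

lemma hyperplane_reflection_add_Basis:
  fixes b c :: "'a::euclidean_space"
  assumes "b \<in> Basis" "c \<in> Basis" "b \<noteq> c"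
  shows "hyperplane_reflection (b + c) x = x - (x \<bullet> b + x \<bullet> c) *\<^sub>R (b + c)"
proof -
  have "(b + c) \<bullet> (b + c) = 2"
    using assms by (simp add: inner_add_left inner_add_right inner_Basis)
  then show ?thesis by (simp add: hyperplane_reflection_def inner_add_right)
qed

lemma inner_hyperplane_reflection_Basis:
  fixes b c d :: "'a::euclidean_space"
  assumes "b \<in> Basis" "c \<in> Basis" "b \<noteq> c" "d \<in> Basis"
  shows "hyperplane_reflection (b - c) x \<bullet> d = (if d = b then x \<bullet> c else if d = c then x \<bullet> b else x \<bullet> d)"
    and "hyperplane_reflection (b + c) x \<bullet> d = (if d = b then - (x \<bullet> c) else if d = c then - (x \<bullet> b) else x \<bullet> d)"
  using assms
  by (auto simp: hyperplane_reflection_diff_Basis hyperplane_reflection_add_Basis inner_diff_left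
      inner_add_left inner_Basis)

lemma signed_orbit_reflection_diff:
  fixes b c :: "'a::euclidean_space"
  assumes bc: "b \<in> Basis" "c \<in> Basis" "b \<noteq> c" and x: "x \<in> signed_orbit k s"
  shows "hyperplane_reflection (b - c) x \<in> signed_orbit k s"
proof -
  define q where "q = s / sqrt (support_size DIM('a) k)"
  obtain A M where P: "(A, M) \<in> sign_patterns k" and xA: "x = q *\<^sub>R signed_vector A M"
    using x by (auto simp: signed_orbit_def q_def)
  let ?t = "Transposition.transpose b c"
  have inj: "inj ?t" by (rule inj_transpose)
  have sub: "?t ` A \<subseteq> Basis"
    using sign_patternsD(1)[OF P] bc by (auto simp: Transposition.transpose_def)
  have P': "(?t ` A, ?t ` M) \<in> sign_patterns k"
  proof -
    have "card (?t ` S) = card S" for S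
      using inj by (intro card_image) (auto intro: inj_on_subset)
    then show ?thesis
      using P sub by (auto simp: sign_patterns_def)
  qed
  have mem: "d \<in> ?t ` S \<longleftrightarrow> ?t d \<in> S" for d S
    by (metis image_iff transpose_involutory)
  have "hyperplane_reflection (b - c) x = q *\<^sub>R signed_vector (?t ` A) (?t ` M)"
  proof (rule euclidean_eqI)
    fix d :: 'a assume d: "d \<in> Basis"
    show "hyperplane_reflection (b - c) x \<bullet> d = q *\<^sub>R signed_vector (?t ` A) (?t ` M) \<bullet> d"
      using bc d sign_patternsD(1)[OF P] sub unfolding xA
      by (simp add: inner_hyperplane_reflection_Basis inner_signed_vector mem)
  qed
  then show ?thesis
    using P' by (auto simp: signed_orbit_def q_def)
qed

text \<open>Effect on the sign set of changing the signs of coordinates \<open>b\<close> and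
  \<open>c\<close>, ignoring those outside the support. Two such changes preserve the parity that
  separates the half-spin types.\<close>

definition double_toggle :: "'a set \<Rightarrow> 'a \<Rightarrow> 'a \<Rightarrow> 'a set \<Rightarrow> 'a set" where
  "double_toggle A b c M =
     (if c \<in> A then toggle c (if b \<in> A then toggle b M else M) else if b \<in> A then toggle b M else M)"

lemma inner_signed_vector_double_toggle:
  fixes b c d :: "'a::euclidean_space"
  assumes "A \<subseteq> Basis" "d \<in> Basis" "b \<noteq> c"
  shows "signed_vector A (double_toggle A b c M) \<bullet> d =
    (if d = b \<or> d = c then - (signed_vector A M \<bullet> d) else signed_vector A M \<bullet> d)"
  unfolding double_toggle_def inner_signed_vector_toggle[OF assms(1,2)] using assms(3) by auto

lemma sign_patterns_double_toggle:
  fixes A M :: "'a::euclidean_space set" and b c :: 'a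
  assumes "(A, M) \<in> sign_patterns k" "b \<in> Basis" "c \<in> Basis"
  shows "(A, double_toggle A b c M) \<in> sign_patterns k"
proof -
  define M' where "M' = (if b \<in> A then toggle b M else M)"
  let ?M = "if c \<in> A then toggle c M' else M'"
  have "finite M" "M' \<subseteq> A" "finite M'"
    using sign_patternsD(2,5)[OF assms(1)] by (auto simp: M'_def toggle_def)
  moreover have "?M \<subseteq> A"
    using \<open>M' \<subseteq> A\<close> by (auto simp: toggle_def)
  moreover have "b \<in> A \<and> c \<in> A" if "k = DIM('a) \<or> k = DIM('a) - 1"
  proof -
    have "A = Basis"
      using assms(1) that by (intro card_subset_eq) (auto simp: sign_patterns_def support_size_def)
    then show ?thesis using assms by simp
  qed
  ultimately have "even (card ?M) = even (card M)" if "k = DIM('a) \<or> k = DIM('a) - 1"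
    using that by (simp add: M'_def even_card_toggle)
  with \<open>?M \<subseteq> A\<close> assms(1) have "(A, ?M) \<in> sign_patterns k"
    unfolding sign_patterns_def by blast
  then show ?thesis unfolding double_toggle_def M'_def .
qed

text \<open>The reflection in \<open>b + c\<close> is the sign change of both coordinates followed
  by their exchange, so the case of \<open>b - c\<close> can be reused.\<close>

lemma signed_orbit_reflection_add:
  fixes b c :: "'a::euclidean_space"
  assumes bc: "b \<in> Basis" "c \<in> Basis" "b \<noteq> c" and x: "x \<in> signed_orbit k s"
  shows "hyperplane_reflection (b + c) x \<in> signed_orbit k s"
proof -
  define q where "q = s / sqrt (support_size DIM('a) k)"
  obtain A M where P: "(A, M) \<in> sign_patterns k" and xA: "x = q *\<^sub>R signed_vector A M"
    using x by (auto simp: signed_orbit_def q_def)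
  let ?M = "double_toggle A b c M"
  have A: "A \<subseteq> Basis" using sign_patternsD(1)[OF P] .
  have "q *\<^sub>R signed_vector A ?M \<in> signed_orbit k s"
    using sign_patterns_double_toggle[OF P bc(1,2)] unfolding signed_orbit_def q_def by (intro image_eqI) auto
  then have "hyperplane_reflection (b - c) (q *\<^sub>R signed_vector A ?M) \<in> signed_orbit k s"
    by (rule signed_orbit_reflection_diff[OF bc])
  also have "hyperplane_reflection (b - c) (q *\<^sub>R signed_vector A ?M) = hyperplane_reflection (b + c) x"
    unfolding xA
    by (rule euclidean_eqI) (use bc A in \<open>simp add: inner_hyperplane_reflection_Basis inner_signed_vector_double_toggle\<close>)
  finally show ?thesis .
qed

text \<open>Transitivity without mentioning the group. Exchanges of coordinates first move the
  support to the desired one; then wrong signs are corrected two at a time.\<close>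

lemma closed_imp_signed_orbit_subset:
  fixes Q :: "'a::euclidean_space set"
  assumes diff: "\<And>b c x. b \<in> Basis \<Longrightarrow> c \<in> Basis \<Longrightarrow> b \<noteq> c \<Longrightarrow> x \<in> Q \<Longrightarrow> hyperplane_reflection (b - c) x \<in> Q"
    and add: "\<And>b c x. b \<in> Basis \<Longrightarrow> c \<in> Basis \<Longrightarrow> b \<noteq> c \<Longrightarrow> x \<in> Q \<Longrightarrow> hyperplane_reflection (b + c) x \<in> Q"
    and x: "x \<in> Q" "x \<in> signed_orbit k s" and k: "k \<le> DIM('a)"
  shows "signed_orbit k s \<subseteq> Q"
proof -
  define q where "q = s / sqrt (support_size DIM('a) k)"
  define v where "v = (\<lambda>A M. q *\<^sub>R (signed_vector A M :: 'a))"
  have supports: "\<exists>M. (B, M) \<in> sign_patterns k \<and> v B M \<in> Q"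
    if "(A, M) \<in> sign_patterns k" "v A M \<in> Q" "B \<subseteq> Basis" "card B = support_size DIM('a) k" for A B M
    using that(1,2)
  proof (induction "card (A - B)" arbitrary: A M rule: less_induct)
    case less
    note P = sign_patternsD[OF less.prems(1)]
    show ?case
    proof (cases "A \<subseteq> B")
      case True
      then have "A = B"
        using P that finite_subset[OF that(3) finite_Basis] by (intro card_subset_eq) auto
      then show ?thesis using less.prems by blast
    next
      case False
      then obtain b where b: "b \<in> A" "b \<notin> B" by blast
      have "\<not> B \<subseteq> A"
        using b that(4) P by (metis card_subset_eq)
      then obtain c where c: "c \<in> B" "c \<notin> A" by blast
      have bc: "b \<in> Basis" "c \<in> Basis" "b \<noteq> c" using b c P that by auto
      have "hyperplane_reflection (b - c) (v A M) \<in> signed_orbit k s"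
        using less.prems by (intro signed_orbit_reflection_diff bc) (auto simp: signed_orbit_def v_def q_def)
      let ?A = "insert c (A - {b})" and ?M = "if b \<in> M then insert c (M - {b}) else M"
      have sub: "A - {b} \<subseteq> Basis" using P by auto
      have eq: "hyperplane_reflection (b - c) (v A M) = v ?A ?M"
        by (rule euclidean_eqI) (use bc b c P sub in \<open>auto simp: v_def inner_hyperplane_reflection_Basis inner_signed_vector\<close>)
      have "card ?A = card A"
        using b(1) c(2) P(4) by (cases "card A") auto
      moreover have "card ?M = card M"
      proof -
        have "c \<notin> M" using c(2) P(2) by auto
        then show ?thesis using P(5) by (cases "b \<in> M"; cases "card M") auto
      qed
      ultimately have "(?A, ?M) \<in> sign_patterns k"
        using less.prems(1) bc P by (auto simp: sign_patterns_def)
      moreover have "v ?A ?M \<in> Q"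
        using diff[OF bc less.prems(2)] eq by simp
      moreover have "card (?A - B) < card (A - B)"
        using b c P by (intro psubset_card_mono) auto
      ultimately show ?thesis using less.hyps by blast
    qed
  qed
  have signs: "v A M' \<in> Q" if "(A, M) \<in> sign_patterns k" "v A M \<in> Q" "(A, M') \<in> sign_patterns k" for A M M'
    using that(1,2)
  proof (induction "card ((M - M') \<union> (M' - M))" arbitrary: M rule: less_induct)
    case less
    define F where "F = (M - M') \<union> (M' - M)"
    have F: "d \<in> F \<longleftrightarrow> (d \<in> M) \<noteq> (d \<in> M')" for d by (auto simp: F_def)
    note P = sign_patternsD[OF less.prems(1)] and P' = sign_patternsD[OF that(3)]
    have double: "v A (double_toggle A b c M) \<in> Q" if "b \<in> Basis" "c \<in> Basis" "b \<noteq> c" for b c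
    proof -
      have "hyperplane_reflection (b - c) (hyperplane_reflection (b + c) (v A M)) \<in> Q"
        using that less.prems(2) by (intro diff add)
      also have "hyperplane_reflection (b - c) (hyperplane_reflection (b + c) (v A M)) =
          v A (double_toggle A b c M)"
        by (rule euclidean_eqI) (use that P(1) in \<open>simp add: v_def inner_hyperplane_reflection_Basis inner_signed_vector_double_toggle\<close>)
      finally show ?thesis .
    qed
    show ?case
    proof (cases "\<exists>b\<in>F. \<exists>c\<in>F. b \<noteq> c")
      case True
      then obtain b c where bc: "b \<in> F" "c \<in> F" "b \<noteq> c" by blast
      have A: "b \<in> A" "c \<in> A" "b \<in> Basis" "c \<in> Basis" using bc P P' by (auto simp: F_def)
      let ?M = "toggle c (toggle b M)"
      have dt: "double_toggle A b c M = ?M" using A by (simp add: double_toggle_def)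
      have "(A, ?M) \<in> sign_patterns k"
        using sign_patterns_double_toggle[OF less.prems(1) A(3,4)] unfolding dt .
      moreover have "v A ?M \<in> Q"
        using double[OF A(3,4) bc(3)] unfolding dt .
      moreover have "(?M - M') \<union> (M' - ?M) = F - {b, c}"
      proof (rule Set.set_eqI)
        fix d show "d \<in> (?M - M') \<union> (M' - ?M) \<longleftrightarrow> d \<in> F - {b, c}"
          using bc by (cases "d = b"; cases "d = c") (auto simp: mem_toggle F)
      qed
      moreover have "card (F - {b, c}) < card F"
        using bc P P' by (intro psubset_card_mono) (auto simp: F_def)
      ultimately show ?thesis using less.hyps[of ?M] by (simp add: F_def)
    next
      case False
      then consider "F = {}" | b where "F = {b}" by blast
      then show ?thesis
      proof cases
        case 1
        then have "M = M'" using F by blast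
        then show ?thesis using less.prems by simp
      next
        case (2 b)
        then have eq: "M' = toggle b M" using F by (intro Set.set_eqI) (auto simp: mem_toggle)
        have b: "b \<in> A" "b \<in> Basis" using 2 P P' F[of b] by auto
        show ?thesis
        proof (cases "k \<ge> DIM('a) - 1")
          case True
          then have "even (card M) = even (card M')"
            using k less.prems(1) that(3) by (cases "k = DIM('a)") (auto simp: sign_patterns_def)
          then show ?thesis
            using even_card_toggle[OF P(5), of b] unfolding eq by simp
        next
          case False
          then have "card A < DIM('a)" using P(3) by (auto simp: support_size_def)
          \<comment> \<open>The sign change at \<open>c\<close>, outside the support, has no effect,
            so a single wrong sign at \<open>b\<close> can be corrected.\<close>
          then obtain c where "c \<in> Basis" "c \<notin> A"
            using P(4) by (metis card_mono leD subsetI)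
          then show ?thesis
            using double[of b c] b unfolding eq by (auto simp: double_toggle_def)
        qed
      qed
    qed
  qed
  obtain A M where "(A, M) \<in> sign_patterns k" "v A M \<in> Q"
    using x by (auto simp: signed_orbit_def v_def q_def)
  then have "v A' M' \<in> Q" if "(A', M') \<in> sign_patterns k" for A' M'
    using supports[of A M A'] signs[of A' _ M'] that sign_patternsD(1,3)[OF that] by blast
  then show ?thesis
    by (auto simp: signed_orbit_def v_def q_def)
qed

section \<open>The reflection group and its orbits\<close>

lemma hyperplane_reflection_involution: "hyperplane_reflection \<alpha> (hyperplane_reflection \<alpha> x) = x"
  by (cases "\<alpha> = 0") (simp_all add: hyperplane_reflection_def inner_diff_left)

lemma hyperplane_reflection_in_BijGroup: "hyperplane_reflection \<alpha> \<in> carrier (BijGroup UNIV)"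
  by (simp add: BijGroup_def Bij_def involuntory_imp_bij hyperplane_reflection_involution)

lemma inv_hyperplane_reflection:
  "inv\<^bsub>BijGroup UNIV\<^esub> (hyperplane_reflection \<alpha>) = hyperplane_reflection \<alpha>"
proof (rule group.inv_equality[OF group_BijGroup])
  show "hyperplane_reflection \<alpha> \<otimes>\<^bsub>BijGroup UNIV\<^esub> hyperplane_reflection \<alpha> = \<one>\<^bsub>BijGroup UNIV\<^esub>"
    using hyperplane_reflection_in_BijGroup[of \<alpha>]
    by (simp add: BijGroup_def compose_def hyperplane_reflection_involution restrict_def)
qed (rule hyperplane_reflection_in_BijGroup)+

lemma D_group_subset_carrier: "D_group e n \<subseteq> carrier (BijGroup UNIV)"
  unfolding D_group_def
  by (rule group.generate_incl[OF group_BijGroup]) (auto intro: hyperplane_reflection_in_BijGroup)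

lemma BijGroup_UNIV_mult:
  assumes "g \<in> carrier (BijGroup UNIV)" "h \<in> carrier (BijGroup UNIV)"
  shows "g \<otimes>\<^bsub>BijGroup UNIV\<^esub> h = (\<lambda>x. g (h x))"
  using assms by (simp add: BijGroup_def compose_def restrict_def)

text \<open>The group enters only through sets closed under the generators; inverses of generators
  cause no trouble because reflections are involutions.\<close>

lemma D_group_closed:
  assumes "g \<in> D_group e n" "x \<in> Q"
    and "\<And>\<alpha> x. \<alpha> \<in> fundamental_roots e n \<Longrightarrow> x \<in> Q \<Longrightarrow> hyperplane_reflection \<alpha> x \<in> Q"
  shows "g x \<in> Q"
  using assms(1,2) unfolding D_group_def
proof (induction arbitrary: x rule: generate.induct)
  case one
  then show ?case by (simp add: BijGroup_def)
next
  case (incl h)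
  then show ?case using assms(3) by auto
next
  case (inv h)
  then show ?case using assms(3) by (auto simp: inv_hyperplane_reflection)
next
  case (eng h1 h2)
  then have "h1 \<in> carrier (BijGroup UNIV)" "h2 \<in> carrier (BijGroup UNIV)"
    using D_group_subset_carrier[of e n, unfolded D_group_def] by blast+
  then show ?case using eng by (simp add: BijGroup_UNIV_mult)
qed

lemma corner_orbit_closed:
  assumes \<alpha>: "\<alpha> \<in> fundamental_roots e n" and x: "x \<in> corner_orbit e n k"
  shows "hyperplane_reflection \<alpha> x \<in> corner_orbit e n k"
proof -
  obtain g where g: "g \<in> D_group e n" "x = g (corner_vector e n k)"
    using x by (auto simp: corner_orbit_def)
  have "hyperplane_reflection \<alpha> \<otimes>\<^bsub>BijGroup UNIV\<^esub> g \<in> D_group e n"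
    unfolding D_group_def by (rule generate.eng[OF generate.incl[OF imageI[OF \<alpha>]] g(1)[unfolded D_group_def]])
  moreover have "hyperplane_reflection \<alpha> \<otimes>\<^bsub>BijGroup UNIV\<^esub> g = (\<lambda>x. hyperplane_reflection \<alpha> (g x))"
    using g(1) D_group_subset_carrier[of e n]
    by (intro BijGroup_UNIV_mult hyperplane_reflection_in_BijGroup) blast
  ultimately show ?thesis
    unfolding corner_orbit_def g(2) by (intro image_eqI[where x="\<lambda>x. hyperplane_reflection \<alpha> (g x)"]) simp_all
qed

lemma corner_vector_in_corner_orbit: "corner_vector e n k \<in> corner_orbit e n k"
proof -
  have "\<one>\<^bsub>BijGroup UNIV\<^esub> \<in> D_group e n"
    unfolding D_group_def by (rule generate.one)
  then show ?thesis
    unfolding corner_orbit_def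
    by (intro image_eqI[where x="\<one>\<^bsub>BijGroup UNIV\<^esub>"]) (simp_all add: BijGroup_def)
qed

context
  fixes e :: "nat \<Rightarrow> 'a::euclidean_space" and n :: nat
  assumes e: "bij_betw e {1..n} Basis" and n2: "n \<ge> 2"
begin

lemma e_Basis: "i \<in> {1..n} \<Longrightarrow> e i \<in> Basis"
  using e by (auto simp: bij_betw_def)

lemma e_eq_iff: "i \<in> {1..n} \<Longrightarrow> j \<in> {1..n} \<Longrightarrow> e i = e j \<longleftrightarrow> i = j"
  by (rule inj_on_eq_iff[OF bij_betw_imp_inj_on[OF e]])

lemma DIM_eq: "DIM('a) = n"
  using bij_betw_same_card[OF e] by simp

text \<open>Conjugating the reflection for \<open>j, k\<close> by the one for \<open>i, j\<close>
  gives the one for \<open>i, k\<close>, so the simple roots reach every pair of indices.\<close>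

lemma closed_under_root_differences:
  assumes root: "\<And>\<alpha> x. \<alpha> \<in> fundamental_roots e n \<Longrightarrow> x \<in> Q \<Longrightarrow> hyperplane_reflection \<alpha> x \<in> Q"
    and bc: "b \<in> Basis" "c \<in> Basis" "b \<noteq> c" and x: "x \<in> Q"
  shows "hyperplane_reflection (b - c) x \<in> Q"
proof -
  have less: "hyperplane_reflection (e i - e j) x \<in> Q" if "1 \<le> i" "i < j" "j \<le> n" "x \<in> Q" for i j x
    using that(2,1,3,4)
  proof (induction i j arbitrary: x rule: less_Suc_induct)
    case (1 i)
    then have "e i - e (Suc i) \<in> fundamental_roots e n"
      unfolding fundamental_roots_def by (intro UnI1 CollectI exI[of _ i]) auto
    then show ?case using 1(3) by (rule root)
  next
    case (2 i j k)
    have ijk: "i \<in> {1..n}" "j \<in> {1..n}" "k \<in> {1..n}" "i \<noteq> j" "j \<noteq> k" "i \<noteq> k"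
      using 2(1,2,5,6) by auto
    have B: "e i \<in> Basis" "e j \<in> Basis" "e k \<in> Basis" "e i \<noteq> e j" "e j \<noteq> e k" "e i \<noteq> e k"
      using ijk by (simp_all add: e_Basis e_eq_iff)
    have "hyperplane_reflection (e i - e j) (hyperplane_reflection (e j - e k) (hyperplane_reflection (e i - e j) x)) \<in> Q"
      using ijk 2(5-7) by (intro 2(3,4)) auto
    also have "hyperplane_reflection (e i - e j) (hyperplane_reflection (e j - e k) (hyperplane_reflection (e i - e j) x)) =
        hyperplane_reflection (e i - e k) x"
      by (rule euclidean_eqI) (use B in \<open>simp add: inner_hyperplane_reflection_Basis\<close>)
    finally show ?case .
  qed
  obtain i j where ij: "b = e i" "c = e j" "i \<in> {1..n}" "j \<in> {1..n}"
    using bc(1,2) unfolding bij_betw_imp_surj_on[OF e, symmetric] by blast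
  then have "i < j \<or> j < i" using bc by (metis linorder_neqE_nat)
  then show ?thesis
  proof
    assume "i < j"
    then show ?thesis using less[of i j x] ij x by simp
  next
    assume "j < i"
    then have "hyperplane_reflection (c - b) x \<in> Q" using less[of j i x] ij x by simp
    also have "hyperplane_reflection (c - b) x = hyperplane_reflection (b - c) x"
      by (rule euclidean_eqI) (use bc in \<open>simp add: inner_hyperplane_reflection_Basis\<close>)
    finally show ?thesis .
  qed
qed

text \<open>Conjugation by coordinate exchanges moves the indices of the one simple root
  \<open>e (n - 1) + e n\<close> to any other pair, one at a time.\<close>

lemma closed_under_root_sums:
  assumes root: "\<And>\<alpha> x. \<alpha> \<in> fundamental_roots e n \<Longrightarrow> x \<in> Q \<Longrightarrow> hyperplane_reflection \<alpha> x \<in> Q"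
    and bc: "b \<in> Basis" "c \<in> Basis" "b \<noteq> c" and x: "x \<in> Q"
  shows "hyperplane_reflection (b + c) x \<in> Q"
proof -
  define T where "T = (\<lambda>b c. \<forall>x\<in>Q. hyperplane_reflection (b + c) x \<in> Q)"
  let ?p = "e (n - 1)" and ?q = "e n"
  have pq: "?p \<in> Basis" "?q \<in> Basis" "?p \<noteq> ?q"
    using n2 e_Basis e_eq_iff by auto
  have base: "T ?p ?q"
    unfolding T_def by (auto intro!: root simp: fundamental_roots_def)
  have sym: "T c b" if "T b c" for b c
    using that by (simp add: T_def add.commute)
  have move: "T b d" if "T b c" "b \<in> Basis" "c \<in> Basis" "b \<noteq> c" "d \<in> Basis" "d \<noteq> b" for b c d
  proof (cases "d = c")
    case False
    have "hyperplane_reflection (b + d) x =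
        hyperplane_reflection (c - d) (hyperplane_reflection (b + c) (hyperplane_reflection (c - d) x))" for x
      by (rule euclidean_eqI) (use that(2-6) False in \<open>auto simp: inner_hyperplane_reflection_Basis\<close>)
    moreover have "hyperplane_reflection (c - d) x \<in> Q" if "x \<in> Q" for x
      using closed_under_root_differences[OF root] \<open>c \<in> Basis\<close> \<open>d \<in> Basis\<close> False that by blast
    ultimately show ?thesis
      using that(1) by (simp add: T_def)
  qed (use that in simp)
  have "T b c"
  proof (cases "c = ?p")
    case True
    then show ?thesis using move[OF base pq, of b] bc sym by auto
  next
    case False
    then have "T c ?p" using move[OF base pq, of c] bc sym by auto
    then show ?thesis using move[of c ?p b] False bc pq sym by auto
  qed
  then show ?thesis using x by (simp add: T_def)
qed

lemma corner_vector_in_signed_orbit: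
  assumes k: "k \<in> {1..n}"
  shows "corner_vector e n k \<in> signed_orbit k 1"
proof -
  let ?S = "support_size DIM('a) k"
  let ?A = "e ` {1..?S}" and ?M = "if k = n - 1 then {e n} else {}"
  have S: "?S \<le> n" using k by (simp add: DIM_eq support_size_def)
  have inj: "inj_on e {1..?S}"
    using e S by (auto simp: bij_betw_def intro: inj_on_subset)
  have P: "(?A, ?M) \<in> sign_patterns k"
  proof -
    have "?A \<subseteq> Basis" using S by (auto simp: e_Basis)
    moreover have "?M \<subseteq> ?A" using k n2 by (auto simp: support_size_def DIM_eq)
    moreover have "card ?A = ?S" by (subst card_image[OF inj]) simp
    ultimately show ?thesis using n2 by (simp add: sign_patterns_def DIM_eq)
  qed
  have "signed_vector ?A ?M = (\<Sum>i\<in>{1..?S}. (if e i \<in> ?M then -1 else 1) *\<^sub>R e i)"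
    unfolding signed_vector_def using inj by (simp add: sum.reindex)
  also have "\<dots> = (if k = n - 1 then (\<Sum>i=1..n - 1. e i) - e n else (\<Sum>i=1..?S. e i))"
  proof (cases "k = n - 1")
    case True
    then have "?S = n" by (simp add: support_size_def DIM_eq)
    moreover have "{1..n} = insert n {1..n - 1}" using n2 by auto
    moreover have "(\<Sum>i=1..n - 1. (if e i \<in> {e n} then -1 else 1) *\<^sub>R e i) = (\<Sum>i=1..n - 1. e i)"
      using n2 by (intro sum.cong) (auto simp: e_eq_iff)
    ultimately show ?thesis using True n2 by simp
  qed simp
  finally have "corner_vector e n k = (1 / sqrt ?S) *\<^sub>R signed_vector ?A ?M"
    using k n2 by (auto simp: corner_vector_def support_size_def DIM_eq)
  then show ?thesis
    unfolding signed_orbit_def using P by force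
qed

text \<open>Both sets contain the corner vector. The explicit set is closed under the simple
  reflections, and the group orbit is closed under all root reflections, which act transitively on
  the explicit set.\<close>

lemma corner_orbit_eq_signed_orbit:
  assumes k: "k \<in> {1..n}"
  shows "corner_orbit e n k = signed_orbit k 1"
proof
  have root: "hyperplane_reflection \<alpha> x \<in> signed_orbit k 1"
    if \<alpha>: "\<alpha> \<in> fundamental_roots e n" and x: "x \<in> signed_orbit k 1" for \<alpha> x
  proof -
    consider i where "\<alpha> = e i - e (i + 1)" "1 \<le> i" "i \<le> n - 1" | "\<alpha> = e (n - 1) + e n"
      using \<alpha> unfolding fundamental_roots_def by blast
    then show ?thesis
      using x n2 by cases
        (auto simp: e_Basis e_eq_iff intro!: signed_orbit_reflection_diff signed_orbit_reflection_add)
  qed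
  show "corner_orbit e n k \<subseteq> signed_orbit k 1"
    using D_group_closed[OF _ corner_vector_in_signed_orbit[OF k] root] by (auto simp: corner_orbit_def)
  show "signed_orbit k 1 \<subseteq> corner_orbit e n k"
    by (rule closed_imp_signed_orbit_subset[OF _ _ corner_vector_in_corner_orbit corner_vector_in_signed_orbit[OF k]])
       (use k in \<open>auto simp: DIM_eq intro: closed_under_root_differences closed_under_root_sums corner_orbit_closed\<close>)
qed

lemma scaled_corner_orbit_eq_signed_orbit:
  assumes k: "k \<in> {1..n}"
  shows "scaled_corner_orbit e n r k = signed_orbit k (r k)"
  unfolding scaled_corner_orbit_def corner_orbit_eq_signed_orbit[OF k] signed_orbit_def
  by (auto simp: image_image case_prod_unfold)

end

section \<open>Dimensions of spaces of polynomial functions on spheres\<close>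

text \<open>Exponents are forced to zero outside \<open>B\<close>; otherwise infinitely many
  exponent functions would describe the same monomial.\<close>

definition exponents :: "'b set \<Rightarrow> nat \<Rightarrow> ('b \<Rightarrow> nat) set" where
  "exponents B m = {\<alpha>. (\<forall>b. b \<notin> B \<longrightarrow> \<alpha> b = 0) \<and> sum \<alpha> B = m}"

lemma exponents_insert:
  assumes "finite B" "b \<notin> B"
  shows "exponents (insert b B) m = (\<Union>j\<in>{..m}. (\<lambda>\<alpha>. \<alpha>(b := m - j)) ` exponents B j)"
proof (rule Set.set_eqI, rule iffI)
  fix \<alpha> assume \<alpha>: "\<alpha> \<in> exponents (insert b B) m"
  then have "\<alpha> b + sum \<alpha> B = m" using assms by (simp add: exponents_def)
  moreover have "sum (\<alpha>(b := 0)) B = sum \<alpha> B"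
    using assms(2) by (intro sum.cong) auto
  ultimately have "\<alpha>(b := 0) \<in> exponents B (m - \<alpha> b)" "\<alpha> = (\<alpha>(b := 0))(b := m - (m - \<alpha> b))" "m - \<alpha> b \<le> m"
    using \<alpha> by (auto simp: exponents_def)
  then show "\<alpha> \<in> (\<Union>j\<in>{..m}. (\<lambda>\<alpha>. \<alpha>(b := m - j)) ` exponents B j)" by blast
next
  fix \<alpha> assume "\<alpha> \<in> (\<Union>j\<in>{..m}. (\<lambda>\<alpha>. \<alpha>(b := m - j)) ` exponents B j)"
  then obtain j \<beta> where j: "j \<le> m" "\<beta> \<in> exponents B j" "\<alpha> = \<beta>(b := m - j)" by auto
  have "sum (\<beta>(b := m - j)) B = sum \<beta> B"
    using assms(2) by (intro sum.cong) auto
  then show "\<alpha> \<in> exponents (insert b B) m"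
    using j assms by (auto simp: exponents_def)
qed

text \<open>Splitting by the degree \<open>j\<close> left for \<open>B\<close> gives a hockey-stick
  sum. Truncated subtraction yields the right value for empty \<open>B\<close> too:
  \<open>0 choose 0\<close> if \<open>m = 0\<close>, and zero otherwise.\<close>

lemma finite_exponents_card_exponents:
  assumes "finite B"
  shows "finite (exponents B m) \<and> card (exponents B m) = (card B + m - 1 choose m)"
  using assms
proof (induction B arbitrary: m)
  case empty
  have "exponents ({} :: 'a set) m = (if m = 0 then {\<lambda>_. 0} else {})"
    by (auto simp: exponents_def)
  then show ?case by (cases m) (auto simp: binomial_eq_0)
next
  case (insert b B)
  have inj: "inj_on (\<lambda>\<alpha>. \<alpha>(b := m - j)) (exponents B j)" for j
  proof (rule inj_onI)
    fix \<alpha> \<beta> assume *: "\<alpha> \<in> exponents B j" "\<beta> \<in> exponents B j" "\<alpha>(b := m - j) = \<beta>(b := m - j)"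
    show "\<alpha> = \<beta>"
    proof
      fix d show "\<alpha> d = \<beta> d"
        using *(1,2) insert.hyps(2) fun_cong[OF *(3), of d] by (cases "d = b") (auto simp: exponents_def)
    qed
  qed
  have "card (exponents (insert b B) m) = (\<Sum>j\<in>{..m}. card ((\<lambda>\<alpha>. \<alpha>(b := m - j)) ` exponents B j))"
    unfolding exponents_insert[OF insert.hyps]
  proof (rule card_UN_disjoint)
    have "m - i \<noteq> m - j" if "i \<in> {..m}" "j \<in> {..m}" "i \<noteq> j" for i j
      using that by auto
    then show "\<forall>i\<in>{..m}. \<forall>j\<in>{..m}. i \<noteq> j \<longrightarrow>
        (\<lambda>\<alpha>. \<alpha>(b := m - i)) ` exponents B i \<inter> (\<lambda>\<alpha>. \<alpha>(b := m - j)) ` exponents B j = {}"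
      by (auto dest: fun_cong[of _ _ b])
  qed (use insert.IH in auto)
  also have "\<dots> = (\<Sum>j\<le>m. card B + j - 1 choose j)"
    using insert.IH by (simp add: card_image[OF inj])
  also have "\<dots> = (card B + m choose m)"
  proof (cases "card B")
    case 0
    have "(\<Sum>j\<le>m. (j - 1 choose j)) = (\<Sum>j\<le>m. if j = 0 then 1 else 0)"
      by (intro sum.cong) auto
    then show ?thesis by (simp add: 0)
  next
    case (Suc c)
    then show ?thesis using sum_choose_lower[of c m] by simp
  qed
  finally show ?case
    using insert exponents_insert[OF insert.hyps, of m] by simp
qed

lemmas finite_exponents = finite_exponents_card_exponents[THEN conjunct1]
lemmas card_exponents = finite_exponents_card_exponents[THEN conjunct2]

lemma exponents_disjoint: "l \<noteq> m \<Longrightarrow> exponents B l \<inter> exponents B m = {}"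
  by (auto simp: exponents_def)

section \<open>Linear independence of monomials\<close>

lemma monomial_image_exponents: "{monomial \<alpha> | \<alpha>. sum \<alpha> Basis = m} = monomial ` exponents Basis m"
proof (rule Set.set_eqI, rule iffI)
  fix f :: "'a \<Rightarrow> real" assume "f \<in> {monomial \<alpha> | \<alpha>. sum \<alpha> Basis = m}"
  then obtain \<alpha> where \<alpha>: "f = monomial \<alpha>" "sum \<alpha> Basis = m" by auto
  have "monomial \<alpha> = monomial (\<lambda>b. if b \<in> Basis then \<alpha> b else 0)"
    by (auto simp: monomial_def fun_eq_iff)
  moreover have "(\<lambda>b. if b \<in> Basis then \<alpha> b else 0) \<in> exponents Basis m"
    using \<alpha>(2) by (auto simp: exponents_def)
  ultimately show "f \<in> monomial ` exponents Basis m" using \<alpha>(1) by blast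
qed (auto simp: exponents_def)

text \<open>Induction on the variables: read as a polynomial in \<open>y b\<close>, the sum has
  coefficients that vanish and are sums of the same kind in fewer variables. Within one such
  coefficient the exponent of \<open>b\<close> is fixed, so the separation hypothesis
  survives.\<close>

lemma sum_monomials_eq_0_imp_coefficient_eq_0:
  fixes c :: "('b \<Rightarrow> nat) \<Rightarrow> real"
  assumes "finite B" "finite F"
    and "\<And>\<alpha> \<beta>. \<alpha> \<in> F \<Longrightarrow> \<beta> \<in> F \<Longrightarrow> (\<forall>b\<in>B. \<alpha> b = \<beta> b) \<Longrightarrow> \<alpha> = \<beta>"
    and "\<And>y. (\<Sum>\<alpha>\<in>F. c \<alpha> * (\<Prod>b\<in>B. y b ^ \<alpha> b)) = 0" and "\<gamma> \<in> F"
  shows "c \<gamma> = 0"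
  using assms
proof (induction B arbitrary: F \<gamma>)
  case empty
  then have "F = {\<gamma>}" by (metis (mono_tags) empty_iff insertI1 is_singletonI' is_singleton_def singletonD)
  then show ?case using empty.prems(3) by simp
next
  case (insert b B)
  let ?F = "\<lambda>j. {\<alpha> \<in> F. \<alpha> b = j}"
  have "(\<Sum>\<alpha>\<in>?F (\<gamma> b). c \<alpha> * (\<Prod>d\<in>B. y d ^ \<alpha> d)) = 0" for y
  proof -
    define N where "N = (\<Sum>\<alpha>\<in>F. \<alpha> b)"
    have N: "\<alpha> b \<le> N" if "\<alpha> \<in> F" for \<alpha>
      unfolding N_def using that insert.prems(1) by (intro member_le_sum) auto
    have "(\<Sum>j\<le>N. (\<Sum>\<alpha>\<in>?F j. c \<alpha> * (\<Prod>d\<in>B. y d ^ \<alpha> d)) * t ^ j) = 0" for t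
    proof -
      have "(\<Sum>j\<le>N. (\<Sum>\<alpha>\<in>?F j. c \<alpha> * (\<Prod>d\<in>B. y d ^ \<alpha> d)) * t ^ j)
          = (\<Sum>j\<in>{..N}. \<Sum>\<alpha>\<in>?F j. c \<alpha> * (\<Prod>d\<in>B. y d ^ \<alpha> d) * t ^ \<alpha> b)"
        by (simp add: sum_distrib_right)
      also have "\<dots> = (\<Sum>\<alpha>\<in>F. c \<alpha> * (\<Prod>d\<in>B. y d ^ \<alpha> d) * t ^ \<alpha> b)"
        using insert.prems(1) N by (intro sum.group) auto
      also have "\<dots> = (\<Sum>\<alpha>\<in>F. c \<alpha> * (\<Prod>d\<in>insert b B. (y(b := t)) d ^ \<alpha> d))"
      proof (intro sum.cong refl)
        fix \<alpha>
        have "(\<Prod>d\<in>B. (y(b := t)) d ^ \<alpha> d) = (\<Prod>d\<in>B. y d ^ \<alpha> d)"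
          using insert.hyps by (intro prod.cong) auto
        then show "c \<alpha> * (\<Prod>d\<in>B. y d ^ \<alpha> d) * t ^ \<alpha> b = c \<alpha> * (\<Prod>d\<in>insert b B. (y(b := t)) d ^ \<alpha> d)"
          using insert.hyps by simp
      qed
      finally show ?thesis using insert.prems(3) by simp
    qed
    then have "\<forall>j\<le>N. (\<Sum>\<alpha>\<in>?F j. c \<alpha> * (\<Prod>d\<in>B. y d ^ \<alpha> d)) = 0"
      by (subst polyfun_eq_0[symmetric]) blast
    then show ?thesis using N[OF insert.prems(4)] by blast
  qed
  then show ?case
    using insert.prems(1,2,4) by (intro insert.IH[of "?F (\<gamma> b)"]) auto
qed

lemma sum_monomial_eq_0_imp_coefficient_eq_0:
  fixes c :: "('a::euclidean_space \<Rightarrow> nat) \<Rightarrow> real"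
  assumes "finite F" "F \<subseteq> (\<Union>m. exponents Basis m)"
    and "\<And>x. (\<Sum>\<alpha>\<in>F. c \<alpha> * monomial \<alpha> x) = 0" and "\<gamma> \<in> F"
  shows "c \<gamma> = 0"
proof (rule sum_monomials_eq_0_imp_coefficient_eq_0[OF finite_Basis assms(1) _ _ assms(4)])
  fix \<alpha> \<beta> :: "'a \<Rightarrow> nat" assume "\<alpha> \<in> F" "\<beta> \<in> F" "\<forall>b\<in>Basis. \<alpha> b = \<beta> b"
  moreover from this assms(2) have "\<forall>b. b \<notin> Basis \<longrightarrow> \<alpha> b = 0 \<and> \<beta> b = 0"
    by (force simp: exponents_def)
  ultimately show "\<alpha> = \<beta>" by (metis ext)
next
  fix y :: "'a \<Rightarrow> real"
  have "monomial \<alpha> (\<Sum>b\<in>Basis. y b *\<^sub>R b) = (\<Prod>b\<in>Basis. y b ^ \<alpha> b)" for \<alpha>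
    by (simp add: monomial_def)
  then show "(\<Sum>\<alpha>\<in>F. c \<alpha> * (\<Prod>b\<in>Basis. y b ^ \<alpha> b)) = 0"
    using assms(3)[of "\<Sum>b\<in>Basis. y b *\<^sub>R b"] by simp
qed

lemma sum_fun_apply: "(\<Sum>i\<in>I. f i) x = (\<Sum>i\<in>I. f i (x :: 'b) :: real)"
  by (induction I rule: infinite_finite_induct) auto

lemma dim_independent_family:
  fixes g :: "'i \<Rightarrow> 'b \<Rightarrow> real"
  assumes E: "finite E"
    and ind: "\<And>c \<gamma>. (\<And>x. (\<Sum>\<alpha>\<in>E. c \<alpha> * g \<alpha> x) = 0) \<Longrightarrow> \<gamma> \<in> E \<Longrightarrow> c \<gamma> = 0"
  shows "fun_space.dim (g ` E) = card E"
proof -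
  have inj: "inj_on g E"
  proof (rule inj_onI, rule ccontr)
    fix \<alpha> \<beta> assume *: "\<alpha> \<in> E" "\<beta> \<in> E" "g \<alpha> = g \<beta>" "\<alpha> \<noteq> \<beta>"
    \<comment> \<open>If two indices gave the same function, the difference of their indicators
      would be a nontrivial vanishing combination.\<close>
    let ?c = "\<lambda>\<gamma>. (if \<gamma> = \<alpha> then 1 else 0) - (if \<gamma> = \<beta> then 1 else 0) :: real"
    have "(\<Sum>\<gamma>\<in>E. ?c \<gamma> * g \<gamma> x) = 0" for x
      using * E by (simp add: left_diff_distrib sum_subtractf if_distrib[of "\<lambda>u. u * _"] cong: if_cong)
    then have "?c \<alpha> = 0" using *(1) by (rule ind)
    then show False using *(4) by simp
  qed
  have "fun_space.independent (g ` E)"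
    unfolding fun_space.independent_explicit_module
  proof (intro allI impI)
    fix t :: "('b \<Rightarrow> real) set" and u v
    assume t: "finite t" "t \<subseteq> g ` E" "(\<Sum>v\<in>t. (\<lambda>x. u v * v x)) = 0" "v \<in> t"
    define c where "c = (\<lambda>\<alpha>. if g \<alpha> \<in> t then u (g \<alpha>) else 0)"
    have "(\<Sum>\<alpha>\<in>E. c \<alpha> * g \<alpha> x) = 0" for x
    proof -
      have "(\<Sum>\<alpha>\<in>E. c \<alpha> * g \<alpha> x) = (\<Sum>w\<in>g ` E. (if w \<in> t then u w else 0) * w x)"
        by (simp add: sum.reindex[OF inj] c_def)
      also have "\<dots> = (\<Sum>w\<in>t. u w * w x)"
        using t(2) E by (intro sum.mono_neutral_cong_right) auto
      also have "\<dots> = (\<Sum>v\<in>t. (\<lambda>x. u v * v x)) x"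
        by (simp add: sum_fun_apply)
      finally show ?thesis using t(3) by simp
    qed
    moreover obtain \<gamma> where "\<gamma> \<in> E" "v = g \<gamma>" using t by auto
    ultimately show "u v = 0" using ind[of c \<gamma>] t(4) by (simp add: c_def)
  qed
  then show ?thesis
    using card_image[OF inj] fun_space.dim_eq_card_independent by metis
qed

lemma restrict_zero_image_span:
  "restrict_zero S ` fun_space.span X = fun_space.span (restrict_zero S ` X)"
proof -
  interpret module_hom "\<lambda>(c::real) (f::'a \<Rightarrow> real) x. c * f x" "\<lambda>(c::real) (f::'a \<Rightarrow> real) x. c * f x"
    "restrict_zero S"
    by unfold_locales (auto simp: restrict_zero_def fun_eq_iff algebra_simps)
  show ?thesis by (rule span_image[symmetric])
qed

lemma poly_space_eq_span:
  "(poly_space l :: ('a::euclidean_space \<Rightarrow> real) set) =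
    fun_space.span (monomial ` (\<Union>m\<in>{..l}. exponents Basis m))"
proof -
  have "{monomial \<alpha> | \<alpha> :: 'a \<Rightarrow> nat. sum \<alpha> Basis \<le> l} = (\<Union>m\<in>{..l}. {monomial \<alpha> | \<alpha>. sum \<alpha> Basis = m})"
    by auto
  then show ?thesis
    unfolding poly_space_def monomial_image_exponents image_UN by simp
qed

lemma parity_poly_space_eq_span:
  "(parity_poly_space l :: ('a::euclidean_space \<Rightarrow> real) set) =
    fun_space.span (monomial ` (\<Union>i\<in>{..l div 2}. exponents Basis (l - 2 * i)))"
proof -
  define X where "X = (\<lambda>i. monomial ` exponents Basis (l - 2 * i) :: ('a \<Rightarrow> real) set)"
  have "fun_space.span (\<Union>i\<in>{..l div 2}. fun_space.span (X i)) = fun_space.span (\<Union>i\<in>{..l div 2}. X i)"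
  proof (rule subset_antisym)
    have "fun_space.span (X i) \<subseteq> fun_space.span (\<Union>i\<in>{..l div 2}. X i)" if "i \<in> {..l div 2}" for i
      using that by (intro fun_space.span_mono UN_upper)
    then show "fun_space.span (\<Union>i\<in>{..l div 2}. fun_space.span (X i)) \<subseteq> fun_space.span (\<Union>i\<in>{..l div 2}. X i)"
      by (rule fun_space.span_minimal[OF UN_least fun_space.subspace_span])
    show "fun_space.span (\<Union>i\<in>{..l div 2}. X i) \<subseteq> fun_space.span (\<Union>i\<in>{..l div 2}. fun_space.span (X i))"
      by (intro fun_space.span_mono UN_mono subset_refl fun_space.span_superset)
  qed
  then show ?thesis
    unfolding parity_poly_space_def Hom_def monomial_image_exponents image_UN atLeast0AtMost X_def .
qed

lemma card_exponents_Basis: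
  "card (exponents (Basis :: 'a::euclidean_space set) m) = (DIM('a) + m - 1 choose m)"
  by (rule card_exponents[OF finite_Basis])

section \<open>Dimension bounds for arbitrary supports\<close>

lemma dim_restrict_zero_span_le:
  assumes "finite E"
  shows "fun_space.dim (restrict_zero S ` fun_space.span (monomial ` E)) \<le> card E"
proof -
  have "fun_space.dim (restrict_zero S ` fun_space.span (monomial ` E)) \<le> card (restrict_zero S ` monomial ` E)"
    unfolding restrict_zero_image_span using assms by (intro fun_space.dim_le_card) auto
  also have "\<dots> \<le> card E"
    using assms by (metis card_image_le finite_imageI le_trans)
  finally show ?thesis .
qed

text \<open>Restriction can only lose dimension, so the count of monomials bounds the dimension on
  every union of spheres.\<close>

lemma dim_poly_on_le: "dim_poly_on l (S :: 'a::euclidean_space set) \<le> (DIM('a) + l choose l)"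
proof -
  have "dim_poly_on l S \<le> card (\<Union>m\<in>{..l}. exponents (Basis :: 'a set) m)"
    unfolding dim_poly_on_def poly_space_eq_span
    by (intro dim_restrict_zero_span_le) (auto simp: finite_exponents)
  also have "\<dots> \<le> (\<Sum>m\<le>l. card (exponents (Basis :: 'a set) m))"
    by (rule card_UN_le) simp
  also have "\<dots> = (\<Sum>m\<le>l. (DIM('a) - 1 + m) choose m)"
    unfolding card_exponents_Basis by (intro sum.cong arg_cong2[where f=binomial]) auto
  also have "\<dots> = (DIM('a) + l choose l)"
    unfolding sum_choose_lower using DIM_positive[where 'a='a]
    by (intro arg_cong2[where f=binomial]) linarith+
  finally show ?thesis .
qed

lemma dim_parity_poly_on_le:
  "dim_parity_poly_on l (S :: 'a::euclidean_space set) \<le>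
    (\<Sum>i\<le>l div 2. DIM('a) + (l - 2 * i) - 1 choose (l - 2 * i))"
proof -
  have "dim_parity_poly_on l S \<le> card (\<Union>i\<in>{..l div 2}. exponents (Basis :: 'a set) (l - 2 * i))"
    unfolding dim_parity_poly_on_def parity_poly_space_eq_span
    by (intro dim_restrict_zero_span_le) (auto simp: finite_exponents)
  also have "\<dots> \<le> (\<Sum>i\<le>l div 2. card (exponents (Basis :: 'a set) (l - 2 * i)))"
    by (rule card_UN_le) simp
  finally show ?thesis unfolding card_exponents_Basis .
qed

lemma monomial_scaleR: "monomial \<alpha> (t *\<^sub>R x) = t ^ sum \<alpha> Basis * monomial \<alpha> x"
  by (simp add: monomial_def power_mult_distrib prod.distrib power_sum)

text \<open>The hypothesis \<open>zero\<close> says that a polynomial in the span vanishing on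
  \<open>S\<close> vanishes everywhere, that is, restriction loses no dimension.\<close>

lemma dim_restrict_zero_span_eq:
  fixes S :: "'a::euclidean_space set"
  assumes E: "finite E" "E \<subseteq> (\<Union>m. exponents Basis m)"
    and zero: "\<And>c x. (\<And>y. y \<in> S \<Longrightarrow> (\<Sum>\<alpha>\<in>E. c \<alpha> * monomial \<alpha> y) = 0) \<Longrightarrow> (\<Sum>\<alpha>\<in>E. c \<alpha> * monomial \<alpha> x) = 0"
  shows "fun_space.dim (restrict_zero S ` fun_space.span (monomial ` E)) = card E"
proof -
  have "fun_space.dim ((\<lambda>\<alpha>. restrict_zero S (monomial \<alpha>)) ` E) = card E"
  proof (rule dim_independent_family[OF E(1)])
    fix c \<gamma> assume *: "\<And>x. (\<Sum>\<alpha>\<in>E. c \<alpha> * restrict_zero S (monomial \<alpha>) x) = 0" and "\<gamma> \<in> E"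
    have "(\<Sum>\<alpha>\<in>E. c \<alpha> * monomial \<alpha> y) = 0" if "y \<in> S" for y
      using *[of y] that by (simp add: restrict_zero_def)
    then have "(\<Sum>\<alpha>\<in>E. c \<alpha> * monomial \<alpha> x) = 0" for x by (rule zero)
    then show "c \<gamma> = 0"
      by (rule sum_monomial_eq_0_imp_coefficient_eq_0[OF E _ \<open>\<gamma> \<in> E\<close>])
  qed
  then show ?thesis
    unfolding restrict_zero_image_span by (simp add: image_image)
qed

lemma homogeneous_sum_scaleR:
  "(\<Sum>\<alpha>\<in>exponents Basis m. c \<alpha> * monomial \<alpha> (t *\<^sub>R x)) = t ^ m * (\<Sum>\<alpha>\<in>exponents Basis m. c \<alpha> * monomial \<alpha> x)"
  unfolding sum_distrib_left by (intro sum.cong) (auto simp: monomial_scaleR exponents_def)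

text \<open>On a sphere the squared norm is constant, so this lifts a monomial to higher degree of
  the same parity without changing its restriction, up to a factor.\<close>

lemma monomial_mult_norm_power_in_Hom:
  "(\<lambda>x. monomial \<alpha> x * ((norm x)\<^sup>2) ^ i) \<in> Hom (sum \<alpha> Basis + 2 * i)"
proof (induction i arbitrary: \<alpha>)
  case (Suc i)
  have shift: "monomial (\<alpha>(b := \<alpha> b + 2)) x = monomial \<alpha> x * (x \<bullet> b)\<^sup>2" if "b \<in> Basis" for b x
  proof -
    have "(\<Prod>d\<in>Basis - {b}. (x \<bullet> d) ^ (\<alpha>(b := \<alpha> b + 2)) d) = (\<Prod>d\<in>Basis - {b}. (x \<bullet> d) ^ \<alpha> d)"
      by (intro prod.cong) auto
    then show ?thesis
      using that by (simp add: monomial_def prod.remove[of _ b] power_add mult_ac power2_eq_square)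
  qed
  have sum: "sum (\<alpha>(b := \<alpha> b + 2)) Basis = sum \<alpha> Basis + 2" if "b \<in> Basis" for b
  proof -
    have "sum (\<alpha>(b := \<alpha> b + 2)) (Basis - {b}) = sum \<alpha> (Basis - {b})"
      by (intro sum.cong) auto
    then show ?thesis
      using that by (simp add: sum.remove[of _ b])
  qed
  have "(\<Sum>b\<in>Basis. (\<lambda>x. monomial (\<alpha>(b := \<alpha> b + 2)) x * ((norm x)\<^sup>2) ^ i)) \<in> Hom (sum \<alpha> Basis + 2 * Suc i)"
    unfolding Hom_def
  proof (rule fun_space.span_sum)
    fix b :: 'a assume "b \<in> Basis"
    have deg: "sum \<alpha> Basis + 2 * Suc i = sum (\<alpha>(b := \<alpha> b + 2)) Basis + 2 * i"
      unfolding sum[OF \<open>b \<in> Basis\<close>] by simp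
    show "(\<lambda>x. monomial (\<alpha>(b := \<alpha> b + 2)) x * ((norm x)\<^sup>2) ^ i)
        \<in> fun_space.span {monomial \<beta> | \<beta>. sum \<beta> Basis = sum \<alpha> Basis + 2 * Suc i}"
      unfolding deg by (rule Suc.IH[unfolded Hom_def])
  qed
  also have "(\<Sum>b\<in>Basis. (\<lambda>x. monomial (\<alpha>(b := \<alpha> b + 2)) x * ((norm x)\<^sup>2) ^ i)) =
      (\<lambda>x. monomial \<alpha> x * ((norm x)\<^sup>2) ^ Suc i)"
  proof
    fix x :: 'a
    have "(\<Sum>b\<in>Basis. monomial (\<alpha>(b := \<alpha> b + 2)) x * ((norm x)\<^sup>2) ^ i) =
        (\<Sum>b\<in>Basis. monomial \<alpha> x * (x \<bullet> b)\<^sup>2 * ((norm x)\<^sup>2) ^ i)"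
      by (intro sum.cong refl) (simp only: shift)
    also have "\<dots> = monomial \<alpha> x * (norm x)\<^sup>2 * ((norm x)\<^sup>2) ^ i"
      by (simp only: norm_square_eq_sum_Basis sum_distrib_left sum_distrib_right)
    finally show "(\<Sum>b\<in>Basis. (\<lambda>x. monomial (\<alpha>(b := \<alpha> b + 2)) x * ((norm x)\<^sup>2) ^ i)) x =
        monomial \<alpha> x * ((norm x)\<^sup>2) ^ Suc i"
      by (simp add: sum_fun_apply mult.assoc)
  qed
  finally show ?case .
qed (simp add: monomial_in_Hom)

text \<open>On one sphere the lower homogeneous parts are absorbed into the top degree, and a
  homogeneous polynomial is determined by its values on the sphere.\<close>

lemma dim_parity_poly_on_sphere:
  assumes "\<rho> > 0"
  shows "dim_parity_poly_on l (sphere (0::'a::euclidean_space) \<rho>) = (DIM('a) + l - 1 choose l)"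
proof -
  let ?S = "sphere (0::'a) \<rho>"
  have "restrict_zero ?S ` monomial ` exponents Basis (l - 2 * i) \<subseteq> restrict_zero ?S ` Hom l" if "i \<le> l div 2" for i
  proof clarify
    fix \<alpha> :: "'a \<Rightarrow> nat" assume \<alpha>: "\<alpha> \<in> exponents Basis (l - 2 * i)"
    have "(\<lambda>x. (1 / \<rho> ^ (2 * i)) * (monomial \<alpha> x * ((norm x)\<^sup>2) ^ i)) \<in> Hom l"
      using monomial_mult_norm_power_in_Hom[of \<alpha> i] \<alpha> that
      by (simp only: Hom_def) (intro fun_space.span_scale, auto simp: exponents_def)
    moreover have "restrict_zero ?S (monomial \<alpha>) =
        restrict_zero ?S (\<lambda>x. (1 / \<rho> ^ (2 * i)) * (monomial \<alpha> x * ((norm x)\<^sup>2) ^ i))"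
      using assms by (auto simp: restrict_zero_def fun_eq_iff power_mult)
    ultimately show "restrict_zero ?S (monomial \<alpha>) \<in> restrict_zero ?S ` Hom l" by blast
  qed
  then have "restrict_zero ?S ` monomial ` (\<Union>i\<in>{..l div 2}. exponents Basis (l - 2 * i)) \<subseteq> restrict_zero ?S ` Hom l"
    by blast
  then have "restrict_zero ?S ` parity_poly_space l \<subseteq> restrict_zero ?S ` Hom l"
    unfolding parity_poly_space_eq_span restrict_zero_image_span Hom_def
    by (intro fun_space.span_minimal fun_space.subspace_span) auto
  moreover have "Hom l \<subseteq> parity_poly_space l"
    unfolding parity_poly_space_def by (intro order.trans[OF _ fun_space.span_superset]) force
  ultimately have "restrict_zero ?S ` parity_poly_space l = restrict_zero ?S ` Hom l"
    by blast
  then have "dim_parity_poly_on l ?S = fun_space.dim (restrict_zero ?S ` fun_space.span (monomial ` exponents Basis l))"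
    by (simp add: dim_parity_poly_on_def Hom_def monomial_image_exponents)
  also have "\<dots> = card (exponents (Basis::'a set) l)"
  proof (rule dim_restrict_zero_span_eq)
    fix c :: "('a \<Rightarrow> nat) \<Rightarrow> real" and x :: 'a
    let ?f = "\<lambda>y. \<Sum>\<alpha>\<in>exponents Basis l. c \<alpha> * monomial \<alpha> y"
    assume *: "\<And>y. y \<in> ?S \<Longrightarrow> ?f y = 0"
    obtain z :: 'a where z: "norm z = \<rho>" using assms by (metis less_imp_le vector_choose_size)
    show "?f x = 0"
    proof (cases "x = 0")
      case False
      have "?f ((\<rho> / norm x) *\<^sub>R x) = 0"
        using False assms by (intro *) simp
      then show ?thesis
        unfolding homogeneous_sum_scaleR using False assms by simp
    next
      case True
      \<comment> \<open>For \<open>l = 0\<close> the factor \<open>0 ^ l\<close> is 1, so the value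
        at the origin must come from a point of the sphere.\<close>
      have "?f (0 *\<^sub>R z) = 0" unfolding homogeneous_sum_scaleR using *[of z] z by simp
      then show ?thesis using True by simp
    qed
  qed (auto simp: finite_exponents)
  finally show ?thesis by (simp add: card_exponents_Basis)
qed

text \<open>For \<open>l\<close> equal to 2 or 3 there are just two homogeneous parts
  \<open>f\<close> and \<open>g\<close>. On each ray the two radii give
  \<open>t^2 * f + g = 0\<close> for two different \<open>t^2\<close>, so both parts vanish and no
  dimension is lost.\<close>

lemma dim_parity_poly_on_two_spheres:
  fixes S :: "'a::euclidean_space set"
  assumes "\<rho> > 0" "\<sigma> > 0" "\<rho> \<noteq> \<sigma>" "sphere 0 \<rho> \<subseteq> S" "sphere 0 \<sigma> \<subseteq> S" and l: "l = 2 \<or> l = 3"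
  shows "dim_parity_poly_on l S = (DIM('a) + l - 1 choose l) + (DIM('a) + (l - 2) - 1 choose (l - 2))"
proof -
  let ?E = "exponents (Basis::'a set) l \<union> exponents Basis (l - 2)"
  have E: "(\<Union>i\<in>{..l div 2}. exponents (Basis::'a set) (l - 2 * i)) = ?E"
  proof -
    have "l div 2 = Suc 0" using l by auto
    then show ?thesis by (auto simp: atMost_Suc)
  qed
  have disj: "exponents (Basis::'a set) l \<inter> exponents Basis (l - 2) = {}"
    using l by (intro exponents_disjoint) auto
  have split: "(\<Sum>\<alpha>\<in>?E. c \<alpha> * monomial \<alpha> x) =
      (\<Sum>\<alpha>\<in>exponents Basis l. c \<alpha> * monomial \<alpha> x) + (\<Sum>\<alpha>\<in>exponents Basis (l - 2). c \<alpha> * monomial \<alpha> x)" for c x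
    using disj by (intro sum.union_disjoint) (auto simp: finite_exponents)
  have "dim_parity_poly_on l S = fun_space.dim (restrict_zero S ` fun_space.span (monomial ` ?E))"
    unfolding dim_parity_poly_on_def parity_poly_space_eq_span E ..
  also have "\<dots> = card ?E"
  proof (rule dim_restrict_zero_span_eq)
    fix c :: "('a \<Rightarrow> nat) \<Rightarrow> real" and x :: 'a
    let ?f = "\<lambda>y. \<Sum>\<alpha>\<in>exponents Basis l. c \<alpha> * monomial \<alpha> y"
    let ?g = "\<lambda>y. \<Sum>\<alpha>\<in>exponents Basis (l - 2). c \<alpha> * monomial \<alpha> y"
    assume *: "\<And>y. y \<in> S \<Longrightarrow> (\<Sum>\<alpha>\<in>?E. c \<alpha> * monomial \<alpha> y) = 0"
    have unit: "?f u = 0 \<and> ?g u = 0" if u: "norm u = 1" for u :: 'a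
    proof -
      have eq: "t ^ (l - 2) * (t\<^sup>2 * ?f u + ?g u) = 0" if "t = \<rho> \<or> t = \<sigma>" for t
      proof -
        have "t *\<^sub>R u \<in> S" using that assms(1,2,4,5) u by auto
        then have "?f (t *\<^sub>R u) + ?g (t *\<^sub>R u) = 0" using * by (simp add: split)
        then have "t ^ l * ?f u + t ^ (l - 2) * ?g u = 0" by (simp only: homogeneous_sum_scaleR)
        moreover have "t ^ l = t ^ (l - 2) * t\<^sup>2" using l by (auto simp: power3_eq_cube power2_eq_square)
        ultimately show ?thesis by (simp add: algebra_simps)
      qed
      have "\<rho>\<^sup>2 * ?f u + ?g u = 0" "\<sigma>\<^sup>2 * ?f u + ?g u = 0"
        using eq[of \<rho>] eq[of \<sigma>] assms(1,2) by auto
      then have "(\<rho>\<^sup>2 - \<sigma>\<^sup>2) * ?f u = 0" unfolding left_diff_distrib by linarith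
      moreover have "\<rho>\<^sup>2 \<noteq> \<sigma>\<^sup>2" using assms(1-3) by (simp add: power2_eq_iff)
      ultimately have "?f u = 0" by simp
      then show ?thesis using \<open>\<rho>\<^sup>2 * ?f u + ?g u = 0\<close> by simp
    qed
    obtain z :: 'a where z: "norm z = 1" by (metis vector_choose_size zero_le_one)
    have "?f x = 0 \<and> ?g x = 0"
    proof (cases "x = 0")
      case False
      have "?f (norm x *\<^sub>R sgn x) = 0" "?g (norm x *\<^sub>R sgn x) = 0"
        unfolding homogeneous_sum_scaleR using unit[of "sgn x"] False by (simp_all add: norm_sgn)
      then show ?thesis by (simp add: sgn_div_norm False)
    next
      case True
      have "?f (0 *\<^sub>R z) = 0" "?g (0 *\<^sub>R z) = 0"
        unfolding homogeneous_sum_scaleR using unit[OF z] by simp_all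
      then show ?thesis using True by simp
    qed
    then show "(\<Sum>\<alpha>\<in>?E. c \<alpha> * monomial \<alpha> x) = 0" by (simp add: split)
  qed (auto simp: finite_exponents)
  also have "\<dots> = (DIM('a) + l - 1 choose l) + (DIM('a) + (l - 2) - 1 choose (l - 2))"
    using disj by (subst card_Un_disjoint) (auto simp: finite_exponents card_exponents_Basis)
  finally show ?thesis .
qed

section \<open>Orbit sums of monomials\<close>

lemma real_choose_2: "real (n choose 2) = real n * (real n - 1) / 2"
  by (induction n) (auto simp: numeral_2_eq_2 field_simps)

lemma real_choose_3: "real (n choose 3) = real n * (real n - 1) * (real n - 2) / 6"
proof (induction n)
  case (Suc n)
  have "Suc n choose 3 = (n choose 2) + (n choose 3)"
    by (simp add: numeral_3_eq_3 numeral_2_eq_2)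
  then show ?case using Suc by (simp add: real_choose_2 field_simps)
qed simp

context
  fixes k :: nat and s :: real and N S n q :: real
  assumes k: "1 \<le> k" "k \<le> DIM('a::euclidean_space)" and s: "s > 0" and dim: "DIM('a) \<ge> 3"
  defines "N \<equiv> orbit_size DIM('a) k" and "S \<equiv> support_size DIM('a) k" and "n \<equiv> DIM('a)"
    and "q \<equiv> s / sqrt (support_size DIM('a) k)"
begin

private lemma S_pos: "S > 0"
  using support_size_pos[OF k] by (simp add: S_def)

private lemma q_power: "q\<^sup>2 = s\<^sup>2 / S" "q ^ 4 = s ^ 4 / S\<^sup>2" "q ^ 6 = s ^ 6 / S ^ 3"
proof -
  show q: "q\<^sup>2 = s\<^sup>2 / S" using S_pos by (simp add: power_divide q_def S_def)
  have "q ^ 4 = (q\<^sup>2)\<^sup>2" "q ^ 6 = (q\<^sup>2) ^ 3" by (simp_all flip: power_mult)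
  then show "q ^ 4 = s ^ 4 / S\<^sup>2" "q ^ 6 = s ^ 6 / S ^ 3"
    unfolding q power_divide by (simp_all flip: power_mult)
qed

private lemma signed_vector_power:
  assumes "(A, M) \<in> sign_patterns k" "b \<in> (Basis :: 'a set)" "even i" "i > 0"
  shows "(signed_vector A M \<bullet> b) ^ i = (if b \<in> A then 1 else 0)"
  using assms by (simp add: inner_signed_vector[OF sign_patternsD(1)] zero_power)

private lemma orbit_sum:
  fixes f :: "'a \<Rightarrow> real"
  assumes "B \<subseteq> Basis"
    and "\<And>A M. (A, M) \<in> sign_patterns k \<Longrightarrow> f (q *\<^sub>R signed_vector A M) = (if B \<subseteq> A then v else 0)"
  shows "(\<Sum>x\<in>signed_orbit k s. f x) = v * N * (support_size DIM('a) k choose card B) / (DIM('a) choose card B)"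
  unfolding N_def using k s assms by (intro sum_signed_orbit) (simp_all add: q_def)

lemma orbit_sum_1: "(\<Sum>x\<in>(signed_orbit k s :: 'a set). 1) = N"
  using orbit_sum[of "{}" "\<lambda>_. 1" 1] by simp

context
  fixes b c d :: 'a
  assumes b: "b \<in> Basis" and c: "c \<in> Basis" and d: "d \<in> Basis" and bcd: "b \<noteq> c" "b \<noteq> d" "c \<noteq> d"
begin

private lemma one: "(\<Sum>x\<in>signed_orbit k s. (x \<bullet> b) ^ i) = q ^ i * N * S / n" if "even i" "i > 0"
proof -
  have "(\<Sum>x\<in>signed_orbit k s. (x \<bullet> b) ^ i) =
      q ^ i * N * (support_size DIM('a) k choose card {b}) / (DIM('a) choose card {b})"
    by (rule orbit_sum) (use b that in \<open>simp_all add: power_mult_distrib signed_vector_power\<close>)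
  then show ?thesis by (simp add: S_def n_def)
qed

private lemma two: "(\<Sum>x\<in>signed_orbit k s. (x \<bullet> b) ^ i * (x \<bullet> c) ^ j) = q ^ (i + j) * N * (S * (S - 1)) / (n * (n - 1))"
  if "even i" "i > 0" "even j" "j > 0"
proof -
  have "(\<Sum>x\<in>signed_orbit k s. (x \<bullet> b) ^ i * (x \<bullet> c) ^ j) =
      q ^ (i + j) * N * (support_size DIM('a) k choose card {b, c}) / (DIM('a) choose card {b, c})"
    by (rule orbit_sum) (use b c that in \<open>simp_all add: power_mult_distrib signed_vector_power power_add\<close>)
  moreover have "card {b, c} = 2" using bcd by simp
  ultimately show ?thesis by (simp add: real_choose_2 S_def n_def)
qed

private lemma three: "(\<Sum>x\<in>signed_orbit k s. (x \<bullet> b) ^ i * (x \<bullet> c) ^ j * (x \<bullet> d) ^ l) =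
    q ^ (i + j + l) * N * (S * (S - 1) * (S - 2)) / (n * (n - 1) * (n - 2))"
  if "even i" "i > 0" "even j" "j > 0" "even l" "l > 0"
proof -
  have "(\<Sum>x\<in>signed_orbit k s. (x \<bullet> b) ^ i * (x \<bullet> c) ^ j * (x \<bullet> d) ^ l) =
      q ^ (i + j + l) * N * (support_size DIM('a) k choose card {b, c, d}) / (DIM('a) choose card {b, c, d})"
    by (rule orbit_sum) (use b c d that in \<open>simp_all add: power_mult_distrib signed_vector_power power_add\<close>)
  moreover have "card {b, c, d} = 3" using bcd by simp
  ultimately show ?thesis by (simp add: real_choose_3 S_def n_def)
qed

text \<open>Nonzero coordinates have absolute value \<open>q\<close> with
  \<open>q^2 = s^2 / S\<close>. The quotients of falling factorials of \<open>S\<close> and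
  \<open>n\<close> are the proportions of supports containing the given one, two or three
  coordinates.\<close>

lemma orbit_sum_2: "(\<Sum>x\<in>signed_orbit k s. (x \<bullet> b)\<^sup>2) = s\<^sup>2 * N / n"
  and orbit_sum_4: "(\<Sum>x\<in>signed_orbit k s. (x \<bullet> b) ^ 4) = s ^ 4 * N / (S * n)"
  and orbit_sum_6: "(\<Sum>x\<in>signed_orbit k s. (x \<bullet> b) ^ 6) = s ^ 6 * N / (S\<^sup>2 * n)"
  and orbit_sum_22: "(\<Sum>x\<in>signed_orbit k s. (x \<bullet> b)\<^sup>2 * (x \<bullet> c)\<^sup>2) = s ^ 4 * N * (S - 1) / (S * (n * (n - 1)))"
  and orbit_sum_42: "(\<Sum>x\<in>signed_orbit k s. (x \<bullet> b) ^ 4 * (x \<bullet> c)\<^sup>2) = s ^ 6 * N * (S - 1) / (S\<^sup>2 * (n * (n - 1)))"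
  and orbit_sum_222: "(\<Sum>x\<in>signed_orbit k s. (x \<bullet> b)\<^sup>2 * (x \<bullet> c)\<^sup>2 * (x \<bullet> d)\<^sup>2) =
    s ^ 6 * N * ((S - 1) * (S - 2)) / (S\<^sup>2 * (n * (n - 1) * (n - 2)))"
  using S_pos by (simp_all add: one two three q_power) (simp_all add: power2_eq_square power3_eq_cube mult.assoc)

end

end

section \<open>Cancellation in orbit sums of monomials with odd exponents\<close>

lemma monomial_flip:
  fixes x y :: "'a::euclidean_space"
  assumes "D \<subseteq> Basis" "\<And>d. d \<in> Basis \<Longrightarrow> y \<bullet> d = (if d \<in> D then - (x \<bullet> d) else x \<bullet> d)"
  shows "monomial \<alpha> y = (-1) ^ sum \<alpha> D * monomial \<alpha> x"
proof -
  have "monomial \<alpha> y = (\<Prod>d\<in>Basis. (if d \<in> D then (-1) ^ \<alpha> d else 1) * (x \<bullet> d) ^ \<alpha> d)"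
    unfolding monomial_def using assms(2) by (intro prod.cong) (auto simp: power_minus[of "x \<bullet> _"])
  also have "\<dots> = (\<Prod>d\<in>D. (-1) ^ \<alpha> d) * monomial \<alpha> x"
    using assms(1) by (simp add: prod.distrib monomial_def prod.If_cases Int_absorb1)
  finally show ?thesis by (simp add: power_sum)
qed

lemma sum_signed_orbit_reindex:
  assumes "1 \<le> k" "k \<le> DIM('a::euclidean_space)" "s > 0"
  shows "(\<Sum>x\<in>signed_orbit k s. f (x::'a)) =
    (\<Sum>p\<in>sign_patterns k. f ((s / sqrt (support_size DIM('a) k)) *\<^sub>R signed_vector (fst p) (snd p)))"
proof -
  have c: "s / sqrt (support_size DIM('a) k) \<noteq> 0"
    using assms support_size_pos[of k "DIM('a)"] by simp
  show ?thesis
    unfolding signed_orbit_def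
    by (subst sum.reindex[OF inj_on_signed_vector[OF c]]) (simp add: case_prod_unfold)
qed

lemma toggle_commute: "toggle b (toggle c M) = toggle c (toggle b M)"
  by (rule Set.set_eqI) (simp add: mem_toggle)

lemma double_toggle_involution: "double_toggle A b c (double_toggle A b c M) = M"
  by (simp add: double_toggle_def toggle_commute[of b c])

text \<open>Changing the signs at \<open>b\<close> and \<open>c\<close> together preserves every
  orbit, also the half-spin ones, and negates the monomial because only one of the two exponents is
  odd.\<close>

lemma orbit_sum_monomial_odd_even:
  fixes b c :: "'a::euclidean_space"
  assumes k: "1 \<le> k" "k \<le> DIM('a)" "s > 0"
    and "b \<in> Basis" "c \<in> Basis" "odd (\<alpha> b)" "even (\<alpha> c)"
  shows "(\<Sum>x\<in>signed_orbit k s. monomial \<alpha> (x::'a)) = 0"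
proof -
  have bc: "b \<noteq> c" using assms by auto
  let ?v = "\<lambda>p. (s / sqrt (support_size DIM('a) k)) *\<^sub>R (signed_vector (fst p) (snd p) :: 'a)"
  define T :: "'a set \<times> 'a set \<Rightarrow> 'a set \<times> 'a set" where "T = (\<lambda>p. (fst p, double_toggle (fst p) b c (snd p)))"
  have TT: "T (T p) = p" for p
    by (simp add: T_def double_toggle_involution)
  have T: "T p \<in> sign_patterns k" if "p \<in> sign_patterns k" for p
    using sign_patterns_double_toggle[of "fst p" "snd p" k b c] that assms by (simp add: T_def)
  have flip: "monomial \<alpha> (?v (T p)) = - monomial \<alpha> (?v p)" if "p \<in> sign_patterns k" for p
  proof -
    have "fst p \<subseteq> Basis" using sign_patternsD(1)[of "fst p" "snd p"] that by simp
    then have "monomial \<alpha> (?v (T p)) = (-1) ^ sum \<alpha> {b, c} * monomial \<alpha> (?v p)"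
      using assms bc by (intro monomial_flip) (auto simp: T_def inner_signed_vector_double_toggle)
    then show ?thesis using assms bc by simp
  qed
  have "(\<Sum>p\<in>sign_patterns k. monomial \<alpha> (?v p)) = (\<Sum>p\<in>sign_patterns k. - monomial \<alpha> (?v p))"
    by (rule sum.reindex_bij_witness[of _ T T]) (simp_all add: TT T flip)
  then show ?thesis
    unfolding sum_signed_orbit_reindex[OF k] by (simp add: sum_negf)
qed

text \<open>One sign change permutes an orbit of smaller support, where \<open>k = l\<close> and the
  sum vanishes, but exchanges the two half-spin orbits, where it only relates their sums.\<close>

lemma sum_monomial_single_toggle:
  fixes b :: "'a::euclidean_space"
  assumes b: "b \<in> Basis" "odd (\<alpha> b)"
    and T: "\<And>A M. (A, M) \<in> sign_patterns k \<Longrightarrow> (A, if b \<in> A then toggle b M else M) \<in> sign_patterns l"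
      "\<And>A M. (A, M) \<in> sign_patterns l \<Longrightarrow> (A, if b \<in> A then toggle b M else M) \<in> sign_patterns k"
    and kl: "1 \<le> k" "k \<le> DIM('a)" "1 \<le> l" "l \<le> DIM('a)" "s > 0" "support_size DIM('a) k = support_size DIM('a) l"
  shows "(\<Sum>x\<in>signed_orbit k s. monomial \<alpha> (x::'a)) = - (\<Sum>x\<in>signed_orbit l s. monomial \<alpha> x)"
proof -
  let ?v = "\<lambda>p. (s / sqrt (support_size DIM('a) l)) *\<^sub>R (signed_vector (fst p) (snd p) :: 'a)"
  define T' :: "'a set \<times> 'a set \<Rightarrow> 'a set \<times> 'a set" where
    "T' = (\<lambda>p. (fst p, if b \<in> fst p then toggle b (snd p) else snd p))"
  have TT: "T' (T' p) = p" for p by (cases p) (simp add: T'_def)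
  have flip: "monomial \<alpha> (?v (T' p)) = - monomial \<alpha> (?v p)" if "p \<in> sign_patterns k" for p
  proof -
    have "fst p \<subseteq> Basis" using sign_patternsD(1)[of "fst p" "snd p"] that by simp
    then have "monomial \<alpha> (?v (T' p)) = (-1) ^ sum \<alpha> {b} * monomial \<alpha> (?v p)"
      using b by (intro monomial_flip) (simp_all only: T'_def fst_conv snd_conv inner_scaleR_left inner_signed_vector_toggle, auto)
    then show ?thesis using b by simp
  qed
  have "(\<Sum>p\<in>sign_patterns k. monomial \<alpha> (?v p)) = (\<Sum>p\<in>sign_patterns l. - monomial \<alpha> (?v p))"
    by (rule sum.reindex_bij_witness[of _ T' T']) (auto simp: TT flip, auto simp: T'_def dest: T)
  then show ?thesis
    using kl by (simp add: sum_signed_orbit_reindex sum_negf)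
qed

lemma orbit_sum_monomial_odd:
  fixes b :: "'a::euclidean_space"
  assumes "b \<in> Basis" "odd (\<alpha> b)" and k: "1 \<le> k" "k < DIM('a) - 1" and "s > 0"
  shows "(\<Sum>x\<in>signed_orbit k s. monomial \<alpha> (x::'a)) = 0"
proof -
  have "(A, if b \<in> A then toggle b M else M) \<in> sign_patterns k" if "(A, M) \<in> sign_patterns k" for A M
    using that k by (auto simp: sign_patterns_def toggle_def)
  note toggle = this
  have "(\<Sum>x\<in>signed_orbit k s. monomial \<alpha> (x::'a)) = - (\<Sum>x\<in>signed_orbit k s. monomial \<alpha> x)"
    by (rule sum_monomial_single_toggle[where b=b and \<alpha>=\<alpha>, OF assms(1,2)]) (erule toggle | use k \<open>s > 0\<close> in simp)+
  then show ?thesis by simp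
qed

lemma orbit_sum_monomial_half_spin:
  fixes b :: "'a::euclidean_space"
  assumes "b \<in> Basis" "odd (\<alpha> b)" "s > 0" and dim: "DIM('a) \<ge> 2"
  shows "(\<Sum>x\<in>signed_orbit (DIM('a) - 1) s. monomial \<alpha> (x::'a)) = - (\<Sum>x\<in>signed_orbit DIM('a) s. monomial \<alpha> x)"
proof -
  have ne: "DIM('a) \<noteq> DIM('a) - 1" using dim by linarith
  have A: "A = Basis" if "(A, M) \<in> sign_patterns k" "k \<ge> DIM('a) - 1" for A M :: "'a set" and k
    using that by (intro card_subset_eq) (auto simp: sign_patterns_def support_size_def)
  have "(A, if b \<in> A then toggle b M else M) \<in> sign_patterns DIM('a)"
    if P: "(A, M) \<in> sign_patterns (DIM('a) - 1)" for A M
    using P A[OF P] sign_patternsD(2,5)[OF P] ne assms(1) even_card_toggle[of M b]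
    by (auto simp: sign_patterns_def support_size_def mem_toggle split: if_splits)
  moreover have "(A, if b \<in> A then toggle b M else M) \<in> sign_patterns (DIM('a) - 1)"
    if P: "(A, M) \<in> sign_patterns DIM('a)" for A M
    using P A[OF P] sign_patternsD(2,5)[OF P] ne assms(1) even_card_toggle[of M b]
    by (auto simp: sign_patterns_def support_size_def mem_toggle split: if_splits)
  ultimately show ?thesis
    using assms by (intro sum_monomial_single_toggle[of b]) (auto simp: support_size_def)
qed

section \<open>Unions of weighted orbits\<close>

locale weighted_orbit_union =
  fixes J :: "nat set" and r w :: "nat \<Rightarrow> real" and W :: "'a::euclidean_space \<Rightarrow> real"
  assumes J: "J \<subseteq> {1..DIM('a)}" and dim: "DIM('a) \<ge> 4"
    and r_pos: "k \<in> J \<Longrightarrow> r k > 0" and w_pos: "k \<in> J \<Longrightarrow> w k > 0"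
    and W: "k \<in> J \<Longrightarrow> x \<in> signed_orbit k (r k) \<Longrightarrow> W x = w k"
begin

definition X :: "'a set" where "X = (\<Union>k\<in>J. signed_orbit k (r k))"

definition n :: real where "n = DIM('a)"

definition S :: "nat \<Rightarrow> real" where "S k = support_size DIM('a) k"

definition u :: "nat \<Rightarrow> real" where "u k = w k * orbit_size DIM('a) k"

text \<open>The defects of the monomials with even exponents of degree four and six are linear
  combinations of the following sums.\<close>

definition m4 :: real where "m4 = (\<Sum>k\<in>J. u k * r k ^ 4 * (n + 2 - 3 * S k) / S k)"
definition m6 :: real where "m6 = (\<Sum>k\<in>J. u k * r k ^ 6 * (n + 4 - 5 * S k) / (S k)\<^sup>2)"
definition m6' :: real where "m6' = (\<Sum>k\<in>J. u k * r k ^ 6 * ((S k - 1) * (n + 4 - 3 * S k)) / (S k)\<^sup>2)"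

lemma n4: "n \<ge> 4" using dim by (simp add: n_def)

lemma J_D: "k \<in> J \<Longrightarrow> 1 \<le> k" "k \<in> J \<Longrightarrow> k \<le> DIM('a)"
  using J by auto

lemma S_pos: "k \<in> J \<Longrightarrow> S k > 0"
  using support_size_pos J_D by (simp add: S_def)

lemma finite_J: "finite J" using J by (rule finite_subset) simp

lemma finite_X: "finite X"
  by (simp add: X_def finite_J finite_signed_orbit)

lemma sum_X: "(\<Sum>x\<in>X. f x) = (\<Sum>k\<in>J. \<Sum>x\<in>signed_orbit k (r k). f x)"
proof -
  have "signed_orbit i (r i) \<inter> signed_orbit j (r j) = ({} :: 'a set)" if "i \<in> J" "j \<in> J" "i \<noteq> j" for i j
    using that J_D r_pos by (intro signed_orbit_disjoint) auto
  then show ?thesis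
    unfolding X_def by (intro sum.UNION_disjoint finite_J) (auto simp: finite_signed_orbit)
qed

lemma card_X: "card X = (\<Sum>k\<in>J. orbit_size DIM('a) k)"
proof -
  have "card X = (\<Sum>k\<in>J. card (signed_orbit k (r k) :: 'a set))"
    unfolding card_eq_sum by (rule sum_X)
  also have "\<dots> = (\<Sum>k\<in>J. orbit_size DIM('a) k)"
    using J_D r_pos by (intro sum.cong refl card_signed_orbit) (auto dest: r_pos)
  finally show ?thesis .
qed

lemma W_pos: "x \<in> X \<Longrightarrow> W x > 0"
  using W w_pos by (auto simp: X_def)

lemma norm_orbit:
  fixes x :: 'a
  assumes "k \<in> J" "x \<in> signed_orbit k (r k)"
  shows "norm x = r k"
  using assms J_D r_pos by (intro norm_signed_orbit[of k "r k" x]) (auto simp: less_imp_le)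

lemma orbit_size_pos: "k \<in> J \<Longrightarrow> orbit_size DIM('a) k > 0"
  using J_D[of k] by (auto simp: orbit_size_def)

lemma norm_X: "norm ` X = r ` J"
proof -
  have "norm ` (signed_orbit k (r k) :: 'a set) = {r k}" if "k \<in> J" for k
  proof -
    have "card (signed_orbit k (r k) :: 'a set) \<noteq> 0"
      using card_signed_orbit[of k "r k", where 'a='a] J_D[OF that] r_pos[OF that] orbit_size_pos[OF that] by simp
    then have "signed_orbit k (r k) \<noteq> ({} :: 'a set)" by auto
    then show ?thesis using norm_orbit[OF that] by force
  qed
  then show ?thesis by (simp add: X_def image_UN) blast
qed

lemma defect_X:
  "defect X W f = (\<Sum>k\<in>J. w k * (orbit_size DIM('a) k * sphere_mean (r k) f - (\<Sum>x\<in>signed_orbit k (r k). f x)))"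
proof -
  have "(\<Sum>x\<in>signed_orbit k (r k). W x * (sphere_mean (norm x) f - f x)) =
      w k * (orbit_size DIM('a) k * sphere_mean (r k) f - (\<Sum>x\<in>signed_orbit k (r k). f x))" if k: "k \<in> J" for k
  proof -
    have "(\<Sum>x\<in>signed_orbit k (r k). W x * (sphere_mean (norm x) f - f x)) =
        (\<Sum>x\<in>signed_orbit k (r k). w k * (sphere_mean (r k) f - f x))"
      using k by (intro sum.cong) (simp_all add: W norm_orbit)
    then show ?thesis
      using card_signed_orbit[of k "r k", where 'a='a] J_D[OF k] r_pos[OF k]
      by (simp add: sum_distrib_left[symmetric] sum_subtractf)
  qed
  then show ?thesis unfolding defect_def sum_X by simp
qed

section \<open>Defects of even monomials\<close>

context
  fixes b c d :: 'a
  assumes b: "b \<in> Basis" and c: "c \<in> Basis" and d: "d \<in> Basis" and bcd: "b \<noteq> c" "b \<noteq> d" "c \<noteq> d"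
begin

private lemmas orbit_sums = orbit_sum_2[OF _ _ _ _ b c d bcd] orbit_sum_4[OF _ _ _ _ b c d bcd]
  orbit_sum_6[OF _ _ _ _ b c d bcd] orbit_sum_22[OF _ _ _ _ b c d bcd] orbit_sum_42[OF _ _ _ _ b c d bcd]
  orbit_sum_222[OF _ _ _ _ b c d bcd]

private lemmas sphere_means = sphere_mean_degree_2[OF _ b] sphere_mean_degree_4[OF _ b c bcd(1)]
  sphere_mean_degree_6[OF _ b c d bcd]

lemma defect_2: "defect X W (\<lambda>x. (x \<bullet> b)\<^sup>2) = 0"
  unfolding defect_X using J_D r_pos dim
  by (intro sum.neutral) (auto simp: orbit_sums sphere_means less_imp_le)

private lemmas m_simps = orbit_sums sphere_means less_imp_le u_def S_def n_def

text \<open>One sum suffices for both: multiplying the square of a coordinate by the squared norm,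
  constant on each orbit, gives defect zero, so the first defect plus \<open>n - 1\<close> times the
  second vanishes.\<close>

lemma defect_4: "defect X W (\<lambda>x. (x \<bullet> b) ^ 4) = - m4 / (n * (n + 2))"
  and defect_22: "defect X W (\<lambda>x. (x \<bullet> b)\<^sup>2 * (x \<bullet> c)\<^sup>2) = m4 / (n * (n - 1) * (n + 2))"
proof -
  have "w * (N * (3 * r ^ 4 / (n * (n + 2))) - r ^ 4 * N / (s * n)) =
      - (w * N * r ^ 4 * (n + 2 - 3 * s) / s) / (n * (n + 2))"
    "w * (N * (r ^ 4 / (n * (n + 2))) - r ^ 4 * N * (s - 1) / (s * (n * (n - 1)))) =
      (w * N * r ^ 4 * (n + 2 - 3 * s) / s) / (n * (n - 1) * (n + 2))"
    if "s > 0" "n \<ge> 4" for N s n w r :: real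
    using that by (simp add: divide_simps, algebra)+
  note eq = this[of "S k" n "w k" "orbit_size DIM('a) k" "r k" for k, OF S_pos n4]
  show "defect X W (\<lambda>x. (x \<bullet> b) ^ 4) = - m4 / (n * (n + 2))"
    unfolding defect_X m4_def sum_divide_distrib sum_negf[symmetric]
  proof (intro sum.cong refl, goal_cases)
    case (1 k)
    show ?case
      using eq(1)[OF 1] 1 J_D[OF 1] r_pos[OF 1] dim by (simp only: m_simps, simp?)
  qed
  show "defect X W (\<lambda>x. (x \<bullet> b)\<^sup>2 * (x \<bullet> c)\<^sup>2) = m4 / (n * (n - 1) * (n + 2))"
    unfolding defect_X m4_def sum_divide_distrib
  proof (intro sum.cong refl, goal_cases)
    case (1 k)
    show ?case
      using eq(2)[OF 1] 1 J_D[OF 1] r_pos[OF 1] dim by (simp only: m_simps, simp?)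
  qed
qed

text \<open>On each orbit the squared norm is constant and the degree-four defects satisfy one
  relation. This gives one linear relation among the three contributions of degree six, so two sums
  describe them all.\<close>

lemma defect_6: "defect X W (\<lambda>x. (x \<bullet> b) ^ 6) = - ((n + 7) * m6 + 5 * m6') / (n * (n + 2) * (n + 4))"
  and defect_42: "defect X W (\<lambda>x. (x \<bullet> b) ^ 4 * (x \<bullet> c)\<^sup>2) =
    (3 * m6 - (n - 1) * m6') / (n * (n - 1) * (n + 2) * (n + 4))"
  and defect_222: "defect X W (\<lambda>x. (x \<bullet> b)\<^sup>2 * (x \<bullet> c)\<^sup>2 * (x \<bullet> d)\<^sup>2) =
    ((n - 2) * m6 + (3 * n + 2) * m6') / (n * (n - 1) * (n - 2) * (n + 2) * (n + 4))"
proof -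
  have "w * (N * (15 * r ^ 6 / (n * (n + 2) * (n + 4))) - r ^ 6 * N / (s\<^sup>2 * n)) =
      - ((n + 7) * (w * N * r ^ 6 * (n + 4 - 5 * s) / s\<^sup>2) +
         5 * (w * N * r ^ 6 * ((s - 1) * (n + 4 - 3 * s)) / s\<^sup>2)) / (n * (n + 2) * (n + 4))"
    "w * (N * (3 * r ^ 6 / (n * (n + 2) * (n + 4))) - r ^ 6 * N * (s - 1) / (s\<^sup>2 * (n * (n - 1)))) =
      (3 * (w * N * r ^ 6 * (n + 4 - 5 * s) / s\<^sup>2) -
         (n - 1) * (w * N * r ^ 6 * ((s - 1) * (n + 4 - 3 * s)) / s\<^sup>2)) / (n * (n - 1) * (n + 2) * (n + 4))"
    "w * (N * (r ^ 6 / (n * (n + 2) * (n + 4))) - r ^ 6 * N * ((s - 1) * (s - 2)) / (s\<^sup>2 * (n * (n - 1) * (n - 2)))) =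
      ((n - 2) * (w * N * r ^ 6 * (n + 4 - 5 * s) / s\<^sup>2) +
         (3 * n + 2) * (w * N * r ^ 6 * ((s - 1) * (n + 4 - 3 * s)) / s\<^sup>2)) /
         (n * (n - 1) * (n - 2) * (n + 2) * (n + 4))"
    if "s > 0" "n \<ge> 4" for N s n w r :: real
    using that by (simp add: divide_simps, algebra)+
  note eq = this[of "S k" n "w k" "orbit_size DIM('a) k" "r k" for k, OF S_pos n4]
  show "defect X W (\<lambda>x. (x \<bullet> b) ^ 6) = - ((n + 7) * m6 + 5 * m6') / (n * (n + 2) * (n + 4))"
    unfolding defect_X m6_def m6'_def sum_distrib_left sum.distrib[symmetric] sum_divide_distrib sum_negf[symmetric]
  proof (intro sum.cong refl, goal_cases)
    case (1 k)
    show ?case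
      using eq(1)[OF 1] 1 J_D[OF 1] r_pos[OF 1] dim by (simp only: m_simps, simp?)
  qed
  show "defect X W (\<lambda>x. (x \<bullet> b) ^ 4 * (x \<bullet> c)\<^sup>2) =
      (3 * m6 - (n - 1) * m6') / (n * (n - 1) * (n + 2) * (n + 4))"
    unfolding defect_X m6_def m6'_def sum_distrib_left sum_subtractf[symmetric] sum_divide_distrib
  proof (intro sum.cong refl, goal_cases)
    case (1 k)
    show ?case
      using eq(2)[OF 1] 1 J_D[OF 1] r_pos[OF 1] dim by (simp only: m_simps, simp?)
  qed
  show "defect X W (\<lambda>x. (x \<bullet> b)\<^sup>2 * (x \<bullet> c)\<^sup>2 * (x \<bullet> d)\<^sup>2) =
      ((n - 2) * m6 + (3 * n + 2) * m6') / (n * (n - 1) * (n - 2) * (n + 2) * (n + 4))"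
    unfolding defect_X m6_def m6'_def sum_distrib_left sum.distrib[symmetric] sum_divide_distrib
  proof (intro sum.cong refl, goal_cases)
    case (1 k)
    show ?case
      using eq(3)[OF 1] 1 J_D[OF 1] r_pos[OF 1] dim by (simp only: m_simps, simp?)
  qed
qed

end

lemma defect_1: "defect X W (\<lambda>x. 1) = 0"
  unfolding defect_X using J_D r_pos dim
  by (intro sum.neutral) (auto simp: orbit_sum_1[simplified] sphere_mean_const less_imp_le)

lemma obtain_Basis:
  fixes b :: 'a
  assumes "b \<in> Basis" "c \<in> Basis" "b \<noteq> c"
  obtains d where "d \<in> Basis" "b \<noteq> d" "c \<noteq> d"
proof -
  have "\<not> Basis \<subseteq> {b, c}"
    using card_mono[of "{b, c}" Basis] dim card_insert_le_m1[of 2 "{c}" b] by force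
  then show ?thesis using that by blast
qed

lemma obtain_Basis_3:
  assumes "b \<in> (Basis :: 'a set)"
  obtains c d where "c \<in> Basis" "d \<in> Basis" "b \<noteq> c" "b \<noteq> d" "c \<noteq> d"
proof -
  have "\<not> Basis \<subseteq> {b}" using card_mono[of "{b}" Basis] dim by force
  then obtain c where c: "c \<in> Basis" "b \<noteq> c" by blast
  show ?thesis by (rule obtain_Basis[OF assms c]) (rule that[OF c(1) _ c(2)])
qed

lemma obtain_distinct_Basis:
  obtains b c d :: 'a where "b \<in> Basis" "c \<in> Basis" "d \<in> Basis" "b \<noteq> c" "b \<noteq> d" "c \<noteq> d"
proof -
  obtain b :: 'a where b: "b \<in> Basis" using nonempty_Basis by blast
  show ?thesis by (rule obtain_Basis_3[OF b]) (rule that[OF b])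
qed

lemma design_defect:
  assumes "euclidean_design t X W" "f \<in> poly_space l" "l \<le> t"
  shows "defect X W f = 0"
proof -
  have "f \<in> poly_space t" using assms(2) poly_space_mono[OF assms(3)] by (rule subsetD[rotated])
  then show ?thesis using assms(1) unfolding euclidean_design_iff_defect by blast
qed

lemma design_imp_m4:
  assumes "euclidean_design t X W" "t \<ge> 4"
  shows "m4 = 0"
proof -
  obtain b c d :: 'a where B: "b \<in> Basis" "c \<in> Basis" "d \<in> Basis" "b \<noteq> c" "b \<noteq> d" "c \<noteq> d"
    by (rule obtain_distinct_Basis)
  have "defect X W (\<lambda>x. (x \<bullet> b) ^ 4) = 0"
    by (rule design_defect[OF assms(1) poly_space_coordinate_power[OF B(1)] assms(2)])
  then show ?thesis using n4 by (simp add: defect_4[OF B])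
qed

lemma design_imp_m6:
  assumes "euclidean_design t X W" "t \<ge> 6"
  shows "m6 = 0" "m6' = 0"
proof -
  obtain b c d :: 'a where B: "b \<in> Basis" "c \<in> Basis" "d \<in> Basis" "b \<noteq> c" "b \<noteq> d" "c \<noteq> d"
    by (rule obtain_distinct_Basis)
  have "defect X W (\<lambda>x. (x \<bullet> b) ^ 6) = 0"
    by (rule design_defect[OF assms(1) poly_space_coordinate_power[OF B(1)] assms(2)])
  moreover have "defect X W (\<lambda>x. (x \<bullet> b) ^ 4 * (x \<bullet> c)\<^sup>2) = 0"
    using assms(2)
    by (intro design_defect[OF assms(1) poly_space_mult[OF poly_space_coordinate_power[OF B(1)]
          poly_space_coordinate_power[OF B(2)]]]) simp
  ultimately have eq: "(n + 7) * m6 + 5 * m6' = 0" "3 * m6 = (n - 1) * m6'"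
    using n4 by (simp_all add: defect_6[OF B] defect_42[OF B])
  \<comment> \<open>Elimination of \<open>m6\<close>; the bracket is the determinant of the system
    up to sign, and it is positive.\<close>
  have "((n + 7) * (n - 1) + 15) * m6' = 3 * ((n + 7) * m6 + 5 * m6')"
    using eq(2) by algebra
  then have "((n + 7) * (n - 1) + 15) * m6' = 0" unfolding eq(1) by simp
  moreover have "(n + 7) * (n - 1) + 15 > 0"
    using n4 by (intro add_nonneg_pos mult_nonneg_nonneg) auto
  ultimately show "m6' = 0" by simp
  then show "m6 = 0" using eq(2) by simp
qed

lemma design_imp_strength_le_7:
  assumes "euclidean_design t X W" "J \<noteq> {}"
  shows "t \<le> 7"
proof (rule ccontr)
  assume "\<not> t \<le> 7"
  then have t: "8 \<le> t" by simp
  obtain b c d :: 'a where B: "b \<in> Basis" "c \<in> Basis" "d \<in> Basis" "b \<noteq> c" "b \<noteq> d" "c \<noteq> d"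
    by (rule obtain_distinct_Basis)
  let ?f = "\<lambda>x::'a. (x \<bullet> b)\<^sup>2 * (x \<bullet> c)\<^sup>2 * ((x \<bullet> b)\<^sup>2 - (x \<bullet> c)\<^sup>2)\<^sup>2"
  note sq = poly_space_coordinate_power[OF B(1), of 2] poly_space_coordinate_power[OF B(2), of 2]
  have "?f \<in> poly_space (2 + 2 + 2 * 2)"
    by (rule poly_space_mult[OF poly_space_mult[OF sq] poly_space_power[OF poly_space_diff[OF sq]]])
  then have "defect X W ?f = 0"
    by (rule design_defect[OF assms(1)]) (use t in simp)
  moreover have "defect X W ?f > 0"
    unfolding defect_def
  proof (rule sum_pos)
    show "finite X" by (rule finite_X)
    show "X \<noteq> {}" using norm_X assms(2) by auto
    fix x assume x: "x \<in> X"
    then obtain k where k: "k \<in> J" "x \<in> signed_orbit k (r k)" by (auto simp: X_def)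
    then obtain A M where P: "(A, M) \<in> sign_patterns k"
      and xA: "x = (r k / sqrt (support_size DIM('a) k)) *\<^sub>R signed_vector A M"
      by (auto simp: signed_orbit_def)
    have coord: "(signed_vector A M \<bullet> d)\<^sup>2 = (if d \<in> A then 1 else 0)" if "d \<in> Basis" for d
      using inner_signed_vector[OF sign_patternsD(1)[OF P] that, of M] by simp
    have f0: "?f x = 0"
      unfolding xA inner_scaleR_left power_mult_distrib coord[OF B(1)] coord[OF B(2)] by simp
    moreover have "sphere_mean (norm x) ?f > 0"
      using r_pos[OF k(1)] B by (intro sphere_mean_degree_8_pos) (simp_all add: norm_orbit[OF k])
    ultimately show "0 < W x * (sphere_mean (norm x) ?f - ?f x)"
      unfolding f0 using W_pos[OF x] by simp
  qed
  ultimately show False by simp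
qed

text \<open>For \<open>t \<ge> n\<close> the product of all coordinates distinguishes the two half-spin orbits.\<close>

lemma design_imp_half_spin:
  assumes "euclidean_design t X W" "DIM('a) + 2 * i \<le> t"
  defines "N \<equiv> DIM('a)"
  shows "(if N \<in> J then w N * r N ^ (N + 2 * i) else 0) = (if N - 1 \<in> J then w (N - 1) * r (N - 1) ^ (N + 2 * i) else 0)"
proof -
  \<comment> \<open>The power of the norm leaves the signs alone and raises the exponent of the
    radius, so different \<open>i\<close> give independent relations between weights and
    radii.\<close>
  let ?f = "\<lambda>x::'a. monomial (\<lambda>_. 1) x * ((norm x)\<^sup>2) ^ i"
  \<comment> \<open>A half-spin orbit has \<open>2 ^ (N - 1)\<close> points, and there the product
    of the coordinates is \<open>(r k / sqrt N) ^ N\<close> up to sign; \<open>K\<close> collects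
    the constants.\<close>
  define K where "K = 2 ^ (N - 1) / sqrt N ^ N"
  have "K \<noteq> 0" using dim by (simp add: K_def N_def)
  have "monomial (\<lambda>_. 1) \<in> (poly_space N :: ('a \<Rightarrow> real) set)"
    by (rule monomial_in_poly_space) (simp add: N_def)
  then have "?f \<in> poly_space (N + i * 2)"
    by (rule poly_space_mult[OF _ poly_space_power[OF poly_space_norm_square]])
  then have "defect X W ?f = 0"
    by (rule design_defect[OF assms(1)]) (use assms(2) in \<open>simp add: N_def\<close>)
  moreover have "defect X W ?f = (\<Sum>k\<in>J. (if k = N - 1 then K * (w k * r k ^ (N + 2 * i)) else 0) -
      (if k = N then K * (w k * r k ^ (N + 2 * i)) else 0))"
    unfolding defect_X
  proof (intro sum.cong refl)
    fix k assume k: "k \<in> J"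
    \<comment> \<open>Sign of the product of coordinates, constant on each half-spin orbit by
      parity; on smaller supports the product is zero.\<close>
    let ?e = "if k = N then 1 else if k = N - 1 then -1 else 0 :: real"
    have "sphere_mean (r k) ?f = sphere_mean (r k) (\<lambda>x::'a. ((r k)\<^sup>2) ^ i * monomial (\<lambda>_. 1) x)"
      using r_pos[OF k] by (intro sphere_mean_cong) auto
    also have "\<dots> = ((r k)\<^sup>2) ^ i * sphere_mean (r k) (monomial (\<lambda>_. 1) :: 'a \<Rightarrow> real)"
      using r_pos[OF k] by (intro sphere_mean_cmult) simp
    also have "sphere_mean (r k) (monomial (\<lambda>_. 1) :: 'a \<Rightarrow> real) = 0"
    proof -
      obtain b :: 'a where "b \<in> Basis" using nonempty_Basis by blast
      then show ?thesis using r_pos[OF k] dim by (intro sphere_mean_monomial_odd[of _ b]) simp_all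
    qed
    finally have mean: "sphere_mean (r k) ?f = 0" by simp
    have v: "?f ((r k / sqrt (support_size N k)) *\<^sub>R signed_vector A M) =
        (if Basis \<subseteq> A then ((r k)\<^sup>2) ^ i * ((r k / sqrt N) ^ N * ?e) else 0)"
      if P: "(A, M) \<in> sign_patterns k" for A M :: "'a set"
    proof (cases "Basis \<subseteq> A")
      case True
      then have A: "A = Basis" using sign_patternsD(1)[OF P] by blast
      then have S: "support_size N k = N" using sign_patternsD(3)[OF P] by (simp add: N_def)
      have "N \<noteq> N - 1" using dim by (simp add: N_def)
      moreover have "k = N \<or> k = N - 1"
        using S J_D(2)[OF k] unfolding support_size_def N_def by (cases "k \<ge> DIM('a) - 1") auto
      ultimately have "(-1) ^ card M = ?e"
        using P by (auto simp: sign_patterns_def N_def)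
      then have mv: "monomial (\<lambda>_. 1) (signed_vector Basis M) = ?e"
        unfolding monomial_def power_one_right using prod_signed_vector[of M] sign_patternsD(2)[OF P] A by simp
      have "monomial (\<lambda>_. 1) ((r k / sqrt N) *\<^sub>R signed_vector Basis M) = (r k / sqrt N) ^ N * ?e"
        unfolding monomial_scaleR mv by (simp add: N_def)
      moreover have "norm ((r k / sqrt N) *\<^sub>R signed_vector Basis M) = r k"
      proof (rule norm_orbit[OF k])
        show "(r k / sqrt N) *\<^sub>R signed_vector Basis M \<in> signed_orbit k (r k)"
          unfolding signed_orbit_def N_def[symmetric] S
          by (rule image_eqI[where x="(Basis, M)"]) (use P A in simp_all)
      qed
      ultimately show ?thesis using True A S by (simp add: mult.commute)
    next
      case False
      then obtain b where "b \<in> Basis" "b \<notin> A" by blast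
      then have "signed_vector A M \<bullet> b = 0" "b \<in> Basis"
        using inner_signed_vector[OF sign_patternsD(1)[OF P], of b M] by simp_all
      then have "monomial (\<lambda>_. 1) (signed_vector A M) = 0"
        unfolding monomial_def by (intro prod_zero) auto
      then show ?thesis using False by (simp add: monomial_scaleR)
    qed
    define c where "c = orbit_size N k * (support_size N k choose N) / (N choose N)"
    have sum: "(\<Sum>x\<in>signed_orbit k (r k). ?f x) = ((r k)\<^sup>2) ^ i * ((r k / sqrt N) ^ N * ?e) * c"
      using sum_signed_orbit[OF J_D[OF k] _ subset_refl, of "r k" ?f] v r_pos[OF k]
      by (simp add: N_def c_def)
    have c: "c = 2 ^ (N - 1)" if "k = N \<or> k = N - 1"
      using that by (auto simp: c_def orbit_size_def support_size_def)
    have pow: "((r k)\<^sup>2) ^ i * (r k / sqrt N) ^ N = r k ^ (N + 2 * i) / sqrt N ^ N"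
      by (simp add: power_divide power_add power_mult)
    have "(\<Sum>x\<in>signed_orbit k (r k). ?f x) = r k ^ (N + 2 * i) / sqrt N ^ N * c * ?e"
      unfolding sum pow[symmetric] by (simp only: mult_ac)
    also have "\<dots> = K * r k ^ (N + 2 * i) * ?e"
      using c by (simp add: K_def)
    finally have "w k * (orbit_size DIM('a) k * sphere_mean (r k) ?f - (\<Sum>x\<in>signed_orbit k (r k). ?f x)) =
        - (K * (w k * r k ^ (N + 2 * i)) * ?e)"
      unfolding mean by simp
    moreover have "N \<noteq> N - 1" using dim by (simp add: N_def)
    ultimately show "w k * (orbit_size DIM('a) k * sphere_mean (r k) ?f - (\<Sum>x\<in>signed_orbit k (r k). ?f x)) =
        (if k = N - 1 then K * (w k * r k ^ (N + 2 * i)) else 0) -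
        (if k = N then K * (w k * r k ^ (N + 2 * i)) else 0)"
      by (cases "k = N"; cases "k = N - 1") (simp_all only: if_True if_False, simp_all)
  qed
  ultimately have "(if N - 1 \<in> J then K * (w (N - 1) * r (N - 1) ^ (N + 2 * i)) else 0) =
      (if N \<in> J then K * (w N * r N ^ (N + 2 * i)) else 0)"
    using finite_J by (simp add: sum_subtractf del: One_nat_def split del: if_split)
  then show ?thesis
    using \<open>K \<noteq> 0\<close> by (cases "N \<in> J"; cases "N - 1 \<in> J") simp_all
qed

text \<open>If some exponent is even, every orbit sum vanishes. Otherwise all exponents are odd, the
  degree is at least the dimension, and the two half-spin orbits cancel each other when radii and
  weights agree.\<close>

lemma defect_odd_monomial:
  assumes b: "b \<in> Basis" "odd (\<alpha> b)"
    and "sum \<alpha> Basis < DIM('a) \<or>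
      DIM('a) \<in> J \<and> DIM('a) - 1 \<in> J \<and> r (DIM('a) - 1) = r DIM('a) \<and> w (DIM('a) - 1) = w DIM('a)"
  shows "defect X W (monomial \<alpha>) = 0"
proof -
  let ?s = "\<lambda>k. \<Sum>x\<in>signed_orbit k (r k). monomial \<alpha> (x::'a)"
  have "sphere_mean (r k) (monomial \<alpha> :: 'a \<Rightarrow> real) = 0" if "k \<in> J" for k
    using b dim r_pos[OF that] by (intro sphere_mean_monomial_odd[of _ b]) auto
  then have "defect X W (monomial \<alpha>) = - (\<Sum>k\<in>J. w k * ?s k)"
    unfolding defect_X sum_negf[symmetric] by (intro sum.cong) auto
  also have "(\<Sum>k\<in>J. w k * ?s k) = 0"
  proof (cases "\<exists>c\<in>Basis. even (\<alpha> c)")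
    case True
    then obtain c where c: "c \<in> Basis" "even (\<alpha> c)" by blast
    have "?s k = 0" if "k \<in> J" for k
      using b c J_D[OF that] r_pos[OF that] by (intro orbit_sum_monomial_odd_even[of _ _ b c]) auto
    then show ?thesis by (intro sum.neutral) auto
  next
    case False
    have "DIM('a) \<le> sum \<alpha> Basis"
    proof -
      have "(\<Sum>c\<in>(Basis::'a set). 1) \<le> sum \<alpha> Basis"
        using False by (intro sum_mono) (simp add: Suc_le_eq odd_pos)
      then show ?thesis by simp
    qed
    with assms(3) have spin: "DIM('a) \<in> J" "DIM('a) - 1 \<in> J"
      "r (DIM('a) - 1) = r DIM('a)" "w (DIM('a) - 1) = w DIM('a)" by auto
    have "?s k = 0" if "k \<in> J" "k \<noteq> DIM('a)" "k \<noteq> DIM('a) - 1" for k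
      using b that J_D[OF that(1)] r_pos[OF that(1)] by (intro orbit_sum_monomial_odd[of b]) auto
    then have "(\<Sum>k\<in>J. w k * ?s k) = (\<Sum>k\<in>{DIM('a), DIM('a) - 1}. w k * ?s k)"
      using spin finite_J by (intro sum.mono_neutral_right) auto
    also have "\<dots> = w DIM('a) * ?s DIM('a) + w (DIM('a) - 1) * ?s (DIM('a) - 1)"
      using dim by (subst sum.insert) auto
    also have "\<dots> = 0"
      using orbit_sum_monomial_half_spin[of b \<alpha> "r DIM('a)"] b dim r_pos[OF spin(1)] spin(3,4) by simp
    finally show ?thesis .
  qed
  finally show ?thesis by simp
qed

text \<open>Applied up to three times, it reduces an even monomial of degree at most six to a
  product of squared coordinates.\<close>

lemma peel_even_monomial:
  assumes "\<And>b. b \<in> Basis \<Longrightarrow> even (\<alpha> b)" "sum \<alpha> (Basis :: 'a set) \<noteq> 0"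
  obtains b \<beta> where "b \<in> Basis" "\<And>c. c \<in> Basis \<Longrightarrow> even (\<beta> c)" "sum \<beta> Basis + 2 = sum \<alpha> Basis"
    "monomial \<alpha> = (\<lambda>x::'a. (x \<bullet> b)\<^sup>2 * monomial \<beta> x)"
proof -
  obtain b where b: "b \<in> Basis" "\<alpha> b \<noteq> 0" using assms(2) by (metis sum.neutral)
  then have ge: "\<alpha> b = (\<alpha> b - 2) + 2" using assms(1)[of b] by (auto elim!: evenE)
  let ?\<beta> = "\<alpha>(b := \<alpha> b - 2)"
  have "sum ?\<beta> (Basis - {b}) = sum \<alpha> (Basis - {b})" by (intro sum.cong) auto
  then have sum: "sum ?\<beta> Basis + 2 = sum \<alpha> Basis"
    using b ge by (simp add: sum.remove[of _ b])
  have "monomial \<alpha> x = (x \<bullet> b)\<^sup>2 * monomial ?\<beta> x" for x :: 'a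
  proof -
    have "(\<Prod>d\<in>Basis - {b}. (x \<bullet> d) ^ ?\<beta> d) = (\<Prod>d\<in>Basis - {b}. (x \<bullet> d) ^ \<alpha> d)"
      by (intro prod.cong) auto
    moreover have "(x \<bullet> b) ^ \<alpha> b = (x \<bullet> b)\<^sup>2 * (x \<bullet> b) ^ (\<alpha> b - 2)"
      using ge by (metis add.commute power_add)
    ultimately show ?thesis using b by (simp add: monomial_def prod.remove[of _ b])
  qed
  moreover have "even (?\<beta> c)" if "c \<in> Basis" for c using assms(1) that b(1) by auto
  ultimately show ?thesis using b(1) sum by (intro that[of b ?\<beta>]) (simp_all add: fun_eq_iff del: fun_upd_apply)
qed

lemma defect_even_monomial:
  assumes "sum \<alpha> (Basis :: 'a set) \<le> 7" and even: "\<And>b. b \<in> Basis \<Longrightarrow> even (\<alpha> b)"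
    and m4: "sum \<alpha> (Basis :: 'a set) \<ge> 4 \<Longrightarrow> m4 = 0"
    and m6: "sum \<alpha> (Basis :: 'a set) \<ge> 6 \<Longrightarrow> m6 = 0 \<and> m6' = 0"
  shows "defect X W (monomial \<alpha>) = 0"
proof -
  have one: "monomial \<beta> = (\<lambda>x::'a. 1)" if "sum \<beta> (Basis :: 'a set) = 0" for \<beta> :: "'a \<Rightarrow> nat"
    using that by (auto simp: monomial_def fun_eq_iff)
  have d2: "defect X W (\<lambda>x. (x \<bullet> b)\<^sup>2) = 0" if b: "b \<in> Basis" for b
  proof -
    obtain c d where "c \<in> Basis" "d \<in> Basis" "b \<noteq> c" "b \<noteq> d" "c \<noteq> d" by (rule obtain_Basis_3[OF b])
    then show ?thesis using defect_2 b by blast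
  qed
  have d4: "defect X W (\<lambda>x. (x \<bullet> b)\<^sup>2 * (x \<bullet> c)\<^sup>2) = 0" if "m4 = 0" and bc: "b \<in> Basis" "c \<in> Basis" for b c
  proof (cases "b = c")
    case True
    obtain c' d where "c' \<in> Basis" "d \<in> Basis" "b \<noteq> c'" "b \<noteq> d" "c' \<noteq> d" by (rule obtain_Basis_3[OF bc(1)])
    then show ?thesis using defect_4[OF bc(1)] \<open>m4 = 0\<close> True by (simp flip: power_add)
  next
    case False
    obtain d where "d \<in> Basis" "b \<noteq> d" "c \<noteq> d" by (rule obtain_Basis[OF bc False])
    then show ?thesis using defect_22[OF bc] \<open>m4 = 0\<close> False by simp
  qed
  have d42: "defect X W (\<lambda>x. (x \<bullet> b) ^ 4 * (x \<bullet> c)\<^sup>2) = 0"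
    if "m6 = 0" "m6' = 0" and bc: "b \<in> Basis" "c \<in> Basis" for b c
  proof (cases "b = c")
    case True
    obtain c' d where "c' \<in> Basis" "d \<in> Basis" "b \<noteq> c'" "b \<noteq> d" "c' \<noteq> d" by (rule obtain_Basis_3[OF bc(1)])
    then show ?thesis using defect_6[OF bc(1)] that True by (simp flip: power_add)
  next
    case False
    obtain d where "d \<in> Basis" "b \<noteq> d" "c \<noteq> d" by (rule obtain_Basis[OF bc False])
    then show ?thesis using defect_42[OF bc] that False by simp
  qed
  have d6: "defect X W (\<lambda>x. (x \<bullet> b)\<^sup>2 * (x \<bullet> c)\<^sup>2 * (x \<bullet> d)\<^sup>2) = 0"
    if "m6 = 0" "m6' = 0" and bcd: "b \<in> Basis" "c \<in> Basis" "d \<in> Basis" for b c d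
  proof -
    have pow: "y\<^sup>2 * y\<^sup>2 * z\<^sup>2 = y ^ 4 * z\<^sup>2" "y\<^sup>2 * z\<^sup>2 * y\<^sup>2 = y ^ 4 * z\<^sup>2" "z\<^sup>2 * y\<^sup>2 * y\<^sup>2 = y ^ 4 * z\<^sup>2" for y z :: real
      by algebra+
    consider "b = c" | "b = d" | "c = d" | "b \<noteq> c" "b \<noteq> d" "c \<noteq> d" by blast
    then show ?thesis
      using d42[OF that(1,2)] defect_222[OF bcd] that bcd by cases (simp_all add: pow)
  qed
  show ?thesis
  proof (cases "sum \<alpha> (Basis :: 'a set) = 0")
    case True
    then show ?thesis using one defect_1 by simp
  next
    case False
    obtain b \<beta> where b: "b \<in> Basis" "\<And>c. c \<in> Basis \<Longrightarrow> even (\<beta> c)" "sum \<beta> Basis + 2 = sum \<alpha> (Basis :: 'a set)"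
      "monomial \<alpha> = (\<lambda>x::'a. (x \<bullet> b)\<^sup>2 * monomial \<beta> x)"
      using peel_even_monomial[OF even False] by metis
    show ?thesis
    proof (cases "sum \<beta> (Basis :: 'a set) = 0")
      case True
      then show ?thesis unfolding b(4) using one[OF True] d2[OF b(1)] by simp
    next
      case False
      obtain c \<gamma> where c: "c \<in> Basis" "\<And>d. d \<in> Basis \<Longrightarrow> even (\<gamma> d)" "sum \<gamma> Basis + 2 = sum \<beta> (Basis :: 'a set)"
        "monomial \<beta> = (\<lambda>x::'a. (x \<bullet> c)\<^sup>2 * monomial \<gamma> x)"
        using peel_even_monomial[OF b(2) False] by metis
      show ?thesis
      proof (cases "sum \<gamma> (Basis :: 'a set) = 0")
        case True
        have "m4 = 0" by (rule m4) (use b(3) c(3) in linarith)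
        then show ?thesis unfolding b(4) c(4) using one[OF True] d4[OF _ b(1) c(1)] by simp
      next
        case False
        obtain d \<delta> where d: "d \<in> Basis" "\<And>d. d \<in> Basis \<Longrightarrow> even (\<delta> d)" "sum \<delta> Basis + 2 = sum \<gamma> (Basis :: 'a set)"
          "monomial \<gamma> = (\<lambda>x::'a. (x \<bullet> d)\<^sup>2 * monomial \<delta> x)"
          using peel_even_monomial[OF c(2) False] by metis
        \<comment> \<open>The degree bound 7 leaves at most 1 after three squares, and parity
          excludes 1.\<close>
        have "even (sum \<delta> (Basis :: 'a set))" using d(2) by (intro dvd_sum) auto
        moreover have "sum \<delta> (Basis :: 'a set) \<le> 1"
          using assms(1) b(3) c(3) d(3) by linarith
        ultimately have "sum \<delta> (Basis :: 'a set) = 0"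
          by (cases "sum \<delta> (Basis :: 'a set)") simp_all
        have "m6 = 0 \<and> m6' = 0" by (rule m6) (use b(3) c(3) d(3) in linarith)
        with \<open>sum \<delta> Basis = 0\<close> show ?thesis
          unfolding b(4) c(4) d(4) using one d6[OF _ _ b(1) c(1) d(1)] by (simp add: mult.assoc)
      qed
    qed
  qed
qed

text \<open>Converse to the necessary conditions. Below the dimension no monomial has all exponents
  odd, so a half-spin orbit may then occur alone.\<close>

lemma design_intro:
  assumes "t \<le> 7" "t \<ge> 4 \<Longrightarrow> m4 = 0" "t \<ge> 6 \<Longrightarrow> m6 = 0 \<and> m6' = 0"
    and "t < DIM('a) \<or>
      DIM('a) \<in> J \<and> DIM('a) - 1 \<in> J \<and> r (DIM('a) - 1) = r DIM('a) \<and> w (DIM('a) - 1) = w DIM('a)"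
  shows "euclidean_design t X W"
  unfolding euclidean_design_iff_monomials
proof (intro conjI allI impI ballI finite_X W_pos)
  fix \<alpha> :: "'a \<Rightarrow> nat" assume \<alpha>: "sum \<alpha> Basis \<le> t"
  show "defect X W (monomial \<alpha>) = 0"
  proof (cases "\<exists>b\<in>Basis. odd (\<alpha> b)")
    case True
    then obtain b where b: "b \<in> Basis" "odd (\<alpha> b)" by blast
    show ?thesis by (rule defect_odd_monomial[where \<alpha>=\<alpha>, OF b]) (use assms(4) \<alpha> in linarith)
  next
    case False
    then show ?thesis using assms(1-3) \<alpha> by (intro defect_even_monomial) auto
  qed
qed

end

section \<open>Classification\<close>

text \<open>The right sides count a half-spin orbit, up to the cleared factor 6. The left sides are
  the bounds for \<open>t = 3\<close>, \<open>t = 5\<close>, \<open>t = 6\<close> and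
  \<open>t = 7\<close>, each beaten from the stated threshold on.\<close>

lemma power_growth:
  "n \<ge> 5 \<Longrightarrow> 2 * n < (2::nat) ^ (n - 1)"
  "n \<ge> 7 \<Longrightarrow> (n + 1) * n + 2 < (2::nat) ^ (n - 1)"
  "n \<ge> 9 \<Longrightarrow> (n + 3) * ((n + 2) * (n + 1)) < 6 * (2::nat) ^ (n - 1)"
  "n \<ge> 10 \<Longrightarrow> 2 * ((n + 2) * ((n + 1) * n)) + 12 * n < 6 * (2::nat) ^ (n - 1)"
proof -
  have "2 * (5 + m) < (2::nat) ^ (4 + m)" for m
    by (induction m) (simp_all add: power_add)
  then show "2 * n < (2::nat) ^ (n - 1)" if "n \<ge> 5"
    using le_Suc_ex[OF that] by force
  have "(8 + m) * (7 + m) + 2 < (2::nat) ^ (6 + m)" for m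
    by (induction m) (simp_all add: algebra_simps power_add)
  then show "(n + 1) * n + 2 < (2::nat) ^ (n - 1)" if "n \<ge> 7"
    using le_Suc_ex[OF that] by force
  have "(12 + m) * ((11 + m) * (10 + m)) < 6 * (2::nat) ^ (8 + m)" for m
    by (induction m) (simp_all add: algebra_simps power_add)
  then show "(n + 3) * ((n + 2) * (n + 1)) < 6 * (2::nat) ^ (n - 1)" if "n \<ge> 9"
    using le_Suc_ex[OF that] by (force simp: add.commute)
  have "2 * ((12 + m) * ((11 + m) * (10 + m))) + 12 * (10 + m) < 6 * (2::nat) ^ (9 + m)" for m
    by (induction m) (simp_all add: algebra_simps power_add)
  then show "2 * ((n + 2) * ((n + 1) * n)) + 12 * n < 6 * (2::nat) ^ (n - 1)" if "n \<ge> 10"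
    using le_Suc_ex[OF that] by (force simp: add.commute)
qed

text \<open>Denominators are cleared so that comparisons of cardinalities stay within natural-number
  arithmetic.\<close>

lemma choose_values:
  "2 * (n + 1 choose 2) = (n + 1) * n" "2 * (n + 2 choose 2) = (n + 2) * (n + 1)"
  "6 * (n + 3 choose 3) = (n + 3) * ((n + 2) * (n + 1))" "6 * (n + 2 choose 3) = (n + 2) * ((n + 1) * n)"
proof -
  have "real (2 * (n + 1 choose 2)) = real ((n + 1) * n)" "real (2 * (n + 2 choose 2)) = real ((n + 2) * (n + 1))"
    "real (6 * (n + 3 choose 3)) = real ((n + 3) * ((n + 2) * (n + 1)))" "real (6 * (n + 2 choose 3)) = real ((n + 2) * ((n + 1) * n))"
    by (simp_all add: real_choose_2 real_choose_3) algebra+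
  then show "2 * (n + 1 choose 2) = (n + 1) * n" "2 * (n + 2 choose 2) = (n + 2) * (n + 1)"
    "6 * (n + 3 choose 3) = (n + 3) * ((n + 2) * (n + 1))" "6 * (n + 2 choose 3) = (n + 2) * ((n + 1) * n)"
    by (simp_all only: of_nat_eq_iff)
qed

section \<open>Values and lower bounds of orbit sizes\<close>

lemma orbit_size_values:
  "orbit_size 4 1 = 8" "orbit_size 4 2 = 24" "orbit_size 4 3 = 8" "orbit_size 4 4 = 8"
  "orbit_size 6 1 = 12" "orbit_size 6 5 = 32" "orbit_size 6 6 = 32"
  "orbit_size 8 1 = 16" "orbit_size 8 2 = 112" "orbit_size 8 7 = 128" "orbit_size 8 8 = 128"
  by code_simp+

lemmas orbit_size_simps = orbit_size_values orbit_size_values[unfolded One_nat_def]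

lemma choose_2_le_choose:
  assumes "2 \<le> k" "k \<le> n - 2"
  shows "n choose 2 \<le> n choose k"
proof (cases "2 * k \<le> n")
  case True
  then show ?thesis using assms by (intro binomial_mono) auto
next
  case False
  then have "n choose 2 \<le> n choose (n - k)" using assms by (intro binomial_mono) auto
  then show ?thesis using assms by (metis binomial_symmetric diff_le_self le_trans)
qed

text \<open>Unimodality replaces \<open>n choose k\<close> by \<open>n choose 2\<close>, while
  \<open>2 ^ k\<close> is kept so that \<open>k = 2\<close> can be told apart from larger
  \<open>k\<close>.\<close>

lemma orbit_size_middle:
  assumes "2 \<le> k" "k \<le> n - 2"
  shows "2 ^ k * (n * (n - 1)) \<le> 2 * orbit_size n k"
proof -
  obtain m where n: "n = m + 2" using assms by (metis add.commute le_Suc_ex le_trans diff_le_self)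
  have "2 ^ k * (n * (n - 1)) = 2 ^ k * (2 * (n choose 2))"
    using choose_values(2)[of m] by (simp add: n)
  also have "\<dots> \<le> 2 * (2 ^ k * (n choose k))"
    using choose_2_le_choose[OF assms] by simp
  also have "\<dots> = 2 * orbit_size n k"
    using assms by (simp add: orbit_size_def)
  finally show ?thesis .
qed

lemma orbit_size_ge:
  shows "2 \<le> k \<Longrightarrow> k \<le> n - 2 \<Longrightarrow> 2 * n * (n - 1) \<le> orbit_size n k"
    and "3 \<le> k \<Longrightarrow> k \<le> n - 2 \<Longrightarrow> 4 * n * (n - 1) \<le> orbit_size n k"
    and "1 \<le> k \<Longrightarrow> k \<le> n - 2 \<Longrightarrow> 2 * n \<le> orbit_size n k"
proof -
  have mid: "2 ^ j * (n * (n - 1)) \<le> 2 * orbit_size n k" if "2 \<le> k" "k \<le> n - 2" "j \<le> k" for j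
  proof -
    have "2 ^ j * (n * (n - 1)) \<le> 2 ^ k * (n * (n - 1))"
      using that(3) by (intro mult_right_mono power_increasing) auto
    then show ?thesis using orbit_size_middle[OF that(1,2)] by linarith
  qed
  show two: "2 \<le> k \<Longrightarrow> k \<le> n - 2 \<Longrightarrow> 2 * n * (n - 1) \<le> orbit_size n k"
    using mid[of 2] by simp
  show "3 \<le> k \<Longrightarrow> k \<le> n - 2 \<Longrightarrow> 4 * n * (n - 1) \<le> orbit_size n k"
    using mid[of 3] by simp
  show "2 * n \<le> orbit_size n k" if k: "1 \<le> k" "k \<le> n - 2"
  proof (cases "k = 1")
    case True
    then show ?thesis using k by (simp add: orbit_size_def) arith
  next
    case False
    have "2 * n * 1 \<le> 2 * n * (n - 1)" using k by (intro mult_left_mono) auto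
    then show ?thesis using two False k by linarith
  qed
qed

lemma sum_eq_0_imp_pos:
  fixes f :: "'b \<Rightarrow> real"
  assumes "finite A" "(\<Sum>x\<in>A. f x) = 0" "a \<in> A" "f a < 0"
  shows "\<exists>x\<in>A. f x > 0"
proof (rule ccontr)
  assume "\<not> (\<exists>x\<in>A. f x > 0)"
  then have "(\<Sum>x\<in>A. f x) < (\<Sum>x\<in>A. 0)"
    using assms by (intro sum_strict_mono_ex1) (auto simp: not_less)
  then show False using assms(2) by simp
qed

section \<open>Cardinality bounds for tight designs\<close>

context weighted_orbit_union
begin

lemma u_pos: "k \<in> J \<Longrightarrow> u k > 0"
  using w_pos orbit_size_pos by (simp add: u_def)

lemma supporting_spheres_X: "supporting_spheres X = (\<Union>k\<in>J. sphere 0 (r k))"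
  by (simp add: supporting_spheres_def norm_X)

lemma zero_notin_X: "0 \<notin> X"
proof
  assume "0 \<in> X"
  then have "norm (0 :: 'a) \<in> r ` J" using norm_X by blast
  then show False using r_pos by force
qed

lemma tight_iff:
  "tight_euclidean_design t X W \<longleftrightarrow> euclidean_design t X W \<and>
    card X = (if even t then dim_poly_on (t div 2) (supporting_spheres X)
      else 2 * dim_parity_poly_on ((t + 1) div 2 - 1) (supporting_spheres X))"
  using zero_notin_X by (simp add: tight_euclidean_design_def Let_def)

lemma sum_orbit_size_le: "K \<subseteq> J \<Longrightarrow> (\<Sum>k\<in>K. orbit_size DIM('a) k) \<le> card X"
  unfolding card_X by (intro sum_mono2 finite_J) auto

text \<open>Orbits are nonempty, so an index outside \<open>K\<close> would push the cardinality
  beyond the total of the orbits in \<open>K\<close>.\<close>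

lemma J_eqI:
  assumes "K \<subseteq> J" "card X \<le> (\<Sum>k\<in>K. orbit_size DIM('a) k)"
  shows "J = K"
proof (rule ccontr)
  assume "J \<noteq> K"
  then obtain k where k: "k \<in> J" "k \<notin> K" using assms(1) by blast
  have "(\<Sum>k\<in>insert k K. orbit_size DIM('a) k) \<le> card X"
    using assms(1) k by (intro sum_orbit_size_le) auto
  then show False
    using assms finite_subset[OF assms(1) finite_J] k(2) orbit_size_pos[OF k(1)] by simp
qed

text \<open>Tightness equates the cardinality with a dimension, and the dimension is bounded by
  counting monomials whatever the radii are.\<close>

lemma tight_card_le:
  assumes tight: "tight_euclidean_design t X W"
  shows "t = 1 \<Longrightarrow> card X \<le> 2" "t = 2 \<Longrightarrow> card X \<le> DIM('a) + 1" "t = 3 \<Longrightarrow> card X \<le> 2 * DIM('a)"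
    "t = 4 \<Longrightarrow> 2 * card X \<le> (DIM('a) + 2) * (DIM('a) + 1)"
    "t = 5 \<Longrightarrow> card X \<le> (DIM('a) + 1) * DIM('a) + 2"
    "t = 6 \<Longrightarrow> 6 * card X \<le> (DIM('a) + 3) * ((DIM('a) + 2) * (DIM('a) + 1))"
    "t = 7 \<Longrightarrow> 6 * card X \<le> 2 * ((DIM('a) + 2) * ((DIM('a) + 1) * DIM('a))) + 12 * DIM('a)"
proof -
  let ?S = "supporting_spheres X"
  have e: "card X = dim_poly_on (t div 2) ?S" if "even t"
    using tight that by (simp add: tight_iff)
  have o: "card X = 2 * dim_parity_poly_on ((t + 1) div 2 - 1) ?S" if "odd t"
    using tight that by (simp add: tight_iff)
  note choose = choose_values[of "DIM('a)"]
  show "card X \<le> 2" if "t = 1" using that o dim_parity_poly_on_le[of 0 ?S] by simp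
  show "card X \<le> DIM('a) + 1" if "t = 2" using that e dim_poly_on_le[of 1 ?S] by simp
  show "card X \<le> 2 * DIM('a)" if "t = 3" using that o dim_parity_poly_on_le[of 1 ?S] by simp
  show "2 * card X \<le> (DIM('a) + 2) * (DIM('a) + 1)" if "t = 4"
  proof -
    have "card X = dim_poly_on 2 ?S" using e that by simp
    then show ?thesis using dim_poly_on_le[of 2 ?S] choose(2) by linarith
  qed
  show "card X \<le> (DIM('a) + 1) * DIM('a) + 2" if "t = 5"
  proof -
    have "card X = 2 * dim_parity_poly_on 2 ?S" using o that by simp
    moreover have "dim_parity_poly_on 2 ?S \<le> (DIM('a) + 1 choose 2) + 1"
      using dim_parity_poly_on_le[of 2 ?S] by simp
    ultimately show ?thesis using choose(1) by linarith
  qed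
  show "6 * card X \<le> (DIM('a) + 3) * ((DIM('a) + 2) * (DIM('a) + 1))" if "t = 6"
  proof -
    have "card X = dim_poly_on 3 ?S" using e that by simp
    then show ?thesis using dim_poly_on_le[of 3 ?S] choose(3) by linarith
  qed
  show "6 * card X \<le> 2 * ((DIM('a) + 2) * ((DIM('a) + 1) * DIM('a))) + 12 * DIM('a)" if "t = 7"
  proof -
    have "card X = 2 * dim_parity_poly_on 3 ?S" using o that by simp
    moreover have "dim_parity_poly_on 3 ?S \<le> (DIM('a) + 2 choose 3) + DIM('a)"
      using dim_parity_poly_on_le[of 3 ?S] by simp
    ultimately show ?thesis using choose(4) by linarith
  qed
qed

section \<open>Necessary conditions for a design containing a half-spin orbit\<close>

context
  fixes \<sigma> :: nat
  assumes \<sigma>: "\<sigma> \<in> J" "\<sigma> = DIM('a) \<or> \<sigma> = DIM('a) - 1"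
begin

lemma S_spin: "S \<sigma> = n"
  using \<sigma>(2) by (auto simp: S_def n_def support_size_def)

lemma spin_or_small: "k \<in> J \<Longrightarrow> k = DIM('a) \<or> k = DIM('a) - 1 \<or> k \<le> DIM('a) - 2 \<and> S k = k"
  using J_D[of k] by (auto simp: S_def support_size_def)

lemma S_less_imp:
  assumes "k \<in> J" "S k < n"
  shows "k \<le> DIM('a) - 2" "S k = k"
  using spin_or_small[OF assms(1)] assms(2) by (auto simp: S_def n_def support_size_def)

text \<open>The half-spin term of \<open>m4\<close> is negative and must be balanced by a positive
  one. That term has support size below \<open>n\<close>, where support size and index
  agree.\<close>

lemma design_imp_ex_4:
  assumes "euclidean_design t X W" "t \<ge> 4"
  shows "\<exists>k\<in>J. 3 * k < DIM('a) + 2"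
proof -
  have "\<exists>k\<in>J. u k * r k ^ 4 * (n + 2 - 3 * S k) / S k > 0"
    using design_imp_m4[OF assms] u_pos[OF \<sigma>(1)] r_pos[OF \<sigma>(1)] n4
    by (intro sum_eq_0_imp_pos[OF finite_J _ \<sigma>(1)])
       (simp_all add: m4_def S_spin divide_neg_pos mult_pos_neg)
  then obtain k where k: "k \<in> J" "u k * r k ^ 4 * (n + 2 - 3 * S k) / S k > 0" by blast
  have "n + 2 - 3 * S k > 0"
  proof (rule ccontr)
    assume "\<not> n + 2 - 3 * S k > 0"
    then have "u k * r k ^ 4 * (n + 2 - 3 * S k) / S k \<le> 0"
      using u_pos[OF k(1)] r_pos[OF k(1)] S_pos[OF k(1)] by (intro divide_nonpos_pos mult_nonneg_nonpos) auto
    then show False using k(2) by simp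
  qed
  moreover from this have "S k = k" using n4 by (intro S_less_imp k(1)) linarith
  ultimately have "3 * k < DIM('a) + 2" by (simp add: n_def)
  then show ?thesis using k(1) by blast
qed

lemma design_imp_ex_6:
  assumes "euclidean_design t X W" "t \<ge> 6"
  shows "\<exists>k\<in>J. 5 * k < DIM('a) + 4"
proof -
  have "\<exists>k\<in>J. u k * r k ^ 6 * (n + 4 - 5 * S k) / (S k)\<^sup>2 > 0"
    using design_imp_m6(1)[OF assms] u_pos[OF \<sigma>(1)] r_pos[OF \<sigma>(1)] n4
    by (intro sum_eq_0_imp_pos[OF finite_J _ \<sigma>(1)])
       (simp_all add: m6_def S_spin divide_neg_pos mult_pos_neg)
  then obtain k where k: "k \<in> J" "u k * r k ^ 6 * (n + 4 - 5 * S k) / (S k)\<^sup>2 > 0" by blast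
  have "n + 4 - 5 * S k > 0"
  proof (rule ccontr)
    assume "\<not> n + 4 - 5 * S k > 0"
    then have "u k * r k ^ 6 * (n + 4 - 5 * S k) / (S k)\<^sup>2 \<le> 0"
      using u_pos[OF k(1)] r_pos[OF k(1)] S_pos[OF k(1)] by (intro divide_nonpos_pos mult_nonneg_nonpos) auto
    then show False using k(2) by simp
  qed
  moreover from this have "S k = k" using n4 by (intro S_less_imp k(1)) linarith
  ultimately have "5 * k < DIM('a) + 4" by (simp add: n_def)
  then show ?thesis using k(1) by blast
qed

text \<open>The combination \<open>(n - 2) * m6 - 3 * m6'\<close> has positive terms both for \<open>k = 1\<close> and for the
  half-spin orbits, so it cannot vanish if only these occur.\<close>

lemma design_imp_ex_middle:
  assumes "euclidean_design t X W" "t \<ge> 6"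
  shows "\<exists>k\<in>J. 2 \<le> k \<and> k \<le> DIM('a) - 2"
proof (rule ccontr)
  assume neg: "\<not> ?thesis"
  have S: "S k = 1 \<or> S k = n" if "k \<in> J" for k
    using neg that spin_or_small[OF that] J_D[OF that] by (auto simp: S_def n_def support_size_def)
  let ?g = "\<lambda>s. (n - 2) * (n + 4 - 5 * s) - 3 * ((s - 1) * (n + 4 - 3 * s))"
  have "(n - 2) * m6 - 3 * m6' = (\<Sum>k\<in>J. u k * r k ^ 6 / (S k)\<^sup>2 * ?g (S k))"
  proof -
    have "c * (a * x / q) - 3 * (a * y / q) = a / q * (c * x - 3 * y)" for a c q x y :: real
      by (simp add: divide_inverse) algebra
    then show ?thesis
      unfolding m6_def m6'_def sum_distrib_left sum_subtractf[symmetric] by (intro sum.cong refl)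
  qed
  also have "\<dots> > 0"
  proof (rule sum_pos[OF finite_J])
    show "J \<noteq> {}" using \<sigma>(1) by blast
    fix k assume k: "k \<in> J"
    have "?g 1 = (n - 1) * (n - 2)" "?g n = 2 * ((n - 1) * (n - 2))" by algebra+
    moreover have "(n - 1) * (n - 2) > 0" using n4 by simp
    ultimately have "?g (S k) > 0" using S[OF k] by (metis mult_pos_pos zero_less_numeral)
    then show "u k * r k ^ 6 / (S k)\<^sup>2 * ?g (S k) > 0"
      using u_pos[OF k] r_pos[OF k] S_pos[OF k] by (intro mult_pos_pos divide_pos_pos) auto
  qed
  finally show False using design_imp_m6[OF assms] by simp
qed

text \<open>The sides of \<open>design_imp_half_spin\<close> for \<open>i = 0\<close> are nonzero
  exactly when the respective index is in \<open>J\<close>.\<close>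

lemma design_imp_both_spins:
  assumes "euclidean_design t X W" "t \<ge> DIM('a)"
  shows "DIM('a) \<in> J" "DIM('a) - 1 \<in> J"
proof -
  have "(if DIM('a) \<in> J then w DIM('a) * r DIM('a) ^ DIM('a) else 0) =
      (if DIM('a) - 1 \<in> J then w (DIM('a) - 1) * r (DIM('a) - 1) ^ DIM('a) else 0)"
    by (rule design_imp_half_spin[OF assms(1), of 0, unfolded mult_0_right add_0_right, OF assms(2)])
  moreover have "w k * r k ^ DIM('a) \<noteq> 0" if "k \<in> J" for k
    using w_pos[OF that] r_pos[OF that] by simp
  ultimately show "DIM('a) \<in> J" "DIM('a) - 1 \<in> J"
    using \<sigma> by metis+
qed

lemma two_power_le_card: "2 ^ (DIM('a) - 1) \<le> card X"
  using sum_orbit_size_le[of "{\<sigma>}"] \<sigma> by (auto simp: orbit_size_def split: if_splits)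

lemma sum_card_le:
  assumes "k \<in> J" "k \<le> DIM('a) - 2"
  shows "2 ^ (DIM('a) - 1) + orbit_size DIM('a) k \<le> card X"
    and "DIM('a) \<in> J \<Longrightarrow> DIM('a) - 1 \<in> J \<Longrightarrow> 2 * 2 ^ (DIM('a) - 1) + orbit_size DIM('a) k \<le> card X"
proof -
  have ne: "k \<noteq> \<sigma>" "k \<noteq> DIM('a)" "k \<noteq> DIM('a) - 1" "DIM('a) \<noteq> DIM('a) - 1"
    using assms(2) \<sigma>(2) dim by auto
  have size: "orbit_size DIM('a) DIM('a) = 2 ^ (DIM('a) - 1)" "orbit_size DIM('a) (DIM('a) - 1) = 2 ^ (DIM('a) - 1)"
    by (simp_all add: orbit_size_def)
  show "2 ^ (DIM('a) - 1) + orbit_size DIM('a) k \<le> card X"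
    using sum_orbit_size_le[of "{\<sigma>, k}"] \<sigma> assms(1) ne size by auto
  show "2 * 2 ^ (DIM('a) - 1) + orbit_size DIM('a) k \<le> card X" if "DIM('a) \<in> J" "DIM('a) - 1 \<in> J"
    using sum_orbit_size_le[of "{DIM('a), DIM('a) - 1, k}"] that assms(1) ne size by simp
qed

text \<open>A half-spin orbit alone grows exponentially with the dimension, whereas tightness allows
  only polynomial growth.\<close>

lemma tight_imp_dim_le:
  assumes "tight_euclidean_design t X W"
  shows "t \<noteq> 1" "t \<noteq> 2" "t = 3 \<Longrightarrow> DIM('a) = 4" "t = 4 \<or> t = 5 \<Longrightarrow> DIM('a) \<le> 6"
    "t = 6 \<Longrightarrow> DIM('a) \<le> 8" "t = 7 \<Longrightarrow> DIM('a) \<le> 9"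
proof -
  note le = tight_card_le[OF assms] and pow = two_power_le_card
  note growth = power_growth[of "DIM('a)"]
  have "(2::nat) ^ 3 \<le> 2 ^ (DIM('a) - 1)" using dim by (intro power_increasing) auto
  then have 8: "8 \<le> card X" using pow by simp
  show "t \<noteq> 1" using le(1) 8 by auto
  show "t \<noteq> 2"
  proof
    assume "t = 2"
    then have "card X \<le> DIM('a) + 1" by (rule le(2))
    then show False using pow growth(1) 8 by (cases "DIM('a) \<ge> 5") linarith+
  qed
  show "DIM('a) = 4" if "t = 3"
    using le(3)[OF that] pow growth(1) dim by linarith
  show "DIM('a) \<le> 6" if "t = 4 \<or> t = 5"
  proof (rule ccontr)
    assume "\<not> DIM('a) \<le> 6"
    then have d: "DIM('a) \<ge> 7" by simp
    \<comment> \<open>The bound for \<open>t = 4\<close> is no larger than that for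
      \<open>t = 5\<close>, so one growth estimate handles both.\<close>
    have "(DIM('a) + 2) * (DIM('a) + 1) \<le> 2 * ((DIM('a) + 1) * DIM('a) + 2)"
      by (simp add: le_SucI)
    then have "card X \<le> (DIM('a) + 1) * DIM('a) + 2"
      using that le(4,5) by (cases "t = 4") simp_all
    then show False using growth(2)[OF d] pow by linarith
  qed
  show "DIM('a) \<le> 8" if "t = 6"
    using le(6)[OF that] growth(3) pow by linarith
  show "DIM('a) \<le> 9" if "t = 7"
    using le(7)[OF that] growth(4) pow by linarith
qed

section \<open>Admissible dimensions and index sets for each strength\<close>

lemma tight_3:
  assumes "tight_euclidean_design 3 X W"
  shows "DIM('a) = 4 \<and> J = {\<sigma>}"
proof -
  have N: "DIM('a) = 4" using tight_imp_dim_le(3)[OF assms] by simp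
  have "card X \<le> 8" using tight_card_le(3)[OF assms] N by simp
  then have "J = {\<sigma>}"
    using \<sigma> by (intro J_eqI) (auto simp: N orbit_size_simps)
  then show ?thesis using N by simp
qed

text \<open>In dimensions 4, 5, 6 at most 15, 21, 28 points are allowed, but a half-spin orbit and a
  small one have at least \<open>8 + 8\<close>, \<open>16 + 10\<close>,
  \<open>32 + 12\<close>.\<close>

lemma not_tight_4: "\<not> tight_euclidean_design 4 X W"
proof
  assume tight: "tight_euclidean_design 4 X W"
  then have design: "euclidean_design 4 X W" by (simp add: tight_iff)
  obtain k where k: "k \<in> J" "3 * k < DIM('a) + 2" using design_imp_ex_4[OF design] by auto
  have k': "k \<le> DIM('a) - 2" "1 \<le> k" using k J_D[OF k(1)] dim by auto
  note le = tight_card_le(4)[OF tight refl] sum_card_le[OF k(1) k'(1)] orbit_size_ge(3)[OF k'(2,1)]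
  consider "DIM('a) = 4" | "DIM('a) = 5" | "DIM('a) = 6"
    using tight_imp_dim_le(4)[OF tight] dim by linarith
  then show False
    using le design_imp_both_spins[OF design] by cases auto
qed

text \<open>In dimensions 4 and 5 both half-spin orbits occur, and \<open>16 + 8 > 22\<close>,
  \<open>32 + 10 > 32\<close>. In dimension 6 the bound 44 equals \<open>32 + 12\<close>, leaving
  room for the orbit of index 1 only.\<close>

lemma tight_5:
  assumes tight: "tight_euclidean_design 5 X W"
  shows "DIM('a) = 6 \<and> J = {1, \<sigma>}"
proof -
  have design: "euclidean_design 5 X W" using tight by (simp add: tight_iff)
  obtain k where k: "k \<in> J" "3 * k < DIM('a) + 2" using design_imp_ex_4[OF design] by auto
  have k': "k \<le> DIM('a) - 2" "1 \<le> k" using k J_D[OF k(1)] dim by auto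
  note le = tight_card_le(5)[OF tight refl] sum_card_le[OF k(1) k'(1)] orbit_size_ge(3)[OF k'(2,1)]
  have k1: "k = 1 \<or> 2 \<le> k" using k' by auto
  have small: "DIM('a) \<noteq> 4" "DIM('a) \<noteq> 5"
    using le design_imp_both_spins[OF design] by auto
  have N: "DIM('a) = 6"
    using tight_imp_dim_le(4)[OF tight] dim small by linarith
  have "k = 1"
    using le(1,2) k1 k' orbit_size_ge(1)[of k "DIM('a)"] by (auto simp: N)
  moreover have "J = {k, \<sigma>}"
    using k(1) \<sigma> le(1) \<open>k = 1\<close> by (intro J_eqI) (auto simp: N orbit_size_simps)
  ultimately show ?thesis using N by simp
qed

text \<open>In dimensions 4 and 5 both half-spin orbits are needed for the contradiction:
  \<open>16 + 24 > 35\<close> and \<open>32 + 40 > 56\<close>. In dimensions 6, 7, 8 one of them and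
  a middle orbit exceed 84, 120, 165.\<close>

lemma not_tight_6: "\<not> tight_euclidean_design 6 X W"
proof
  assume tight: "tight_euclidean_design 6 X W"
  then have design: "euclidean_design 6 X W" by (simp add: tight_iff)
  obtain k where k: "k \<in> J" "2 \<le> k" "k \<le> DIM('a) - 2" using design_imp_ex_middle[OF design] by auto
  note le = tight_card_le(6)[OF tight refl] sum_card_le[OF k(1,3)]
  consider "DIM('a) = 4" | "DIM('a) = 5" | "DIM('a) = 6" | "DIM('a) = 7" | "DIM('a) = 8"
    using tight_imp_dim_le(5)[OF tight] dim by linarith
  then show False
    using le design_imp_both_spins[OF design] orbit_size_ge(1)[OF k(2,3)] by cases auto
qed

text \<open>The bound is 48 in dimension 4, attained by \<open>16 + 8 + 24\<close>. In dimension 8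
  it is 256, and \<open>128 + 112\<close> leaves exactly 16, the size of the orbit of index 1, so
  \<open>{1, 2, \<sigma>}\<close> survives the count.\<close>

lemma tight_7:
  assumes tight: "tight_euclidean_design 7 X W"
  shows "DIM('a) = 4 \<and> J = {1, 2, 3, 4} \<or> DIM('a) = 8 \<and> (J = {2, \<sigma>} \<or> J = {1, 2, \<sigma>})"
proof -
  have design: "euclidean_design 7 X W" using tight by (simp add: tight_iff)
  obtain k where k: "k \<in> J" "2 \<le> k" "k \<le> DIM('a) - 2" using design_imp_ex_middle[OF design] by auto
  obtain l where l: "l \<in> J" "5 * l < DIM('a) + 4" using design_imp_ex_6[OF design] by auto
  note le = tight_card_le(7)[OF tight refl] sum_card_le[OF k(1,3)]
  note middle = orbit_size_ge(1)[OF k(2,3)]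
  have l1: "l = 1" if "DIM('a) \<le> 6" using l J_D[OF l(1)] that by linarith
  have three: "2 * 2 ^ (DIM('a) - 1) + orbit_size DIM('a) 1 + orbit_size DIM('a) k \<le> card X"
    if "DIM('a) \<le> 6"
  proof -
    have "DIM('a) \<in> J" "DIM('a) - 1 \<in> J" using design_imp_both_spins[OF design] that by auto
    then have "{DIM('a), DIM('a) - 1, 1, k} \<subseteq> J" using k l l1[OF that] by auto
    moreover have "DIM('a) \<noteq> DIM('a) - 1" "DIM('a) \<noteq> 1" "DIM('a) \<noteq> k" "DIM('a) - 1 \<noteq> 1" "DIM('a) - 1 \<noteq> k" "1 \<noteq> k"
      using dim k by linarith+
    moreover have "orbit_size DIM('a) DIM('a) = 2 ^ (DIM('a) - 1)" "orbit_size DIM('a) (DIM('a) - 1) = 2 ^ (DIM('a) - 1)"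
      by (simp_all add: orbit_size_def)
    ultimately show ?thesis using sum_orbit_size_le[of "{DIM('a), DIM('a) - 1, 1, k}"] by simp
  qed
  have "DIM('a) \<noteq> 5" "DIM('a) \<noteq> 6" "DIM('a) \<noteq> 7" "DIM('a) \<noteq> 9"
    using le three middle orbit_size_ge(3)[of 1 "DIM('a)"] design_imp_both_spins[OF design] by auto
  then consider "DIM('a) = 4" | "DIM('a) = 8"
    using tight_imp_dim_le(6)[OF tight] dim by linarith
  then show ?thesis
  proof cases
    case 1
    then have "{1, 2, 3, 4} \<subseteq> J"
      using design_imp_both_spins[OF design] k l(1) l1 by auto
    then have "J = {1, 2, 3, 4}" using J 1 by auto
    then show ?thesis using 1 by simp
  next
    case 2
    have "k = 2"
      using le(1,2) orbit_size_ge(2)[of k "DIM('a)"] k by (cases "k = 2") (auto simp: 2)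
    then have K: "{2, \<sigma>} \<subseteq> J" "\<sigma> = 8 \<or> \<sigma> = 7" using k \<sigma> 2 by auto
    have sub: "j \<in> {1, 2, \<sigma>}" if j: "j \<in> J" for j
    proof (rule ccontr)
      assume no: "j \<notin> {1, 2, \<sigma>}"
      have "{2, \<sigma>, j} \<subseteq> J" using K j by auto
      \<comment> \<open>Here 240 is \<open>112 + 128\<close> and 256 the cardinality bound. Any
        further orbit but that of index 1 has at least 128 points.\<close>
      from sum_orbit_size_le[OF this] have "240 + orbit_size 8 j \<le> 256"
        using le(1) K(2) no by (auto simp: 2 orbit_size_simps)
      moreover have "orbit_size 8 j \<ge> 128"
        using J_D[OF j] no K(2) orbit_size_ge(2)[of j "DIM('a)"]
        by (cases "j \<le> 6") (auto simp: 2 orbit_size_def)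
      ultimately show False by simp
    qed
    show ?thesis
    proof (cases "1 \<in> J")
      case True
      then have "J = {1, 2, \<sigma>}" using K sub by blast
      then show ?thesis using 2 by simp
    next
      case False
      then have "J = {2, \<sigma>}" using K sub by blast
      then show ?thesis using 2 by simp
    qed
  qed
qed

text \<open>Dividing the two equations eliminates the weights and leaves equal squares of radii; two
  different powers of the radius thus separate weight and radius.\<close>

lemma eq_of_power_weights:
  fixes a b x y :: real
  assumes "a * x ^ 4 = b * y ^ 4" "a * x ^ 6 = b * y ^ 6" "a > 0" "b > 0" "x > 0" "y > 0"
  shows "x = y" "a = b"
proof -
  have "b * y ^ 4 * x\<^sup>2 = b * y ^ 4 * y\<^sup>2"
    using assms(1,2) by algebra
  then have "x\<^sup>2 = y\<^sup>2" using assms(4,6) by simp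
  then show "x = y" using assms(5,6) by (simp add: power2_eq_iff)
  then show "a = b" using assms(1,6) by simp
qed

section \<open>Radii and weights for the remaining index sets\<close>

lemma supporting_spheres_single: "(\<And>k. k \<in> J \<Longrightarrow> r k = \<rho>) \<Longrightarrow> supporting_spheres X = sphere 0 \<rho>"
  using \<sigma>(1) by (auto simp: supporting_spheres_X)

text \<open>In dimension 4 a half-spin orbit consists of four pairwise orthogonal vectors and their
  negatives. Degree 3 is below the dimension, so no second half-spin orbit is required.\<close>

lemma tight_3_iff:
  "tight_euclidean_design 3 X W \<longleftrightarrow> DIM('a) = 4 \<and> J = {\<sigma>}"
proof
  assume *: "DIM('a) = 4 \<and> J = {\<sigma>}"
  then have "euclidean_design 3 X W" by (intro design_intro) auto
  moreover have "card X = 8"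
    unfolding card_X using * \<sigma>(2) by (auto simp: orbit_size_simps)
  moreover have "dim_parity_poly_on 1 (supporting_spheres X) = 4"
    using * supporting_spheres_single[of "r \<sigma>"] dim_parity_poly_on_sphere[where 'a='a, of "r \<sigma>" 1] r_pos[OF \<sigma>(1)] by simp
  ultimately show "tight_euclidean_design 3 X W" by (simp add: tight_iff)
qed (rule tight_3)

text \<open>The 44 points equal twice the dimension 22 for two spheres, whereas one sphere has
  dimension 21, so tightness forces different radii. The ratio 9/8 is \<open>60 / (160/3)\<close>,
  from the two coefficients of \<open>m4\<close>.\<close>

lemma tight_5_iff:
  "tight_euclidean_design 5 X W \<longleftrightarrow>
    DIM('a) = 6 \<and> J = {1, \<sigma>} \<and> r \<sigma> \<noteq> r 1 \<and> 8 * w \<sigma> * r \<sigma> ^ 4 = 9 * w 1 * r 1 ^ 4"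
proof (cases "DIM('a) = 6 \<and> J = {1, \<sigma>}")
  case True
  then have N: "DIM('a) = 6" and Jeq: "J = {1, \<sigma>}" by auto
  have \<sigma>': "\<sigma> = 6 \<or> \<sigma> = 5" using \<sigma>(2) N by auto
  have vals: "S 1 = 1" "n = 6" "S \<sigma> = 6" "u 1 = 12 * w 1" "u \<sigma> = 32 * w \<sigma>"
    using \<sigma>' N by (auto simp: S_def n_def u_def support_size_def orbit_size_simps)
  have "m4 = 60 * (w 1 * r 1 ^ 4) - 160 / 3 * (w \<sigma> * r \<sigma> ^ 4)"
    unfolding m4_def unfolding Jeq using \<sigma>' vals by auto
  then have m4: "m4 = 0 \<longleftrightarrow> 8 * w \<sigma> * r \<sigma> ^ 4 = 9 * w 1 * r 1 ^ 4" by auto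
  have design: "euclidean_design 5 X W \<longleftrightarrow> m4 = 0"
    using design_imp_m4[of 5] design_intro[of 5] N by auto
  have card: "card X = 44"
    unfolding card_X unfolding Jeq N using \<sigma>' by (auto simp: orbit_size_simps)
  have mem: "1 \<in> J" using Jeq by simp
  have pos: "r 1 > 0" "r \<sigma> > 0" using r_pos mem \<sigma>(1) by auto
  have "dim_parity_poly_on 2 (supporting_spheres X) = 22 \<longleftrightarrow> r \<sigma> \<noteq> r 1"
  proof (cases "r \<sigma> = r 1")
    case True
    then have "supporting_spheres X = sphere 0 (r 1)" using Jeq by (intro supporting_spheres_single) auto
    then show ?thesis
      using dim_parity_poly_on_sphere[where 'a='a, of "r 1" 2] pos choose_values(1)[of 6] True N by simp
  next
    case False
    have "sphere 0 (r \<sigma>) \<subseteq> supporting_spheres X" "sphere 0 (r 1) \<subseteq> supporting_spheres X"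
      unfolding supporting_spheres_X using mem \<sigma>(1) by blast+
    then show ?thesis
      using dim_parity_poly_on_two_spheres[of "r \<sigma>" "r 1" "supporting_spheres X" 2] pos choose_values(1)[of 6] N False
      by simp
  qed
  then have "tight_euclidean_design 5 X W \<longleftrightarrow> r \<sigma> \<noteq> r 1 \<and> 8 * w \<sigma> * r \<sigma> ^ 4 = 9 * w 1 * r 1 ^ 4"
    unfolding tight_iff using design m4 card by auto
  then show ?thesis using True by blast
qed (use tight_5 in blast)

text \<open>In dimension 8 the orbits form, up to scale, the 240 roots of \<open>E8\<close>, and the
  equations force a single sphere of dimension 120. In dimension 4 the orbits of index 1, 3, 4 form
  a 24-cell and orbit 2 a dual one; the 48 points match dimension 24 for two spheres, while one
  sphere has dimension 20.\<close>

lemma tight_7_iff: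
  "tight_euclidean_design 7 X W \<longleftrightarrow>
    DIM('a) = 8 \<and> J = {2, \<sigma>} \<and> r \<sigma> = r 2 \<and> w \<sigma> = w 2 \<or>
    DIM('a) = 4 \<and> J = {1, 2, 3, 4} \<and> r 3 = r 1 \<and> r 4 = r 1 \<and> r 2 \<noteq> r 1 \<and> w 3 = w 1 \<and> w 4 = w 1 \<and>
      w 2 * r 2 ^ 6 = w 1 * r 1 ^ 6"
proof -
  have eight: ?thesis if N: "DIM('a) = 8" and Jeq: "J = {2, \<sigma>}"
  proof -
    have \<sigma>': "\<sigma> = 8 \<or> \<sigma> = 7" using \<sigma>(2) N by auto
    have vals: "S 2 = 2" "n = 8" "S \<sigma> = 8" "u 2 = 112 * w 2" "u \<sigma> = 128 * w \<sigma>"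
      using \<sigma>' N by (auto simp: S_def n_def u_def support_size_def orbit_size_simps)
    have m: "m4 = 224 * (w 2 * r 2 ^ 4) - 224 * (w \<sigma> * r \<sigma> ^ 4)"
      "m6 = 56 * (w 2 * r 2 ^ 6) - 56 * (w \<sigma> * r \<sigma> ^ 6)"
      "m6' = 168 * (w 2 * r 2 ^ 6) - 168 * (w \<sigma> * r \<sigma> ^ 6)"
      unfolding m4_def m6_def m6'_def unfolding Jeq using \<sigma>' vals by auto
    have pos: "r 2 > 0" "r \<sigma> > 0" "w 2 > 0" "w \<sigma> > 0" using r_pos w_pos Jeq by auto
    have design: "euclidean_design 7 X W \<longleftrightarrow> r \<sigma> = r 2 \<and> w \<sigma> = w 2"
    proof
      assume d: "euclidean_design 7 X W"
      have "w \<sigma> * r \<sigma> ^ 4 = w 2 * r 2 ^ 4" "w \<sigma> * r \<sigma> ^ 6 = w 2 * r 2 ^ 6"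
        using design_imp_m4[OF d] design_imp_m6(1)[OF d] m by simp_all
      then show "r \<sigma> = r 2 \<and> w \<sigma> = w 2" using pos eq_of_power_weights by blast
    next
      assume "r \<sigma> = r 2 \<and> w \<sigma> = w 2"
      then show "euclidean_design 7 X W" using m N by (intro design_intro) auto
    qed
    have card: "card X = 240"
      unfolding card_X unfolding Jeq N using \<sigma>' by (auto simp: orbit_size_simps)
    have "dim_parity_poly_on 3 (supporting_spheres X) = 120" if "r \<sigma> = r 2"
    proof -
      have "supporting_spheres X = sphere 0 (r 2)" using Jeq that by (intro supporting_spheres_single) auto
      then show ?thesis
        using dim_parity_poly_on_sphere[where 'a='a, of "r 2" 3] pos choose_values(4)[of 8] N by simp
    qed
    then have "tight_euclidean_design 7 X W \<longleftrightarrow> r \<sigma> = r 2 \<and> w \<sigma> = w 2"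
      unfolding tight_iff using design card by auto
    moreover have "DIM('a) \<noteq> 4" using N by simp
    ultimately show ?thesis using N Jeq by blast
  qed
  have four: ?thesis if N: "DIM('a) = 4" and Jeq: "J = {1, 2, 3, 4}"
  proof -
    have vals: "S 1 = 1" "S 2 = 2" "S 3 = 4" "S 4 = 4" "n = 4"
      "u 1 = 8 * w 1" "u 2 = 24 * w 2" "u 3 = 8 * w 3" "u 4 = 8 * w 4"
      using N by (auto simp: S_def n_def u_def support_size_def orbit_size_simps)
    \<comment> \<open>Orbit 2 is absent from \<open>m4\<close> because
      \<open>n + 2 - 3 * S 2 = 0\<close>; hence its radius stays free and only
      \<open>w 2 * r 2 ^ 6\<close> is fixed.\<close>
    have m: "m4 = 24 * (w 1 * r 1 ^ 4) - 12 * (w 3 * r 3 ^ 4) - 12 * (w 4 * r 4 ^ 4)"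
      "m6 = 24 * (w 1 * r 1 ^ 6) - 12 * (w 2 * r 2 ^ 6) - 6 * (w 3 * r 3 ^ 6) - 6 * (w 4 * r 4 ^ 6)"
      "m6' = 12 * (w 2 * r 2 ^ 6) - 6 * (w 3 * r 3 ^ 6) - 6 * (w 4 * r 4 ^ 6)"
      unfolding m4_def m6_def m6'_def unfolding Jeq using vals by simp_all
    have mem: "1 \<in> J" "2 \<in> J" "3 \<in> J" "4 \<in> J" using Jeq by auto
    then have pos: "r 1 > 0" "r 2 > 0" "r 3 > 0" "r 4 > 0" "w 1 > 0" "w 2 > 0" "w 3 > 0" "w 4 > 0"
      using r_pos w_pos by auto
    have design: "euclidean_design 7 X W \<longleftrightarrow>
      r 3 = r 1 \<and> r 4 = r 1 \<and> w 3 = w 1 \<and> w 4 = w 1 \<and> w 2 * r 2 ^ 6 = w 1 * r 1 ^ 6"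
    proof
      assume d: "euclidean_design 7 X W"
      \<comment> \<open>Degree \<open>4 + 2 * i\<close> with \<open>i = 0\<close> and
        \<open>i = 1\<close> stays within strength 7, giving the two powers needed to equate the
        half-spin radii and weights.\<close>
      have "w 4 * r 4 ^ 4 = w 3 * r 3 ^ 4" "w 4 * r 4 ^ 6 = w 3 * r 3 ^ 6"
        using design_imp_half_spin[OF d, of 0] design_imp_half_spin[OF d, of 1] N mem by simp_all
      then have 34: "r 4 = r 3" "w 4 = w 3" using pos eq_of_power_weights by blast+
      then have "w 1 * r 1 ^ 4 = w 3 * r 3 ^ 4" "w 1 * r 1 ^ 6 = w 3 * r 3 ^ 6" "w 2 * r 2 ^ 6 = w 3 * r 3 ^ 6"
        using design_imp_m4[OF d] design_imp_m6[OF d] m by simp_all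
      moreover from this have "r 1 = r 3" "w 1 = w 3" using pos eq_of_power_weights by blast+
      ultimately show "r 3 = r 1 \<and> r 4 = r 1 \<and> w 3 = w 1 \<and> w 4 = w 1 \<and> w 2 * r 2 ^ 6 = w 1 * r 1 ^ 6"
        using 34 by simp
    next
      assume "r 3 = r 1 \<and> r 4 = r 1 \<and> w 3 = w 1 \<and> w 4 = w 1 \<and> w 2 * r 2 ^ 6 = w 1 * r 1 ^ 6"
      then show "euclidean_design 7 X W" using m N mem by (intro design_intro) auto
    qed
    have card: "card X = 48"
      unfolding card_X unfolding Jeq N by (simp add: orbit_size_simps)
    have "dim_parity_poly_on 3 (supporting_spheres X) = 24 \<longleftrightarrow> r 2 \<noteq> r 1" if "r 3 = r 1" "r 4 = r 1"
    proof (cases "r 2 = r 1")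
      case True
      then have "supporting_spheres X = sphere 0 (r 1)" using Jeq that by (intro supporting_spheres_single) auto
      then show ?thesis
        using dim_parity_poly_on_sphere[where 'a='a, of "r 1" 3] pos choose_values(4)[of 4] True N by simp
    next
      case False
      have "sphere 0 (r 2) \<subseteq> supporting_spheres X" "sphere 0 (r 1) \<subseteq> supporting_spheres X"
        unfolding supporting_spheres_X using mem by blast+
      then show ?thesis
        using dim_parity_poly_on_two_spheres[of "r 2" "r 1" "supporting_spheres X" 3] pos choose_values(4)[of 4] N False
        by simp
    qed
    then have "tight_euclidean_design 7 X W \<longleftrightarrow> r 3 = r 1 \<and> r 4 = r 1 \<and> r 2 \<noteq> r 1 \<and>
        w 3 = w 1 \<and> w 4 = w 1 \<and> w 2 * r 2 ^ 6 = w 1 * r 1 ^ 6"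
      unfolding tight_iff using design card by auto
    moreover have "DIM('a) \<noteq> 8" using N by simp
    ultimately show ?thesis using N Jeq by blast
  qed
  have False if N: "DIM('a) = 8" and Jeq: "J = {1, 2, \<sigma>}" and tight: "tight_euclidean_design 7 X W"
  proof -
    have d: "euclidean_design 7 X W" using tight by (simp add: tight_iff)
    have \<sigma>': "\<sigma> = 8 \<or> \<sigma> = 7" using \<sigma>(2) N by auto
    have vals: "S 1 = 1" "S 2 = 2" "n = 8" "S \<sigma> = 8" "u 1 = 16 * w 1" "u 2 = 112 * w 2" "u \<sigma> = 128 * w \<sigma>"
      using \<sigma>' N by (auto simp: S_def n_def u_def support_size_def orbit_size_simps)
    have "m6 = 112 * (w 1 * r 1 ^ 6) + 56 * (w 2 * r 2 ^ 6) - 56 * (w \<sigma> * r \<sigma> ^ 6)"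
      "m6' = 168 * (w 2 * r 2 ^ 6) - 168 * (w \<sigma> * r \<sigma> ^ 6)"
      unfolding m6_def m6'_def unfolding Jeq using \<sigma>' vals by auto
    \<comment> \<open>Orbit 1 does not enter \<open>m6'\<close>, which balances orbits 2 and
      \<sigma>; these then cancel in \<open>m6\<close> and leave the orbit 1 term alone.\<close>
    then have "w 1 * r 1 ^ 6 = 0" using design_imp_m6[OF d] by simp
    then show False using w_pos[of 1] r_pos[of 1] Jeq by simp
  qed
  then show ?thesis
    using tight_7 eight four by metis
qed

lemma tight_classification:
  assumes "t \<ge> 1"
  shows "tight_euclidean_design t X W \<longleftrightarrow>
    t = 7 \<and> DIM('a) = 8 \<and> J = {2, \<sigma>} \<and> r \<sigma> = r 2 \<and> w \<sigma> = w 2 \<or>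
    t = 5 \<and> DIM('a) = 6 \<and> J = {1, \<sigma>} \<and> r \<sigma> \<noteq> r 1 \<and> 8 * w \<sigma> * r \<sigma> ^ 4 = 9 * w 1 * r 1 ^ 4 \<or>
    t = 7 \<and> DIM('a) = 4 \<and> J = {1, 2, 3, 4} \<and> r 3 = r 1 \<and> r 4 = r 1 \<and> r 2 \<noteq> r 1 \<and> w 3 = w 1 \<and> w 4 = w 1 \<and>
      w 2 * r 2 ^ 6 = w 1 * r 1 ^ 6 \<or>
    t = 3 \<and> DIM('a) = 4 \<and> J = {\<sigma>}"
proof -
  have "t \<in> {3, 5, 7}" if tight: "tight_euclidean_design t X W"
  proof -
    have "t \<le> 7" using tight \<sigma>(1) by (intro design_imp_strength_le_7) (auto simp: tight_iff)
    moreover have "t \<noteq> 4" "t \<noteq> 6" using tight not_tight_4 not_tight_6 by auto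
    ultimately show ?thesis using tight_imp_dim_le(1,2)[OF tight] assms by auto
  qed
  then consider "t = 3" | "t = 5" | "t = 7" | "\<not> tight_euclidean_design t X W" "t \<noteq> 3" "t \<noteq> 5" "t \<noteq> 7"
    by blast
  then show ?thesis
  proof cases
    case 1
    show ?thesis unfolding 1 tight_3_iff by simp
  next
    case 2
    show ?thesis unfolding 2 tight_5_iff by simp
  next
    case 3
    show ?thesis unfolding 3 tight_7_iff by simp
  qed simp
qed

end

text \<open>Dividing by the radius and the weight of a reference orbit \<open>i\<close> normalises
  both to 1 there, with independent scaling constants.\<close>

lemma scaling_witness:
  assumes "i \<in> J" "P (\<lambda>k. r k / r i) (\<lambda>k. w k / w i)"
  shows "\<exists>a>0. \<exists>b>0. \<exists>r' w'. (\<forall>k\<in>J. r k = a * r' k \<and> w k = b * w' k) \<and> P r' w'"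
  using assms r_pos[OF assms(1)] w_pos[OF assms(1)]
  by (intro exI[of _ "r i"] exI[of _ "w i"] exI[of _ "\<lambda>k. r k / r i"] exI[of _ "\<lambda>k. w k / w i"] conjI) auto

end

theorem theorem4p11:
  fixes e :: "nat \<Rightarrow> real ^ 'n"
    and n t :: nat
    and J :: "nat set"
    and r w :: "nat \<Rightarrow> real"
    and W :: "real ^ 'n \<Rightarrow> real"
  assumes "n = CARD('n)"
    and "bij_betw e {1..n} Basis"
    and "n \<ge> 4"
    and "t \<ge> 1"
    and "J \<subseteq> {1..n}"
    and "n \<in> J \<or> n - 1 \<in> J"
    and "\<forall>k\<in>J. r k > 0"
    and "\<forall>k\<in>J. w k > 0"
    and "\<forall>k\<in>J. \<forall>x\<in>scaled_corner_orbit e n r k. W x = w k"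
  shows "tight_euclidean_design t (corner_orbit_union e n J r) W \<longleftrightarrow>
    (\<exists>a>0. \<exists>b>0. \<exists>r' w'.
      (\<forall>k\<in>J. r k = a * r' k \<and> w k = b * w' k) \<and>
      (t = 7 \<and> n = 8 \<and> J = {2, 7} \<and> r' 2 = 1 \<and> r' 7 = 1 \<and> w' 2 = 1 \<and> w' 7 = 1 \<or>
       t = 7 \<and> n = 8 \<and> J = {2, 8} \<and> r' 2 = 1 \<and> r' 8 = 1 \<and> w' 2 = 1 \<and> w' 8 = 1 \<or>
       t = 5 \<and> n = 6 \<and> J = {1, 5} \<and> r' 1 = 1 \<and> r' 5 \<noteq> 1 \<and> w' 1 = 1 \<and> w' 5 = 9 / (8 * r' 5 ^ 4) \<or>
       t = 5 \<and> n = 6 \<and> J = {1, 6} \<and> r' 1 = 1 \<and> r' 6 \<noteq> 1 \<and> w' 1 = 1 \<and> w' 6 = 9 / (8 * r' 6 ^ 4) \<or>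
       t = 7 \<and> n = 4 \<and> J = {1, 2, 3, 4} \<and> r' 1 = 1 \<and> r' 3 = 1 \<and> r' 4 = 1 \<and> r' 2 \<noteq> 1 \<and>
         w' 1 = 1 \<and> w' 3 = 1 \<and> w' 4 = 1 \<and> w' 2 = 1 / r' 2 ^ 6 \<or>
       t = 3 \<and> n = 4 \<and> J = {3} \<and> r' 3 = 1 \<and> w' 3 = 1 \<or>
       t = 3 \<and> n = 4 \<and> J = {4} \<and> r' 4 = 1 \<and> w' 4 = 1))"
    (is "?tight \<longleftrightarrow> (\<exists>a>0. \<exists>b>0. \<exists>r' w'. ?scaled a b r' w' \<and> ?cases r' w')")
proof -
  have N: "DIM(real ^ 'n) = n" using assms(1) by simp
  have orbit: "scaled_corner_orbit e n r k = signed_orbit k (r k)" if "k \<in> J" for k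
    using scaled_corner_orbit_eq_signed_orbit[OF assms(2)] assms(3,5) that by auto
  interpret weighted_orbit_union J r w W
    by unfold_locales (use assms(3,5,7-9) N orbit in auto)
  have X: "corner_orbit_union e n J r = X"
    by (simp add: corner_orbit_union_def X_def orbit)
  obtain \<sigma> where \<sigma>: "\<sigma> \<in> J" "\<sigma> = n \<or> \<sigma> = n - 1" using assms(6) by blast
  \<comment> \<open>Scale-invariant form of the list, with \<sigma> standing for either half-spin
    index, so that mirror-image cases are treated together.\<close>
  define classified where "classified \<longleftrightarrow>
    t = 7 \<and> n = 8 \<and> J = {2, \<sigma>} \<and> r \<sigma> = r 2 \<and> w \<sigma> = w 2 \<or>
    t = 5 \<and> n = 6 \<and> J = {1, \<sigma>} \<and> r \<sigma> \<noteq> r 1 \<and> 8 * w \<sigma> * r \<sigma> ^ 4 = 9 * w 1 * r 1 ^ 4 \<or>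
    t = 7 \<and> n = 4 \<and> J = {1, 2, 3, 4} \<and> r 3 = r 1 \<and> r 4 = r 1 \<and> r 2 \<noteq> r 1 \<and> w 3 = w 1 \<and> w 4 = w 1 \<and>
      w 2 * r 2 ^ 6 = w 1 * r 1 ^ 6 \<or>
    t = 3 \<and> n = 4 \<and> J = {\<sigma>}"
  have iff: "?tight \<longleftrightarrow> classified"
  proof -
    have "\<sigma> = DIM(real ^ 'n) \<or> \<sigma> = DIM(real ^ 'n) - 1" using \<sigma>(2) N by simp
    from tight_classification[OF \<sigma>(1) this assms(4)] show ?thesis
      unfolding X classified_def N .
  qed
  show ?thesis
  proof
    assume ?tight
    then have "classified" using iff by simp
    then show "\<exists>a>0. \<exists>b>0. \<exists>r' w'. ?scaled a b r' w' \<and> ?cases r' w'"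
      unfolding classified_def
    proof (elim disjE conjE)
      assume sphere: "t = 7" "n = 8" "J = {2, \<sigma>}" "r \<sigma> = r 2" "w \<sigma> = w 2"
      have pos: "r 2 > 0" "w 2 > 0" using r_pos[of 2] w_pos[of 2] sphere(3) by auto
      have "\<sigma> = 7 \<or> \<sigma> = 8" using \<sigma>(2) sphere(2) by auto
      then show ?thesis
        by (intro scaling_witness[of 2]) (use sphere pos in auto)
    next
      assume five: "t = 5" "n = 6" "J = {1, \<sigma>}" "r \<sigma> \<noteq> r 1" "8 * w \<sigma> * r \<sigma> ^ 4 = 9 * w 1 * r 1 ^ 4"
      have pos: "r 1 > 0" "w 1 > 0" "r \<sigma> > 0" using r_pos[of 1] w_pos[of 1] r_pos[OF \<sigma>(1)] five(3) by auto
      have "w \<sigma> / w 1 = 9 / (8 * (r \<sigma> / r 1) ^ 4)"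
        using five(5) pos by (simp add: field_simps)
      moreover have "\<sigma> = 5 \<or> \<sigma> = 6" using \<sigma>(2) five(2) by auto
      ultimately show ?thesis
        by (intro scaling_witness[of 1]) (use five(1-4) pos in auto)
    next
      assume four: "t = 7" "n = 4" "J = {1, 2, 3, 4}" "r 3 = r 1" "r 4 = r 1" "r 2 \<noteq> r 1" "w 3 = w 1" "w 4 = w 1"
        "w 2 * r 2 ^ 6 = w 1 * r 1 ^ 6"
      have pos: "r 1 > 0" "w 1 > 0" "r 2 > 0" using r_pos[of 1] w_pos[of 1] r_pos[of 2] four(3) by auto
      have "w 2 / w 1 = 1 / (r 2 / r 1) ^ 6"
        using four(9) pos by (simp add: field_simps)
      then show ?thesis
        by (intro scaling_witness[of 1]) (use four(1-8) pos in auto)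
    next
      assume three: "t = 3" "n = 4" "J = {\<sigma>}"
      have pos: "r \<sigma> > 0" "w \<sigma> > 0" using r_pos[OF \<sigma>(1)] w_pos[OF \<sigma>(1)] by auto
      have "\<sigma> = 3 \<or> \<sigma> = 4" using \<sigma>(2) three(2) by auto
      then show ?thesis
        by (intro scaling_witness[of \<sigma>]) (use three pos in auto)
    qed
  next
    have classified if a: "a > 0" and b: "b > 0" and scaled: "?scaled a b r' w'" and cases: "?cases r' w'" for a b r' w'
    proof -
      have r': "r' k > 0" if "k \<in> J" for k
        using r_pos[OF that] scaled a that by (simp add: zero_less_mult_iff)
      have five: "8 * (b * y) * (a * x) ^ 4 = 9 * b * a ^ 4" if "y = 9 / (8 * x ^ 4)" "x > 0" for x y
        using that by (simp add: power_mult_distrib)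
      have four: "(b * y) * (a * x) ^ 6 = b * a ^ 6" if "y = 1 / x ^ 6" "x > 0" for x y
        using that by (simp add: power_mult_distrib)
      show classified
        using cases
      proof (elim disjE conjE)
        assume *: "t = 7" "n = 8" "J = {2, 7}" "r' 2 = 1" "r' 7 = 1" "w' 2 = 1" "w' 7 = 1"
        then have "\<sigma> = 7" using \<sigma> by auto
        then show ?thesis unfolding classified_def using * scaled by simp
      next
        assume *: "t = 7" "n = 8" "J = {2, 8}" "r' 2 = 1" "r' 8 = 1" "w' 2 = 1" "w' 8 = 1"
        then have "\<sigma> = 8" using \<sigma> by auto
        then show ?thesis unfolding classified_def using * scaled by simp
      next
        assume *: "t = 5" "n = 6" "J = {1, 5}" "r' 1 = 1" "r' 5 \<noteq> 1" "w' 1 = 1" "w' 5 = 9 / (8 * r' 5 ^ 4)"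
        then have "\<sigma> = 5" using \<sigma> by auto
        then show ?thesis unfolding classified_def using * scaled a five[OF *(7) r'] by simp
      next
        assume *: "t = 5" "n = 6" "J = {1, 6}" "r' 1 = 1" "r' 6 \<noteq> 1" "w' 1 = 1" "w' 6 = 9 / (8 * r' 6 ^ 4)"
        then have "\<sigma> = 6" using \<sigma> by auto
        then show ?thesis unfolding classified_def using * scaled a five[OF *(7) r'] by simp
      next
        assume *: "t = 7" "n = 4" "J = {1, 2, 3, 4}" "r' 1 = 1" "r' 3 = 1" "r' 4 = 1" "r' 2 \<noteq> 1"
          "w' 1 = 1" "w' 3 = 1" "w' 4 = 1" "w' 2 = 1 / r' 2 ^ 6"
        then show ?thesis unfolding classified_def using scaled a four[OF *(11) r'] by simp
      next
        assume *: "t = 3" "n = 4" "J = {3}" "r' 3 = 1" "w' 3 = 1"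
        then show ?thesis unfolding classified_def using \<sigma> by auto
      next
        assume *: "t = 3" "n = 4" "J = {4}" "r' 4 = 1" "w' 4 = 1"
        then show ?thesis unfolding classified_def using \<sigma> by auto
      qed
    qed
    note main = this
    assume "\<exists>a>0. \<exists>b>0. \<exists>r' w'. ?scaled a b r' w' \<and> ?cases r' w'"
    then have classified
      by (elim exE conjE) (rule main)
    then show ?tight using iff by simp
  qed
qed

end
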